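(* Suppose the error assumptions (E1)–(E7) hold, the variances of the idiosyncratic innovations $\varepsilon_t^{(0,\nu)}$ are bounded uniformly in $t$, and $0<\liminf_{T}\lambda_{\min}(\Gamma_T^{(\nu)})<\limsup_T\lambda_{\max}(\Gamma_T^{(\nu)})<\infty$ for $\nu=1,\dots,d$. (i) If the regularization parameter $\lambda_T\ge0$ is non-random with $\lambda_T=o(1)$, then $\sqrt T(\widehat{\boldsymbol\beta}^{(R)}_{T\nu}-\boldsymbol\beta_\nu)$ is $\mathcal{AN}(\mathbf 0,\Sigma_{\mathbf x}^{-1}\Gamma_T^{(\nu)}\Sigma_{\mathbf x}^{-1})$ for $\nu=1,\dots,d$. (ii) If the regularization parameter $\lambda_T\ge0$ is random with $\mathbb E(\lambda_T^2)=o(1)$ as $T\to\infty$, then $\sqrt T(\widehat{\boldsymbol\beta}^{(R)}_{T\nu}-\boldsymbol\beta_\nu)$ is $\mathcal{AN}(\mathbf 0,\Sigma_{\mathbf x}^{-1}\Gamma_T^{(\nu)}\Sigma_{\mathbf x}^{-1})$ for $\nu=1,\dots,d$.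
   Context: Setting: regressors $\mathbf x_t\in\mathbb R^p$, spatial locations $\mathbf s_t\in[0,1]^q$, responses $Y_t^{(\nu)}=\mathbf x_t^\top\boldsymbol\beta_\nu+\epsilon_t^{(\nu)}$, $\nu=1,\dots,d$, $t=1,\dots,T$; probabilities are conditional on the regressors. $\mathbb X_T=(\mathbf x_1,\dots,\mathbf x_T)^\top$ full rank, $\mathbf Y_T^{(\nu)}=(Y_1^{(\nu)},\dots,Y_T^{(\nu)})^\top$, ridge estimator $\widehat{\boldsymbol\beta}^{(R)}_{T\nu}=(\mathbb X_T^\top\mathbb X_T+\lambda_T\mathbb I)^{-1}\mathbb X_T^\top\mathbf Y_T^{(\nu)}$. Standing regressor assumption (R): regressors bounded; there exist positive definite $\Sigma_{\mathbf x}$, $\eta\ge0$, $C<\infty$, compact interval $A\subset(0,\infty)$, independent of $T,p$, with $\|T^{-1}\sum_t\mathbf x_t\mathbf x_t^\top-\Sigma_{\mathbf x}\|_2\le Cp^\eta/\sqrt T$ and $\operatorname{spec}(T^{-1}\mathbb X_T^\top\mathbb X_T)\subset A$. $\Gamma_T^{(\nu)}=T^{-1}\sum_{s=1}^T\sum_{t=1}^T\mathbf x_s\mathbf x_t^\top\operatorname{Cov}(\epsilon_s^{(\nu)},\epsilon_t^{(\nu)})$. Asymptotic normality: $\mathbf Z_n$ is $\mathcal{AN}(\boldsymbol\mu_n,\Sigma_n)$ if for every $\mathbf a$ with $\mathbf a^\top\Sigma_n\mathbf a>0$ for all large $n$, $(\mathbf a^\top\mathbf Z_n-\mathbf a^\top\boldsymbol\mu_n)/(\mathbf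 a^\top\Sigma_n\mathbf a)^{1/2}\xrightarrow{d}\mathcal N(0,1)$. Error model: $\boldsymbol\epsilon_t=\mathbf H(\mathbf U_t(\mathbf s_t),\dots,\mathbf U_{t-m}(\mathbf s_t))-\mathbb E\,\mathbf H(\mathbf U_t(\mathbf s_t),\dots,\mathbf U_{t-m}(\mathbf s_t))$, $m\in\mathbb N_0$ fixed, $\mathbf H=(H_1,\dots,H_d):\mathbb R^{d\times(m+1)}\to\mathbb R^d$; the $\nu$th coordinate of $\mathbf U_t(\mathbf s)$ is $\sum_{\ell=1}^L\phi_{\nu\ell}d(\mathbf s,\mathbf r_\ell)F_t^{(\ell,\nu)}+E_t^{(\nu)}$ with fixed $L$, real $\phi_{\nu\ell}$, sites $\mathbf r_\ell\in[0,1]^q$, a function $d:[0,1]^q\times[0,1]^q\to[0,1]$, $\mathbf F_t^{(\ell)}=\sum_{j\ge0}\mathbb C_j^{(\ell)}\boldsymbol\varepsilon_{t-j}^{(\ell)}$, idiosyncratic noise $\mathbf E_t=\sum_{j\ge0}\mathbb C_j^{(0)}\boldsymbol\varepsilon_{t-j}^{(0)}$, $d\times d$ matrices $\mathbb C_j^{(\ell)}$ with rows $\mathbf c_j^{(\ell,\nu)\top}$; $\varepsilon_t^{(\ell,\nu)}$ is the $\nu$th coordinate of $\boldsymbol\varepsilon_t^{(\ell)}$. (E1) $\{\boldsymbol\varepsilon_t^{(\ell)}\}_t$, $\ell=0,\dots,L$, mutually independent sequences of independent mean zero vectors $\boldsymbol\varepsilon_t^{(\ell)}=\Sigma_{\varepsilon,t}^{(\ell)1/2}\mathbf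 u_t^{(\ell)}$, $\Sigma_{\varepsilon,t}^{(\ell)}$ symmetric positive definite, $\mathbf u_t^{(\ell)}$ mean zero with independent coordinates. (E2) $\sup_t\max_\ell\max_\nu\mathbb E|\varepsilon_t^{(\ell,\nu)}|^{2+\delta}<\infty$ for some $\delta>0$. (E3) If $d=1$: $\sup_t\max_\ell\mathbb E(\varepsilon_t^{(\ell)})^2<\infty$. (E4) If $d=1$: $\mathbb E(\varepsilon_t^{(0)})^2\ge\underline\sigma_0^2>0$; if $d>1$: $\lambda_{\min}(\Sigma_{\varepsilon,t}^{(0)})\ge\underline\lambda>0$. (E5) $\varepsilon_t^{(\ell,\nu)}$ has density $p_t^{(\ell,\nu)}$ with $\sup_t\int|p_t^{(\ell,\nu)}(z+x)-p_t^{(\ell,\nu)}(z)|dz=O(|x|)$. (E6) $\max_\ell\max_\nu\|\mathbf c_j^{(\ell,\nu)}\|_\infty\le C\max(j,1)^{-7/2-\theta}$, some $\theta>0$. (E7) each $H_\nu$ is $L_H$-Lipschitz w.r.t. the Frobenius norm, and some random $d\times(m+1)$ matrix $\Xi$ independent of $\{\mathbf U_t\}$ has $\sup_\nu\mathbb E|H_\nu(\Xi)|^{2+\delta}<\infty$. *)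

theory Defs
  imports "HOL-Probability.Probability"
begin

text \<open>Linear process with coefficient matrices Cm l j (row nu = c_j^(l,nu)) driven by
  the innovations eps l t (t :: int).  l = 0 gives the idiosyncratic noise E_t,
  l = 1..L the factors F_t^(l).\<close>
definition lin_proc ::
  "(nat \<Rightarrow> nat \<Rightarrow> real^'d^'d) \<Rightarrow> (nat \<Rightarrow> int \<Rightarrow> 'a \<Rightarrow> real^'d) \<Rightarrow> nat \<Rightarrow> int \<Rightarrow> 'a \<Rightarrow> real^'d"
  where "lin_proc Cm eps l t \<omega> = (\<Sum>j. Cm l j *v eps l (t - int j) \<omega>)"

definition U_field ::
  "nat \<Rightarrow> ('d \<Rightarrow> nat \<Rightarrow> real) \<Rightarrow> (real^'q \<Rightarrow> real^'q \<Rightarrow> real) \<Rightarrow> (nat \<Rightarrow> real^'q)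
   \<Rightarrow> (nat \<Rightarrow> nat \<Rightarrow> real^'d^'d) \<Rightarrow> (nat \<Rightarrow> int \<Rightarrow> 'a \<Rightarrow> real^'d) \<Rightarrow> int \<Rightarrow> real^'q \<Rightarrow> 'a \<Rightarrow> real^'d"
  where "U_field L phi dd r Cm eps t s \<omega> =
    (\<chi> \<nu>. (\<Sum>l=1..L. phi \<nu> l * dd s (r l) * lin_proc Cm eps l t \<omega> $ \<nu>) + lin_proc Cm eps 0 t \<omega> $ \<nu>)"

text \<open>The d x (m+1) matrix (U_t(s_t), ..., U_{t-m}(s_t)), columns indexed by k = 0..m.\<close>
definition H_arg ::
  "nat \<Rightarrow> (int \<Rightarrow> real^'q \<Rightarrow> 'a \<Rightarrow> real^'d) \<Rightarrow> (nat \<Rightarrow> real^'q) \<Rightarrow> nat \<Rightarrow> 'a \<Rightarrow> nat \<Rightarrow> real^'d"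
  where "H_arg m U s t \<omega> = (\<lambda>k. if k \<le> m then U (int t - int k) (s t) \<omega> else 0)"

definition err_proc ::
  "'a measure \<Rightarrow> ((nat \<Rightarrow> real^'d) \<Rightarrow> real^'d) \<Rightarrow> nat \<Rightarrow> (int \<Rightarrow> real^'q \<Rightarrow> 'a \<Rightarrow> real^'d)
   \<Rightarrow> (nat \<Rightarrow> real^'q) \<Rightarrow> nat \<Rightarrow> 'd \<Rightarrow> 'a \<Rightarrow> real"
  where "err_proc M H m U s t \<nu> \<omega> =
    H (H_arg m U s t \<omega>) $ \<nu> - (\<integral>\<omega>'. H (H_arg m U s t \<omega>') $ \<nu> \<partial>M)"

definition covar :: "'a measure \<Rightarrow> ('a \<Rightarrow> real) \<Rightarrow> ('a \<Rightarrow> real) \<Rightarrow> real"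
  where "covar M X Y = (\<integral>\<omega>. (X \<omega> - (\<integral>\<omega>. X \<omega> \<partial>M)) * (Y \<omega> - (\<integral>\<omega>. Y \<omega> \<partial>M)) \<partial>M)"

definition Gamma_mat :: "'a measure \<Rightarrow> (nat \<Rightarrow> real^'p) \<Rightarrow> (nat \<Rightarrow> 'a \<Rightarrow> real) \<Rightarrow> nat \<Rightarrow> real^'p^'p"
  where "Gamma_mat M x e T =
    (\<chi> i j. (1 / real T) * (\<Sum>s=1..T. \<Sum>t=1..T. x s $ i * x t $ j * covar M (e s) (e t)))"

definition gram :: "(nat \<Rightarrow> real^'p) \<Rightarrow> nat \<Rightarrow> real^'p^'p"
  where "gram x T = (\<chi> i j. \<Sum>t=1..T. x t $ i * x t $ j)"

definition ridge :: "(nat \<Rightarrow> real^'p) \<Rightarrow> (nat \<Rightarrow> real) \<Rightarrow> nat \<Rightarrow> real \<Rightarrow> real^'p"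
  where "ridge x Y T lam = matrix_inv (gram x T + lam *\<^sub>R mat 1) *v (\<Sum>t=1..T. Y t *\<^sub>R x t)"

definition real_eigs :: "real^'n^'n \<Rightarrow> real set"
  where "real_eigs A = {\<mu>. \<exists>v. v \<noteq> 0 \<and> A *v v = \<mu> *\<^sub>R v}"

definition lambda_min :: "real^'n^'n \<Rightarrow> real" where "lambda_min A = Min (real_eigs A)"
definition lambda_max :: "real^'n^'n \<Rightarrow> real" where "lambda_max A = Max (real_eigs A)"

definition sym_pd :: "real^'n^'n \<Rightarrow> bool"
  where "sym_pd A \<longleftrightarrow> transpose A = A \<and> (\<forall>v. v \<noteq> 0 \<longrightarrow> 0 < v \<bullet> (A *v v))"

definition AN :: "'a measure \<Rightarrow> (nat \<Rightarrow> 'a \<Rightarrow> real^'p) \<Rightarrow> (nat \<Rightarrow> real^'p) \<Rightarrow> (nat \<Rightarrow> real^'p^'p) \<Rightarrow> bool"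
  where "AN M Z mu S \<longleftrightarrow>
    (\<forall>a. (\<forall>\<^sub>F n in sequentially. 0 < a \<bullet> (S n *v a)) \<longrightarrow>
      weak_conv_m (\<lambda>n. distr M borel (\<lambda>\<omega>. (a \<bullet> Z n \<omega> - a \<bullet> mu n) / sqrt (a \<bullet> (S n *v a))))
        std_normal_distribution)"

end

theory Submission
  imports Defs
begin

text \<open>
  Let \<open>e\<^sub>t\<^sup>(\<^sup>k\<^sup>,\<^sup>b\<^sup>)\<close> be the error obtained by cutting the linear
  processes at lag \<open>k\<close> and clipping the innovations at \<open>b\<close>. Since \<open>H\<close> is Lipschitz and the
  coefficients decay faster than \<open>j\<^sup>-\<^sup>3\<close>, the \<open>L\<^sup>2\<close>-distance of an error to its lag-\<open>h\<close> version is
  summable in \<open>h\<close>. As the lag-\<open>(t - s)\<close> version of the time-\<open>t\<close> error is independent of the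
  time-\<open>s\<close> error, this makes the covariances of \<open>e\<^sub>t - e\<^sub>t\<^sup>(\<^sup>k\<^sup>,\<^sup>b\<^sup>)\<close> summable with a total that vanishes as
  \<open>k, b \<rightarrow> \<infinity>\<close>: normalised weighted sums of the errors are \<open>L\<^sup>2\<close>-close, uniformly in \<open>T\<close>, to those of
  a bounded process with finite range of dependence. For the latter, removing the window of
  dependent summands around each time shows that the characteristic function nearly solves
  \<open>\<phi>' = - \<theta> \<sigma>\<^sup>2 \<phi>\<close> with an error of order \<open>T\<^sup>-\<^sup>1\<^sup>/\<^sup>2\<close>. Finally
  \<open>\<surd>T (\<beta>\<^sub>R - \<beta>)\<close> differs from \<open>\<Sigma>\<^sub>x\<^sup>-\<^sup>1 T\<^sup>-\<^sup>1\<^sup>/\<^sup>2 \<Sum>\<^sub>t x\<^sub>t e\<^sub>t\<close> by a term of order \<open>T\<^sup>-\<^sup>1\<^sup>/\<^sup>2\<close> in \<open>L\<^sup>1\<close>, by the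
  resolvent identity. A non-random penalty is a special case of a random one.
\<close>

section \<open>Square-integrable random variables\<close>

text \<open>\<open>Gamma_mat\<close> need not converge, so there is no limiting variance to aim at.
  In a direction \<open>a\<close>, with \<open>b = matrix_inv S *v a\<close>, the quotient of
  \<open>b \<bullet> x t\<close> and the standard deviation serves as a weight depending on
  \<open>T\<close>: the normalised sum then has variance exactly one, and the lower eigenvalue bound
  keeps the weights bounded. The obstacle is that an approximation error must stay small after
  \<open>T\<close> dependent terms have been added. Cauchy-Schwarz splits each covariance into the
  L2 size of one difference and the L2 distance of the other from its lag version. The first factor
  is small for large cut-offs; the second has a bound that does not involve the cut-offs and needs
  only to be summable. Coefficients of order \<open>j powr (-3)\<close> have tails of order
  \<open>k powr (-2)\<close>, which are summable. Clipping supplies the bounded summands that the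
  remainder of the characteristic function requires, while only moments of order
  \<open>2 + \<delta>\<close> are at hand. The cut-offs are fixed before \<open>T\<close> grows, so
  the constants of the bounded problem may depend on them badly.\<close>

definition square_integrable :: "'a measure \<Rightarrow> ('a \<Rightarrow> real) \<Rightarrow> bool"
  where "square_integrable M X \<longleftrightarrow> X \<in> borel_measurable M \<and> integrable M (\<lambda>\<omega>. (X \<omega>)\<^sup>2)"

lemma square_integrable_measurable [measurable_dest]:
  "square_integrable M X \<Longrightarrow> X \<in> borel_measurable M"
  by (simp add: square_integrable_def)

lemma square_integrable_bound:
  assumes X: "square_integrable M X" and [measurable]: "Y \<in> borel_measurable M"
    and le: "AE \<omega> in M. \<bar>Y \<omega>\<bar> \<le> \<bar>X \<omega>\<bar>"
  shows "square_integrable M Y"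
  unfolding square_integrable_def
proof
  show "integrable M (\<lambda>\<omega>. (Y \<omega>)\<^sup>2)"
    using X unfolding square_integrable_def
  proof (elim conjE Bochner_Integration.integrable_bound)
    show "AE \<omega> in M. norm ((Y \<omega>)\<^sup>2) \<le> norm ((X \<omega>)\<^sup>2)"
      using le by eventually_elim (simp add: abs_le_square_iff)
  qed measurable
qed fact

lemma square_integrable_mult:
  assumes X: "square_integrable M X" and Y: "square_integrable M Y"
  shows "integrable M (\<lambda>\<omega>. X \<omega> * Y \<omega>)"
proof (rule Bochner_Integration.integrable_bound)
  show "integrable M (\<lambda>\<omega>. (X \<omega>)\<^sup>2 + (Y \<omega>)\<^sup>2)"
    using X Y by (auto simp: square_integrable_def)
  note [measurable] = X Y
  show "(\<lambda>\<omega>. X \<omega> * Y \<omega>) \<in> borel_measurable M"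
    by measurable
  have "\<bar>x * y\<bar> \<le> x\<^sup>2 + y\<^sup>2" for x y :: real
  proof -
    have "2 * \<bar>x * y\<bar> \<le> x\<^sup>2 + y\<^sup>2"
      using sum_squares_bound[of "\<bar>x\<bar>" "\<bar>y\<bar>"] by (simp add: abs_mult)
    then show ?thesis using abs_ge_zero[of "x * y"] by linarith
  qed
  then show "AE \<omega> in M. norm (X \<omega> * Y \<omega>) \<le> norm ((X \<omega>)\<^sup>2 + (Y \<omega>)\<^sup>2)"
    by (auto simp: abs_mult)
qed

lemma square_integrable_cmult:
  "square_integrable M X \<Longrightarrow> square_integrable M (\<lambda>\<omega>. c * X \<omega>)"
  by (auto simp: square_integrable_def power_mult_distrib)

lemma square_integrable_add:
  assumes X: "square_integrable M X" and Y: "square_integrable M Y"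
  shows "square_integrable M (\<lambda>\<omega>. X \<omega> + Y \<omega>)"
  using square_integrable_mult[OF X Y] X Y
  by (auto simp: square_integrable_def power2_sum mult.assoc)

lemma square_integrable_diff:
  assumes X: "square_integrable M X" and Y: "square_integrable M Y"
  shows "square_integrable M (\<lambda>\<omega>. X \<omega> - Y \<omega>)"
  using square_integrable_add[OF X square_integrable_cmult[OF Y, of "-1"]] by simp

lemma square_integrable_sum:
  assumes "\<And>i. i \<in> A \<Longrightarrow> square_integrable M (X i)"
  shows "square_integrable M (\<lambda>\<omega>. \<Sum>i\<in>A. X i \<omega>)"
  using assms
proof (induction A rule: infinite_finite_induct)
  case (insert i A)
  then show ?case by (simp add: square_integrable_add)
qed (simp_all add: square_integrable_def)

text \<open>Cauchy-Schwarz from the quadratic \<open>t\<^sup>2 * a + 2 * t * b + c\<close>, which is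
  the second moment of \<open>t * X + Y\<close> and so never negative.\<close>

lemma abs_integral_mult_le:
  assumes X: "square_integrable M X" and Y: "square_integrable M Y"
  shows "\<bar>\<integral>\<omega>. X \<omega> * Y \<omega> \<partial>M\<bar> \<le> sqrt (\<integral>\<omega>. (X \<omega>)\<^sup>2 \<partial>M) * sqrt (\<integral>\<omega>. (Y \<omega>)\<^sup>2 \<partial>M)"
proof -
  define a b c where "a = (\<integral>\<omega>. (X \<omega>)\<^sup>2 \<partial>M)" and "b = (\<integral>\<omega>. X \<omega> * Y \<omega> \<partial>M)" and "c = (\<integral>\<omega>. (Y \<omega>)\<^sup>2 \<partial>M)"
  have nonneg: "0 \<le> a" "0 \<le> c" by (simp_all add: a_def c_def)
  have q: "0 \<le> t\<^sup>2 * a + 2 * t * b + c" for t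
  proof -
    have "0 \<le> (\<integral>\<omega>. (t * X \<omega> + Y \<omega>)\<^sup>2 \<partial>M)" by simp
    also have "\<dots> = (\<integral>\<omega>. t\<^sup>2 * (X \<omega>)\<^sup>2 + 2 * t * (X \<omega> * Y \<omega>) + (Y \<omega>)\<^sup>2 \<partial>M)"
      by (simp add: power2_sum power_mult_distrib algebra_simps)
    also have "\<dots> = t\<^sup>2 * a + 2 * t * b + c"
      using X Y square_integrable_mult[OF X Y] by (simp add: a_def b_def c_def square_integrable_def)
    finally show ?thesis .
  qed
  have "b\<^sup>2 \<le> a * c"
  proof (cases "a = 0")
    case True
    have "b = 0"
    proof (rule ccontr)
      assume "b \<noteq> 0"
      \<comment> \<open>At this point the affine function \<open>2 * t * b + c\<close> takes the
        value -1.\<close>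
      with q[of "- (c + 1) / (2 * b)"] True show False by (simp add: field_simps)
    qed
    then show ?thesis using True by simp
  next
    case False
    \<comment> \<open>\<open>- b / a\<close> minimises the quadratic; multiplication by
      \<open>a\<close> turns the minimum into \<open>a * c - b\<^sup>2\<close>.\<close>
    with q[of "- b / a"] nonneg have "0 \<le> a * ((- b / a)\<^sup>2 * a + 2 * (- b / a) * b + c)"
      by (intro mult_nonneg_nonneg) auto
    also have "a * ((- b / a)\<^sup>2 * a + 2 * (- b / a) * b + c) = a * c - b\<^sup>2"
      using False by (simp add: field_simps power2_eq_square)
    finally show ?thesis by simp
  qed
  then have "sqrt (b\<^sup>2) \<le> sqrt (a * c)" by (rule real_sqrt_le_mono)
  then show ?thesis by (simp add: real_sqrt_mult a_def b_def c_def)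
qed

text \<open>The moment assumptions are stated with the nonnegative integral, which makes sense
  before integrability is known. Such a bound yields integrability and a bound on the Bochner
  integral at once.\<close>

lemma square_integrable_nn_integral:
  assumes [measurable]: "X \<in> borel_measurable M" and "0 \<le> \<kappa>"
    and le: "(\<integral>\<^sup>+\<omega>. ennreal ((X \<omega>)\<^sup>2) \<partial>M) \<le> ennreal \<kappa>"
  shows "square_integrable M X" and "(\<integral>\<omega>. (X \<omega>)\<^sup>2 \<partial>M) \<le> \<kappa>"
proof -
  have int: "integrable M (\<lambda>\<omega>. (X \<omega>)\<^sup>2)"
    using le by (intro integrableI_nonneg) (auto simp: less_top[symmetric] top_unique)
  then show "square_integrable M X" by (simp add: square_integrable_def)
  have "ennreal (\<integral>\<omega>. (X \<omega>)\<^sup>2 \<partial>M) = (\<integral>\<^sup>+\<omega>. ennreal ((X \<omega>)\<^sup>2) \<partial>M)"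
    using int by (intro nn_integral_eq_integral[symmetric]) auto
  also note le
  finally show "(\<integral>\<omega>. (X \<omega>)\<^sup>2 \<partial>M) \<le> \<kappa>"
    using \<open>0 \<le> \<kappa>\<close> by (simp only: ennreal_le_iff)
qed

section \<open>Lipschitz and Taylor bounds for exponentials\<close>

lemma abs_exp_minus_diff_le:
  fixes x y :: real
  assumes "0 \<le> x" "0 \<le> y"
  shows "\<bar>exp (- x) - exp (- y)\<bar> \<le> \<bar>x - y\<bar>"
proof -
  have *: "\<bar>exp (- x) - exp (- y)\<bar> \<le> \<bar>x - y\<bar>" if "0 \<le> x" "x \<le> y" for x y :: real
  proof -
    have "exp (- x) - exp (- y) = exp (- x) * (1 - exp (- (y - x)))"
      by (simp add: right_diff_distrib exp_add[symmetric])
    also have "\<dots> \<le> 1 * (1 - exp (- (y - x)))"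
      using that by (intro mult_right_mono) auto
    also have "\<dots> \<le> y - x"
      using exp_ge_add_one_self[of "x - y"] unfolding minus_diff_eq mult_1_left by linarith
    finally show ?thesis using that by simp
  qed
  show ?thesis
    using *[of x y] *[of y x] assms by (cases "x \<le> y") (auto simp: abs_minus_commute)
qed

lemma norm_iexp_diff_le: "norm (iexp x - iexp y) \<le> \<bar>x - y\<bar>"
proof -
  have "iexp x - iexp y = iexp y * (iexp (x - y) - 1)"
    by (simp add: right_diff_distrib exp_diff of_real_diff)
  then have "norm (iexp x - iexp y) = norm (iexp (x - y) - 1)"
    by (simp add: norm_mult)
  also have "\<dots> \<le> \<bar>x - y\<bar>"
    using iexp_approx1[of "x - y" 0] by simp
  finally show ?thesis .
qed

lemma norm_iexp_linear_le: "norm (iexp x - 1 - \<i> * x) \<le> x\<^sup>2 / 2"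
  using iexp_approx1[of x 1] by (simp add: diff_diff_eq power2_eq_square fact_numeral)

section \<open>Covariances, second moments and characteristic functions\<close>

context prob_space
begin

lemma square_integrable_const: "square_integrable M (\<lambda>_. c)"
  by (simp add: square_integrable_def)

lemma square_integrable_integrable: "square_integrable M X \<Longrightarrow> integrable M X"
  by (auto simp: square_integrable_def intro: square_integrable_imp_integrable)

lemma square_integrable_bounded:
  assumes "X \<in> borel_measurable M" "\<And>\<omega>. \<omega> \<in> space M \<Longrightarrow> \<bar>X \<omega>\<bar> \<le> B"
  shows "square_integrable M X"
  using assms(2) by (intro square_integrable_bound[OF square_integrable_const[of B] assms(1)]) fastforce

lemma covar_eq:
  assumes X: "square_integrable M X" and Y: "square_integrable M Y"
  shows "covar M X Y = expectation (\<lambda>\<omega>. X \<omega> * Y \<omega>) - expectation X * expectation Y"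
proof -
  note int = square_integrable_integrable[OF X] square_integrable_integrable[OF Y]
    square_integrable_mult[OF X Y]
  have "covar M X Y = expectation (\<lambda>\<omega>. X \<omega> * Y \<omega> - X \<omega> * expectation Y - expectation X * Y \<omega> + expectation X * expectation Y)"
    unfolding covar_def by (intro Bochner_Integration.integral_cong) (auto simp: algebra_simps)
  also have "\<dots> = expectation (\<lambda>\<omega>. X \<omega> * Y \<omega>) - expectation X * expectation Y"
    using int by (simp add: prob_space)
  finally show ?thesis .
qed

lemma covar_diff_right:
  assumes "square_integrable M X" "square_integrable M Y" "square_integrable M Z"
  shows "covar M X (\<lambda>\<omega>. Y \<omega> - Z \<omega>) = covar M X Y - covar M X Z"
  using assms by (simp add: covar_eq square_integrable_diff square_integrable_mult
      square_integrable_integrable right_diff_distrib)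

lemma covar_commute: "covar M X Y = covar M Y X"
  by (simp add: covar_def mult.commute)

lemma expectation_centered_square_le:
  assumes X: "square_integrable M X"
  shows "expectation (\<lambda>\<omega>. (X \<omega> - expectation X)\<^sup>2) \<le> expectation (\<lambda>\<omega>. (X \<omega>)\<^sup>2)"
  using covar_eq[OF X X] by (simp add: covar_def power2_eq_square)

lemma abs_covar_le:
  assumes X: "square_integrable M X" and Y: "square_integrable M Y"
  shows "\<bar>covar M X Y\<bar> \<le> sqrt (expectation (\<lambda>\<omega>. (X \<omega>)\<^sup>2)) * sqrt (expectation (\<lambda>\<omega>. (Y \<omega>)\<^sup>2))"
proof -
  have "\<bar>covar M X Y\<bar> \<le> sqrt (expectation (\<lambda>\<omega>. (X \<omega> - expectation X)\<^sup>2)) * sqrt (expectation (\<lambda>\<omega>. (Y \<omega> - expectation Y)\<^sup>2))"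
    unfolding covar_def by (intro abs_integral_mult_le square_integrable_diff X Y square_integrable_const)
  also have "\<dots> \<le> sqrt (expectation (\<lambda>\<omega>. (X \<omega>)\<^sup>2)) * sqrt (expectation (\<lambda>\<omega>. (Y \<omega>)\<^sup>2))"
    by (intro mult_mono real_sqrt_le_mono expectation_centered_square_le X Y) auto
  finally show ?thesis .
qed

lemma expectation_abs_le_sqrt:
  assumes X: "square_integrable M X"
  shows "expectation (\<lambda>\<omega>. \<bar>X \<omega>\<bar>) \<le> sqrt (expectation (\<lambda>\<omega>. (X \<omega>)\<^sup>2))"
proof -
  have "square_integrable M (\<lambda>\<omega>. \<bar>X \<omega>\<bar>)"
    using X by (auto simp: square_integrable_def)
  from abs_integral_mult_le[OF this square_integrable_const[of 1]] show ?thesis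
    by (simp add: prob_space)
qed

lemma expectation_weighted_sum_square:
  assumes "\<And>t. t \<in> I \<Longrightarrow> square_integrable M (D t)"
  shows "expectation (\<lambda>\<omega>. (\<Sum>t\<in>I. a t * (D t \<omega> - expectation (D t)))\<^sup>2)
    = (\<Sum>s\<in>I. \<Sum>t\<in>I. a s * a t * covar M (D s) (D t))"
proof -
  have int: "integrable M (\<lambda>\<omega>. (D s \<omega> - expectation (D s)) * (D t \<omega> - expectation (D t)))"
    if "s \<in> I" "t \<in> I" for s t
    by (intro square_integrable_mult square_integrable_diff assms that square_integrable_const)
  have "expectation (\<lambda>\<omega>. (\<Sum>t\<in>I. a t * (D t \<omega> - expectation (D t)))\<^sup>2)
     = expectation (\<lambda>\<omega>. \<Sum>s\<in>I. \<Sum>t\<in>I. a s * a t * ((D s \<omega> - expectation (D s)) * (D t \<omega> - expectation (D t))))"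
    by (simp add: power2_eq_square sum_product mult_ac)
  also have "\<dots> = (\<Sum>s\<in>I. \<Sum>t\<in>I. a s * a t * covar M (D s) (D t))"
    using int by (simp add: covar_def)
  finally show ?thesis .
qed

lemma square_mean_add_le:
  assumes X: "square_integrable M X" and Y: "square_integrable M Y"
  shows "expectation (\<lambda>\<omega>. (X \<omega> + Y \<omega>)\<^sup>2) \<le> 2 * expectation (\<lambda>\<omega>. (X \<omega>)\<^sup>2) + 2 * expectation (\<lambda>\<omega>. (Y \<omega>)\<^sup>2)"
proof -
  have "expectation (\<lambda>\<omega>. (X \<omega> + Y \<omega>)\<^sup>2) \<le> expectation (\<lambda>\<omega>. 2 * (X \<omega>)\<^sup>2 + 2 * (Y \<omega>)\<^sup>2)"
  proof (rule integral_mono)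
    show "(X \<omega> + Y \<omega>)\<^sup>2 \<le> 2 * (X \<omega>)\<^sup>2 + 2 * (Y \<omega>)\<^sup>2" for \<omega>
      using sum_squares_bound[of "X \<omega>" "Y \<omega>"] by (simp add: power2_sum)
  qed (use X Y square_integrable_add[OF X Y] in \<open>auto simp: square_integrable_def\<close>)
  also have "\<dots> = 2 * expectation (\<lambda>\<omega>. (X \<omega>)\<^sup>2) + 2 * expectation (\<lambda>\<omega>. (Y \<omega>)\<^sup>2)"
    using X Y by (simp add: square_integrable_def)
  finally show ?thesis .
qed

text \<open>\<open>iexp\<close> is Lipschitz with constant 1, so closeness in mean carries over to
  characteristic functions at each fixed argument.\<close>

lemma norm_expectation_iexp_diff_le:
  assumes X[measurable]: "X \<in> borel_measurable M" and Y[measurable]: "Y \<in> borel_measurable M"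
    and D: "integrable M D" and le: "AE \<omega> in M. \<bar>X \<omega> - Y \<omega>\<bar> \<le> D \<omega>"
  shows "norm (expectation (\<lambda>\<omega>. iexp (X \<omega>)) - expectation (\<lambda>\<omega>. iexp (Y \<omega>))) \<le> expectation D"
proof -
  have int: "integrable M (\<lambda>\<omega>. iexp (X \<omega>))" "integrable M (\<lambda>\<omega>. iexp (Y \<omega>))"
    by (auto intro!: integrable_iexp)
  then have "norm (expectation (\<lambda>\<omega>. iexp (X \<omega>)) - expectation (\<lambda>\<omega>. iexp (Y \<omega>)))
      = norm (expectation (\<lambda>\<omega>. iexp (X \<omega>) - iexp (Y \<omega>)))" by simp
  also have "\<dots> \<le> expectation (\<lambda>\<omega>. norm (iexp (X \<omega>) - iexp (Y \<omega>)))"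
    by (rule integral_norm_bound)
  also have "\<dots> \<le> expectation D"
    using le int D
    by (intro integral_mono_AE integrable_norm Bochner_Integration.integrable_diff)
      (auto elim!: eventually_mono intro: order_trans[OF norm_iexp_diff_le])
  finally show ?thesis .
qed

lemma square_mean_diff_le:
  assumes X: "square_integrable M X" and Y: "square_integrable M Y"
  shows "expectation (\<lambda>\<omega>. (X \<omega> - Y \<omega>)\<^sup>2) \<le> 2 * expectation (\<lambda>\<omega>. (X \<omega>)\<^sup>2) + 2 * expectation (\<lambda>\<omega>. (Y \<omega>)\<^sup>2)"
  using square_mean_add_le[OF X square_integrable_cmult[OF Y, of "-1"]] by simp

text \<open>Second moments allow differentiation under the expectation without dominated
  convergence: after \<open>iexp (u * W)\<close> is factored out, the Taylor remainder is at most
  \<open>(v - u)\<^sup>2 * W\<^sup>2 / 2\<close>, so the difference quotient errs by at most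
  \<open>\<bar>v - u\<bar>\<close> times half the second moment.\<close>

lemma expectation_iexp_has_vector_derivative:
  assumes W: "square_integrable M W"
  shows "((\<lambda>u. expectation (\<lambda>\<omega>. iexp (u * W \<omega>))) has_vector_derivative
    \<i> * expectation (\<lambda>\<omega>. W \<omega> * iexp (u * W \<omega>))) (at u)"
  unfolding has_vector_derivative_def
proof (rule has_derivativeI_sandwich[where e = 1 and H = "\<lambda>v. \<bar>v - u\<bar> * (expectation (\<lambda>\<omega>. (W \<omega>)\<^sup>2) / 2)"])
  note [measurable] = W
  show "((\<lambda>v. \<bar>v - u\<bar> * (expectation (\<lambda>\<omega>. (W \<omega>)\<^sup>2) / 2)) \<longlongrightarrow> 0) (at u)"
    by (intro tendsto_mult_left_zero tendsto_rabs_zero) (simp add: LIM_zero)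
  fix v assume "v \<noteq> u"
  have int: "integrable M (\<lambda>\<omega>. iexp (v * W \<omega>))" for v
    by (rule integrable_iexp) auto
  have intW: "integrable M (\<lambda>\<omega>. complex_of_real (W \<omega>) * iexp (u * W \<omega>))"
    using square_integrable_integrable[OF W]
    by (intro Bochner_Integration.integrable_bound[of M "\<lambda>\<omega>. complex_of_real (W \<omega>)" "\<lambda>\<omega>. complex_of_real (W \<omega>) * iexp (u * W \<omega>)"])
      (auto simp: norm_mult)
  have iD: "integrable M (\<lambda>\<omega>. (v - u) *\<^sub>R (\<i> * (complex_of_real (W \<omega>) * iexp (u * W \<omega>))))"
    by (intro integrable_scaleR_right integrable_mult_right intW)
  have lin: "expectation (\<lambda>\<omega>. iexp (v * W \<omega>)) - expectation (\<lambda>\<omega>. iexp (u * W \<omega>))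
      - (v - u) *\<^sub>R (\<i> * expectation (\<lambda>\<omega>. W \<omega> * iexp (u * W \<omega>)))
    = expectation (\<lambda>\<omega>. iexp (v * W \<omega>) - iexp (u * W \<omega>) - (v - u) *\<^sub>R (\<i> * (W \<omega> * iexp (u * W \<omega>))))"
    by (simp only: Bochner_Integration.integral_diff[OF Bochner_Integration.integrable_diff[OF int int] iD]
        Bochner_Integration.integral_diff[OF int int] integral_scaleR_right integral_mult_right_zero)
  have "norm (expectation (\<lambda>\<omega>. iexp (v * W \<omega>)) - expectation (\<lambda>\<omega>. iexp (u * W \<omega>))
      - (v - u) *\<^sub>R (\<i> * expectation (\<lambda>\<omega>. W \<omega> * iexp (u * W \<omega>))))
    \<le> expectation (\<lambda>\<omega>. norm (iexp (v * W \<omega>) - iexp (u * W \<omega>) - (v - u) *\<^sub>R (\<i> * (W \<omega> * iexp (u * W \<omega>)))))"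
    unfolding lin by (rule integral_norm_bound)
  also have "\<dots> \<le> expectation (\<lambda>\<omega>. (v - u)\<^sup>2 / 2 * (W \<omega>)\<^sup>2)"
  proof (rule integral_mono)
    show "integrable M (\<lambda>\<omega>. norm (iexp (v * W \<omega>) - iexp (u * W \<omega>) - (v - u) *\<^sub>R (\<i> * (W \<omega> * iexp (u * W \<omega>)))))"
      by (intro integrable_norm Bochner_Integration.integrable_diff int iD)
    show "integrable M (\<lambda>\<omega>. (v - u)\<^sup>2 / 2 * (W \<omega>)\<^sup>2)"
      using W by (simp add: square_integrable_def)
    fix \<omega>
    have "iexp (v * W \<omega>) = iexp (u * W \<omega> + (v - u) * W \<omega>)"
      by (simp add: left_diff_distrib)
    also have "\<dots> = iexp (u * W \<omega>) * iexp ((v - u) * W \<omega>)"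
      by (simp only: of_real_add distrib_left exp_add)
    finally have eq: "iexp (v * W \<omega>) = iexp (u * W \<omega>) * iexp ((v - u) * W \<omega>)" .
    have "c * d - c - (v - u) *\<^sub>R (\<i> * (w * c)) = c * (d - 1 - \<i> * complex_of_real ((v - u) * w))"
      for c d :: complex and w :: real
      by (simp add: scaleR_conv_of_real algebra_simps)
    then have "iexp (v * W \<omega>) - iexp (u * W \<omega>) - (v - u) *\<^sub>R (\<i> * (W \<omega> * iexp (u * W \<omega>)))
       = iexp (u * W \<omega>) * (iexp ((v - u) * W \<omega>) - 1 - \<i> * complex_of_real ((v - u) * W \<omega>))"
      by (simp only: eq)
    then have "norm (iexp (v * W \<omega>) - iexp (u * W \<omega>) - (v - u) *\<^sub>R (\<i> * (W \<omega> * iexp (u * W \<omega>))))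
       = norm (iexp ((v - u) * W \<omega>) - 1 - \<i> * complex_of_real ((v - u) * W \<omega>))"
      by (simp only: norm_mult norm_exp_i_times mult_1_left)
    also have "\<dots> \<le> (v - u)\<^sup>2 / 2 * (W \<omega>)\<^sup>2"
      using norm_iexp_linear_le[of "(v - u) * W \<omega>"] by (simp only: power_mult_distrib times_divide_eq_left)
    finally show "norm (iexp (v * W \<omega>) - iexp (u * W \<omega>) - (v - u) *\<^sub>R (\<i> * (W \<omega> * iexp (u * W \<omega>))))
      \<le> (v - u)\<^sup>2 / 2 * (W \<omega>)\<^sup>2" .
  qed
  also have "\<dots> = (v - u)\<^sup>2 / 2 * expectation (\<lambda>\<omega>. (W \<omega>)\<^sup>2)" by simp
  finally show "norm (expectation (\<lambda>\<omega>. iexp (v * W \<omega>)) - expectation (\<lambda>\<omega>. iexp (u * W \<omega>))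
      - (v - u) *\<^sub>R (\<i> * expectation (\<lambda>\<omega>. W \<omega> * iexp (u * W \<omega>)))) / norm (v - u)
      \<le> \<bar>v - u\<bar> * (expectation (\<lambda>\<omega>. (W \<omega>)\<^sup>2) / 2)"
    using \<open>v \<noteq> u\<close> by (simp add: divide_le_eq) (simp add: power2_eq_square mult.commute mult.left_commute)
qed (simp_all add: bounded_linear_scaleR_left)

end

section \<open>Sums with finite range of dependence\<close>

lemma card_nat_window_le: "card {s\<in>I. \<bar>int s - int t\<bar> < int n} \<le> 2 * n" if "finite I"
proof -
  have "card {s\<in>I. \<bar>int s - int t\<bar> < int n} \<le> card {t - n..<t + n}"
    by (intro card_mono) auto
  then show ?thesis by simp
qed

text \<open>\<open>G I\<close> models the events determined by the innovations at the times in
  \<open>I\<close>; times are integers because the linear processes reach into the infinite past.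
  These four properties are all that the covariance and characteristic function estimates below need
  to know about the probability model.\<close>

locale indep_time_algebras = prob_space M for M :: "'a measure" +
  fixes G :: "int set \<Rightarrow> 'a measure"
  assumes space_G: "space (G I) = space M"
    and sets_G: "sets (G I) \<subseteq> sets M"
    and G_mono: "I \<subseteq> J \<Longrightarrow> sets (G I) \<subseteq> sets (G J)"
    and G_indep: "I \<inter> J = {} \<Longrightarrow> indep_set (sets (G I)) (sets (G J))"
begin

lemma measurable_G: "X \<in> borel_measurable (G I) \<Longrightarrow> X \<in> borel_measurable M"
  using measurable_mono[of borel borel "G I" M] space_G sets_G by auto

lemma measurable_G_mono: "X \<in> borel_measurable (G I) \<Longrightarrow> I \<subseteq> J \<Longrightarrow> X \<in> borel_measurable (G J)"
  using measurable_mono[of borel borel "G I" "G J"] space_G G_mono by auto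

lemma indep_var_G:
  assumes X: "X \<in> borel_measurable (G I)" and Y: "Y \<in> borel_measurable (G J)" and "I \<inter> J = {}"
  shows "indep_var borel X borel Y"
  unfolding indep_var_eq
proof (intro conjI)
  have sub: "sigma_sets (space M) {Z -` A \<inter> space M |A. A \<in> sets borel} \<subseteq> sets (G K)"
    if "Z \<in> borel_measurable (G K)" for Z :: "'a \<Rightarrow> 'c::topological_space" and K
    using sets.sigma_sets_subset[of "{Z -` A \<inter> space M |A. A \<in> sets borel}" "G K"]
      measurable_sets[OF that] by (auto simp: space_G)
  show "indep_set (sigma_sets (space M) {X -` A \<inter> space M |A. A \<in> sets borel})
      (sigma_sets (space M) {Y -` A \<inter> space M |A. A \<in> sets borel})"
    using G_indep[OF \<open>I \<inter> J = {}\<close>] sub[OF X] sub[OF Y] unfolding indep_sets2_eq by blast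
qed (use measurable_G X Y in auto)

lemma expectation_mult_G:
  fixes X Y :: "'a \<Rightarrow> 'b :: {real_normed_field, banach, second_countable_topology}"
  assumes "X \<in> borel_measurable (G I)" "Y \<in> borel_measurable (G J)" "I \<inter> J = {}"
    and "integrable M X" "integrable M Y"
  shows "expectation (\<lambda>\<omega>. X \<omega> * Y \<omega>) = expectation X * expectation Y"
  using indep_var_lebesgue_integral[OF indep_var_G[OF assms(1-3)] assms(4-5)] .

lemma covar_G_eq_0:
  assumes "X \<in> borel_measurable (G I)" "Y \<in> borel_measurable (G J)" "I \<inter> J = {}"
    and "square_integrable M X" "square_integrable M Y"
  shows "covar M X Y = 0"
  using assms by (simp add: covar_eq expectation_mult_G square_integrable_integrable)

text \<open>Replacing \<open>D t\<close> by its approximation of lag \<open>t - s\<close>, which is independent of \<open>D s\<close>,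
  bounds the covariance of \<open>D s\<close> and \<open>D t\<close> by \<open>\<epsilon> * \<rho> (t - s)\<close>.\<close>
lemma weighted_sum_variance_le:
  fixes D :: "nat \<Rightarrow> 'a \<Rightarrow> real" and D' :: "nat \<Rightarrow> nat \<Rightarrow> 'a \<Rightarrow> real" and a :: "nat \<Rightarrow> real"
  assumes D: "\<And>t. D t \<in> borel_measurable (G {..int t})" "\<And>t. square_integrable M (D t)"
    and D_le: "\<And>t. expectation (\<lambda>\<omega>. (D t \<omega>)\<^sup>2) \<le> \<epsilon>\<^sup>2"
    and D': "\<And>h t. D' h t \<in> borel_measurable (G {int t - int h<..int t})" "\<And>h t. square_integrable M (D' h t)"
    and D'_le: "\<And>h t. expectation (\<lambda>\<omega>. (D t \<omega> - D' h t \<omega>)\<^sup>2) \<le> (\<rho> h)\<^sup>2"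
    and \<rho>: "summable \<rho>" "\<And>h. 0 \<le> \<rho> h" and "0 \<le> \<epsilon>"
    and a: "\<And>t. t \<in> {1..T} \<Longrightarrow> \<bar>a t\<bar> \<le> A"
  shows "expectation (\<lambda>\<omega>. (\<Sum>t=1..T. a t * (D t \<omega> - expectation (D t)))\<^sup>2)
    \<le> 2 * A\<^sup>2 * \<epsilon> * suminf \<rho> * real T"
proof (cases "T = 0")
  case False
  \<comment> \<open>\<open>a\<close> is bounded only on \<open>{1..T}\<close>, so the sign of
    \<open>A\<close> comes from time 1; this is why \<open>T = 0\<close> is split off.\<close>
  then have "0 \<le> A" using a[of 1] by force
  have cov: "\<bar>covar M (D s) (D t)\<bar> \<le> \<epsilon> * \<rho> (t - s)" if "s \<le> t" for s t
  proof -
    \<comment> \<open>\<open>D s\<close> depends on times up to \<open>s\<close>, the lag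
      \<open>t - s\<close> version of \<open>D t\<close> on times after \<open>s\<close> and up to
      \<open>t\<close>.\<close>
    have "covar M (D s) (D' (t - s) t) = 0"
      using that by (intro covar_G_eq_0[OF D(1) D'(1) _ D(2) D'(2)]) auto
    then have "covar M (D s) (D t) = covar M (D s) (\<lambda>\<omega>. D t \<omega> - D' (t - s) t \<omega>)"
      using covar_diff_right[OF D(2) D(2) D'(2)] by simp
    then have "\<bar>covar M (D s) (D t)\<bar> \<le> sqrt (expectation (\<lambda>\<omega>. (D s \<omega>)\<^sup>2)) *
        sqrt (expectation (\<lambda>\<omega>. (D t \<omega> - D' (t - s) t \<omega>)\<^sup>2))"
      using abs_covar_le[OF D(2) square_integrable_diff[OF D(2) D'(2)]] by simp
    also have "\<dots> \<le> \<epsilon> * \<rho> (t - s)"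
      using D_le D'_le \<rho> \<open>0 \<le> \<epsilon>\<close> by (intro mult_mono real_le_lsqrt) (auto intro!: integral_nonneg_AE)
    finally show ?thesis .
  qed
  \<comment> \<open>With truncated subtraction, \<open>(t - s) + (s - t)\<close> is the distance of
    \<open>s\<close> and \<open>t\<close>, which treats both orders at once.\<close>
  have cov2: "a s * a t * covar M (D s) (D t) \<le> A\<^sup>2 * \<epsilon> * \<rho> ((t - s) + (s - t))"
    if "s \<in> {1..T}" "t \<in> {1..T}" for s t
  proof -
    have "\<bar>covar M (D s) (D t)\<bar> \<le> \<epsilon> * \<rho> ((t - s) + (s - t))"
      using cov[of s t] cov[of t s] covar_commute[of "D s" "D t"] by (cases "s \<le> t") auto
    moreover have "\<bar>a s * a t\<bar> \<le> A\<^sup>2"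
      using a[OF that(1)] a[OF that(2)] \<open>0 \<le> A\<close> by (simp add: abs_mult power2_eq_square mult_mono)
    ultimately have "\<bar>a s * a t\<bar> * \<bar>covar M (D s) (D t)\<bar> \<le> A\<^sup>2 * (\<epsilon> * \<rho> ((t - s) + (s - t)))"
      by (intro mult_mono) auto
    then show ?thesis
      by (metis abs_le_D1 abs_mult mult.assoc)
  qed
  have row: "(\<Sum>t=1..T. \<rho> ((t - s) + (s - t))) \<le> 2 * suminf \<rho>" if "s \<in> {1..T}" for s
  proof -
    have inj: "inj_on (\<lambda>t. s - t) {1..s}" "inj_on (\<lambda>t. t - s) {s<..T}"
      by (auto simp: inj_on_def)
    \<comment> \<open>Each lag occurs at most once on either side of \<open>s\<close>; this is the
      factor 2.\<close>
    have "{1..T} = {1..s} \<union> {s<..T}" using that by auto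
    then have "(\<Sum>t=1..T. \<rho> ((t - s) + (s - t))) = (\<Sum>t\<in>{1..s}. \<rho> (s - t)) + (\<Sum>t\<in>{s<..T}. \<rho> (t - s))"
      by (subst \<open>{1..T} = _\<close>, subst sum.union_disjoint) (auto intro!: arg_cong2[where f = "(+)"] sum.cong)
    also have "\<dots> = sum \<rho> ((\<lambda>t. s - t) ` {1..s}) + sum \<rho> ((\<lambda>t. t - s) ` {s<..T})"
      using inj by (simp add: sum.reindex)
    also have "\<dots> \<le> suminf \<rho> + suminf \<rho>"
      using \<rho> by (intro add_mono sum_le_suminf) auto
    finally show ?thesis by simp
  qed
  have "expectation (\<lambda>\<omega>. (\<Sum>t=1..T. a t * (D t \<omega> - expectation (D t)))\<^sup>2)
      = (\<Sum>s=1..T. \<Sum>t=1..T. a s * a t * covar M (D s) (D t))"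
    by (rule expectation_weighted_sum_square) (rule D)
  also have "\<dots> \<le> (\<Sum>s=1..T. \<Sum>t=1..T. A\<^sup>2 * \<epsilon> * \<rho> ((t - s) + (s - t)))"
    by (intro sum_mono cov2)
  also have "\<dots> \<le> (\<Sum>s=1..T. A\<^sup>2 * \<epsilon> * (2 * suminf \<rho>))"
  proof (rule sum_mono)
    fix s assume "s \<in> {1..T}"
    with row[of s] \<open>0 \<le> \<epsilon>\<close> show "(\<Sum>t=1..T. A\<^sup>2 * \<epsilon> * \<rho> ((t - s) + (s - t))) \<le> A\<^sup>2 * \<epsilon> * (2 * suminf \<rho>)"
      unfolding sum_distrib_left[symmetric] by (intro mult_left_mono) auto
  qed
  finally show ?thesis by (simp add: mult_ac)
qed simp

text \<open>A Stein-type estimate for the characteristic function \<open>\<phi>\<close> of a \<open>q\<close>-dependent sum: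
  \<open>\<phi>' + \<theta> \<sigma>\<^sup>2 \<phi>\<close> is small. Removing from \<open>W\<close> the window \<open>V t\<close> around \<open>t\<close> leaves a variable that is
  independent of \<open>Y t\<close>.\<close>
lemma dependent_sum_stein:
  fixes Y :: "nat \<Rightarrow> 'a \<Rightarrow> real" and \<theta> b \<sigma>2 :: real and T q :: nat and W :: "'a \<Rightarrow> real"
  assumes Y: "\<And>t. Y t \<in> borel_measurable (G {int t - int q<..int t})"
    and bdd: "\<And>t \<omega>. \<omega> \<in> space M \<Longrightarrow> \<bar>Y t \<omega>\<bar> \<le> b" and mean: "\<And>t. expectation (Y t) = 0" and "0 \<le> b"
  defines "W \<equiv> (\<lambda>\<omega>. \<Sum>t=1..T. Y t \<omega>)"
  defines "\<sigma>2 \<equiv> expectation (\<lambda>\<omega>. (W \<omega>)\<^sup>2)"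
  shows "norm (expectation (\<lambda>\<omega>. W \<omega> * iexp (\<theta> * W \<omega>)) - \<i> * \<theta> * \<sigma>2 * expectation (\<lambda>\<omega>. iexp (\<theta> * W \<omega>)))
    \<le> \<bar>\<theta>\<bar> * (sqrt (6 * q * T) * (2 * q * b\<^sup>2)) + \<theta>\<^sup>2 * (2 * q\<^sup>2 * b^3 * T)"
proof -
  \<comment> \<open>\<open>V t\<close> collects the summands that may share innovations with
    \<open>Y t\<close>; \<open>P\<close> is a random version of the variance, with mean
    \<open>\<sigma>2\<close>.\<close>
  define N where "N t = {s\<in>{1..T}. \<bar>int s - int t\<bar> < int q}" for t
  define V where "V t \<omega> = (\<Sum>s\<in>N t. Y s \<omega>)" for t \<omega>
  define P where "P \<omega> = (\<Sum>t=1..T. Y t \<omega> * V t \<omega>)" for \<omega>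
  have fin[simp]: "finite (N t)" for t by (simp add: N_def)
  have cardN: "card (N t) \<le> 2 * q" for t unfolding N_def by (rule card_nat_window_le) simp
  have Ym[measurable]: "Y t \<in> borel_measurable M" for t using Y by (rule measurable_G)
  have Vm[measurable]: "V t \<in> borel_measurable M" for t unfolding V_def by measurable
  have Wm[measurable]: "W \<in> borel_measurable M" unfolding W_def by measurable
  have Pm[measurable]: "P \<in> borel_measurable M" unfolding P_def by measurable
  have Vb: "\<bar>V t \<omega>\<bar> \<le> 2 * q * b" if "\<omega> \<in> space M" for t \<omega>
  proof -
    have "\<bar>V t \<omega>\<bar> \<le> (\<Sum>s\<in>N t. \<bar>Y s \<omega>\<bar>)" unfolding V_def by (rule sum_abs)
    also have "\<dots> \<le> card (N t) * b" using bdd[OF that] by (intro sum_bounded_above) auto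
    also have "\<dots> \<le> 2 * q * b" using cardN[of t] \<open>0 \<le> b\<close> by (intro mult_right_mono) (auto simp: of_nat_mono)
    finally show ?thesis .
  qed
  have YVb: "\<bar>Y t \<omega> * V t \<omega>\<bar> \<le> 2 * q * b\<^sup>2" if "\<omega> \<in> space M" for t \<omega>
  proof -
    have "\<bar>Y t \<omega>\<bar> * \<bar>V t \<omega>\<bar> \<le> b * (2 * q * b)"
      using bdd[OF that] Vb[OF that] \<open>0 \<le> b\<close> by (intro mult_mono) auto
    then show ?thesis by (simp add: abs_mult power2_eq_square mult_ac)
  qed
  have sqY: "square_integrable M (Y t)" for t
    using bdd by (intro square_integrable_bounded[where B = b]) auto
  have sqYV: "square_integrable M (\<lambda>\<omega>. Y t \<omega> * V t \<omega>)" for t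
    using YVb by (intro square_integrable_bounded[where B = "2 * q * b\<^sup>2"]) auto
  have sqW: "square_integrable M W" unfolding W_def by (intro square_integrable_sum sqY)
  have sqP: "square_integrable M P" unfolding P_def by (intro square_integrable_sum sqYV)
  have EYY: "expectation (\<lambda>\<omega>. Y t \<omega> * Y s \<omega>) = 0" if "\<bar>int s - int t\<bar> \<ge> int q" for s t
    using that expectation_mult_G[OF Y[of t] Y[of s]] sqY mean
    by (auto simp: square_integrable_integrable)
  \<comment> \<open>Only pairs at distance less than \<open>q\<close> contribute to the variance:
    all others are independent with mean zero.\<close>
  have EP: "expectation P = \<sigma>2"
  proof -
    have "\<sigma>2 = expectation (\<lambda>\<omega>. \<Sum>t=1..T. \<Sum>s=1..T. Y t \<omega> * Y s \<omega>)"
      by (simp add: \<sigma>2_def W_def power2_eq_square sum_product)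
    also have "\<dots> = (\<Sum>t=1..T. \<Sum>s=1..T. expectation (\<lambda>\<omega>. Y t \<omega> * Y s \<omega>))"
      using sqY by (simp add: square_integrable_mult)
    also have "\<dots> = (\<Sum>t=1..T. \<Sum>s\<in>N t. expectation (\<lambda>\<omega>. Y t \<omega> * Y s \<omega>))"
    proof (rule sum.cong[OF refl], rule sum.mono_neutral_right)
      show "\<forall>i\<in>{1..T} - N t. expectation (\<lambda>\<omega>. Y t \<omega> * Y i \<omega>) = 0" for t
        by (intro ballI EYY) (auto simp: N_def)
    qed (auto simp: N_def)
    also have "\<dots> = expectation (\<lambda>\<omega>. \<Sum>t=1..T. \<Sum>s\<in>N t. Y t \<omega> * Y s \<omega>)"
      using sqY by (simp add: square_integrable_mult)
    also have "\<dots> = expectation P"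
      by (simp add: P_def[abs_def] V_def sum_distrib_left)
    finally show ?thesis by simp
  qed
  \<comment> \<open>The summands \<open>Y s\<close> with \<open>s \<in> N t\<close> use innovations
    between \<open>t - 2 * q\<close> and \<open>t + q\<close>, a stretch of length
    \<open>3 * q\<close>. Hence \<open>Y s * V s\<close> and \<open>Y t * V t\<close> are
    independent once \<open>s\<close> and \<open>t\<close> are \<open>3 * q\<close> apart, which is
    the window in \<open>cov\<close>. For \<open>q = 0\<close> the sum \<open>V t\<close> is
    empty.\<close>
  have YVm: "(\<lambda>\<omega>. Y t \<omega> * V t \<omega>) \<in> borel_measurable (G {int t - 2 * int q<..<int t + int q})" for t
  proof (cases "q = 0")
    case False
    then have [measurable]: "Y t \<in> borel_measurable (G {int t - 2 * int q<..<int t + int q})"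
      by (intro measurable_G_mono[OF Y]) auto
    have [measurable]: "Y s \<in> borel_measurable (G {int t - 2 * int q<..<int t + int q})" if "s \<in> N t" for s
      using that by (intro measurable_G_mono[OF Y]) (auto simp: N_def)
    show ?thesis unfolding V_def by measurable
  qed (simp add: V_def N_def)
  have cov: "covar M (\<lambda>\<omega>. Y s \<omega> * V s \<omega>) (\<lambda>\<omega>. Y t \<omega> * V t \<omega>) \<le> (if \<bar>int t - int s\<bar> < int (3 * q) then (2 * q * b\<^sup>2)\<^sup>2 else 0)" for s t
  proof -
    have E2: "sqrt (expectation (\<lambda>\<omega>. (Y t \<omega> * V t \<omega>)\<^sup>2)) \<le> 2 * q * b\<^sup>2" for t
    proof (rule real_le_lsqrt)
      have "expectation (\<lambda>\<omega>. (Y t \<omega> * V t \<omega>)\<^sup>2) \<le> expectation (\<lambda>\<omega>. (2 * q * b\<^sup>2)\<^sup>2)"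
        using sqYV YVb by (intro integral_mono) (auto simp: square_integrable_def intro!: power2_le_iff_abs_le[THEN iffD2])
      then show "expectation (\<lambda>\<omega>. (Y t \<omega> * V t \<omega>)\<^sup>2) \<le> (2 * q * b\<^sup>2)\<^sup>2" by (simp add: prob_space)
    qed (use \<open>0 \<le> b\<close> in auto)
    have "covar M (\<lambda>\<omega>. Y s \<omega> * V s \<omega>) (\<lambda>\<omega>. Y t \<omega> * V t \<omega>) \<le> (2 * q * b\<^sup>2) * (2 * q * b\<^sup>2)"
    proof (rule order_trans[OF abs_le_D1[OF abs_covar_le[OF sqYV sqYV]] mult_mono[OF E2 E2]])
    qed auto
    moreover have "covar M (\<lambda>\<omega>. Y s \<omega> * V s \<omega>) (\<lambda>\<omega>. Y t \<omega> * V t \<omega>) = 0" if "\<not> \<bar>int t - int s\<bar> < int (3 * q)"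
      using that by (intro covar_G_eq_0[OF YVm YVm _ sqYV sqYV]) auto
    ultimately show ?thesis by (simp add: power2_eq_square)
  qed
  \<comment> \<open>Each time has at most \<open>6 * q\<close> partners with nonzero covariance, so
    the variance of \<open>P\<close> grows like \<open>T\<close> and not like its square;
    \<open>absP\<close> turns this into the square root of \<open>T\<close>.\<close>
  have varP: "expectation (\<lambda>\<omega>. (P \<omega> - \<sigma>2)\<^sup>2) \<le> 6 * q * T * (2 * q * b\<^sup>2)\<^sup>2"
  proof -
    have "\<sigma>2 = (\<Sum>t=1..T. expectation (\<lambda>\<omega>. Y t \<omega> * V t \<omega>))"
      unfolding EP[symmetric] P_def using sqYV by (simp add: square_integrable_integrable)
    then have "expectation (\<lambda>\<omega>. (P \<omega> - \<sigma>2)\<^sup>2)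
       = expectation (\<lambda>\<omega>. (\<Sum>t=1..T. 1 * (Y t \<omega> * V t \<omega> - expectation (\<lambda>\<omega>. Y t \<omega> * V t \<omega>)))\<^sup>2)"
      by (simp add: P_def sum_subtractf)
    also have "\<dots> = (\<Sum>s=1..T. \<Sum>t=1..T. 1 * 1 * covar M (\<lambda>\<omega>. Y s \<omega> * V s \<omega>) (\<lambda>\<omega>. Y t \<omega> * V t \<omega>))"
      by (rule expectation_weighted_sum_square) (rule sqYV)
    also have "\<dots> \<le> (\<Sum>s=1..T. \<Sum>t=1..T. if \<bar>int t - int s\<bar> < int (3 * q) then (2 * q * b\<^sup>2)\<^sup>2 else 0)"
      using cov by (intro sum_mono) simp
    also have "\<dots> = (\<Sum>s=1..T. card {t\<in>{1..T}. \<bar>int t - int s\<bar> < int (3 * q)} * (2 * q * b\<^sup>2)\<^sup>2)"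
      by (intro sum.cong refl) (simp flip: sum.inter_filter del: of_nat_mult)
    also have "\<dots> \<le> (\<Sum>s=1..T. (2 * (3 * q)) * (2 * q * b\<^sup>2)\<^sup>2)"
      using card_nat_window_le[of "{1..T}" _ "3 * q"]
      by (intro sum_mono mult_right_mono) (auto simp del: of_nat_mult intro: of_nat_mono)
    finally show ?thesis by (simp add: mult_ac)
  qed
  have absP: "expectation (\<lambda>\<omega>. \<bar>P \<omega> - \<sigma>2\<bar>) \<le> sqrt (6 * q * T) * (2 * q * b\<^sup>2)"
  proof -
    have "expectation (\<lambda>\<omega>. \<bar>P \<omega> - \<sigma>2\<bar>) \<le> sqrt (expectation (\<lambda>\<omega>. (P \<omega> - \<sigma>2)\<^sup>2))"
      by (intro expectation_abs_le_sqrt square_integrable_diff sqP square_integrable_const)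
    also have "\<dots> \<le> sqrt (6 * q * T * (2 * q * b\<^sup>2)\<^sup>2)"
      using varP by (rule real_sqrt_le_mono)
    finally show ?thesis using \<open>0 \<le> b\<close> by (simp add: real_sqrt_mult)
  qed
  have zero: "expectation (\<lambda>\<omega>. Y t \<omega> * iexp (\<theta> * (W \<omega> - V t \<omega>))) = 0" if "t \<in> {1..T}" for t
  proof -
    \<comment> \<open>The summands left in \<open>W - V t\<close> belong to times at distance at
      least \<open>q\<close> from \<open>t\<close>, so their windows avoid that of
      \<open>Y t\<close>.\<close>
    define J where "J = - {int t - int q<..int t}"
    have "(\<lambda>\<omega>. W \<omega> - V t \<omega>) = (\<lambda>\<omega>. \<Sum>s\<in>{1..T} - N t. Y s \<omega>)"
      unfolding W_def V_def by (subst sum_diff) (auto simp: N_def)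
    moreover have [measurable]: "Y s \<in> borel_measurable (G J)" if "s \<in> {1..T} - N t" for s
      using that by (intro measurable_G_mono[OF Y]) (auto simp: N_def J_def)
    have "(\<lambda>\<omega>. \<Sum>s\<in>{1..T} - N t. Y s \<omega>) \<in> borel_measurable (G J)"
      by measurable
    ultimately have [measurable]: "(\<lambda>\<omega>. W \<omega> - V t \<omega>) \<in> borel_measurable (G J)" by simp
    have [measurable]: "Y t \<in> borel_measurable (G {int t - int q<..int t})" by fact
    have "expectation (\<lambda>\<omega>. complex_of_real (Y t \<omega>) * iexp (\<theta> * (W \<omega> - V t \<omega>)))
      = expectation (\<lambda>\<omega>. complex_of_real (Y t \<omega>)) * expectation (\<lambda>\<omega>. iexp (\<theta> * (W \<omega> - V t \<omega>)))"
    proof (rule expectation_mult_G[where I = "{int t - int q<..int t}" and J = J])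
      show "(\<lambda>\<omega>. iexp (\<theta> * (W \<omega> - V t \<omega>))) \<in> borel_measurable (G J)" by measurable
      show "(\<lambda>\<omega>. complex_of_real (Y t \<omega>)) \<in> borel_measurable (G {int t - int q<..int t})" by measurable
      show "integrable M (\<lambda>\<omega>. complex_of_real (Y t \<omega>))" using sqY by (auto intro: square_integrable_integrable)
      show "integrable M (\<lambda>\<omega>. iexp (\<theta> * (W \<omega> - V t \<omega>)))" by (auto intro!: integrable_iexp)
    qed (auto simp: J_def)
    then show ?thesis by (simp add: mean)
  qed
  \<comment> \<open>Second-order remainder of \<open>iexp (- (\<theta> * V t))\<close>. Expanding
    only in the window part leaves a term with mean zero, a term that sums to \<open>P\<close>, and
    this remainder of size at most
    \<open>\<theta>\<^sup>2 * b * (2 * q * b)\<^sup>2 / 2\<close>.\<close>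
  define R where "R t \<omega> = iexp (\<theta> * W \<omega>) * (Y t \<omega> * (1 - iexp (- (\<theta> * V t \<omega>)) - \<i> * (\<theta> * V t \<omega>)))" for t \<omega>
  have Rb: "norm (R t \<omega>) \<le> \<theta>\<^sup>2 * (2 * q\<^sup>2 * b^3)" if "\<omega> \<in> space M" for t \<omega>
  proof -
    have "norm (1 - iexp (- (\<theta> * V t \<omega>)) - \<i> * (\<theta> * V t \<omega>))
        = norm (iexp (- (\<theta> * V t \<omega>)) - 1 - \<i> * complex_of_real (- (\<theta> * V t \<omega>)))"
      by (subst norm_minus_cancel[symmetric]) (simp add: algebra_simps)
    then have "norm (R t \<omega>) = \<bar>Y t \<omega>\<bar> * norm (iexp (- (\<theta> * V t \<omega>)) - 1 - \<i> * complex_of_real (- (\<theta> * V t \<omega>)))"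
      by (simp add: R_def norm_mult)
    also have "\<dots> \<le> b * ((\<theta> * V t \<omega>)\<^sup>2 / 2)"
      using bdd[OF that] \<open>0 \<le> b\<close> norm_iexp_linear_le[of "- (\<theta> * V t \<omega>)"] by (intro mult_mono) auto
    also have "\<dots> \<le> b * (\<theta>\<^sup>2 * (2 * q * b)\<^sup>2 / 2)"
    proof (intro mult_left_mono divide_right_mono)
      have "(V t \<omega>)\<^sup>2 \<le> (2 * q * b)\<^sup>2"
        using Vb[OF that, of t] \<open>0 \<le> b\<close> by (simp only: abs_le_square_iff[symmetric])
      then show "(\<theta> * V t \<omega>)\<^sup>2 \<le> \<theta>\<^sup>2 * (2 * q * b)\<^sup>2"
        by (simp add: power_mult_distrib mult_left_mono)
    qed (use \<open>0 \<le> b\<close> in auto)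
    finally show ?thesis by (simp add: power2_eq_square power3_eq_cube mult_ac)
  qed
  have Rm[measurable]: "R t \<in> borel_measurable M" for t unfolding R_def by measurable
  have Rint: "integrable M (R t)" for t
    using Rb by (intro integrable_const_bound[where B = "\<theta>\<^sup>2 * (2 * q\<^sup>2 * b^3)"]) auto
  have iexp_int: "integrable M (\<lambda>\<omega>. iexp (f \<omega>))" if "f \<in> borel_measurable M" for f
    using that by (intro integrable_iexp) auto
  have cmult_int: "integrable M (\<lambda>\<omega>. complex_of_real (g \<omega>) * iexp (f \<omega>))"
    if "square_integrable M g" "f \<in> borel_measurable M" for f g
    using that square_integrable_integrable[OF that(1)]
    by (intro Bochner_Integration.integrable_bound[of M "\<lambda>\<omega>. complex_of_real (g \<omega>)" "\<lambda>\<omega>. complex_of_real (g \<omega>) * iexp (f \<omega>)"])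
      (auto simp: norm_mult square_integrable_def)
  have decomp: "W \<omega> * iexp (\<theta> * W \<omega>) = (\<Sum>t=1..T. Y t \<omega> * iexp (\<theta> * (W \<omega> - V t \<omega>)))
     + \<i> * \<theta> * (P \<omega> * iexp (\<theta> * W \<omega>)) + (\<Sum>t=1..T. R t \<omega>)" for \<omega>
  proof -
    have "Y t \<omega> * iexp (\<theta> * W \<omega>) = Y t \<omega> * iexp (\<theta> * (W \<omega> - V t \<omega>))
        + \<i> * \<theta> * (Y t \<omega> * V t \<omega> * iexp (\<theta> * W \<omega>)) + R t \<omega>" for t
    proof -
      have "iexp (\<theta> * (W \<omega> - V t \<omega>)) = iexp (\<theta> * W \<omega>) * iexp (- (\<theta> * V t \<omega>))"
        by (simp add: exp_add[symmetric] algebra_simps)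
      then show ?thesis by (simp add: R_def algebra_simps)
    qed
    then have "(\<Sum>t=1..T. Y t \<omega> * iexp (\<theta> * W \<omega>)) = (\<Sum>t=1..T. Y t \<omega> * iexp (\<theta> * (W \<omega> - V t \<omega>)))
        + (\<Sum>t=1..T. \<i> * \<theta> * (Y t \<omega> * V t \<omega> * iexp (\<theta> * W \<omega>))) + (\<Sum>t=1..T. R t \<omega>)"
      by (simp only: sum.distrib)
    moreover have "complex_of_real (W \<omega>) * c = (\<Sum>t=1..T. Y t \<omega> * c)" for c :: complex
      by (simp add: W_def sum_distrib_right)
    moreover have "\<i> * \<theta> * (complex_of_real (P \<omega>) * c) = (\<Sum>t=1..T. \<i> * \<theta> * (Y t \<omega> * V t \<omega> * c))" for c :: complex
      by (simp add: P_def sum_distrib_right sum_distrib_left)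
    ultimately show ?thesis by simp
  qed
  have "expectation (\<lambda>\<omega>. W \<omega> * iexp (\<theta> * W \<omega>))
     = (\<Sum>t=1..T. expectation (\<lambda>\<omega>. Y t \<omega> * iexp (\<theta> * (W \<omega> - V t \<omega>))))
     + \<i> * \<theta> * expectation (\<lambda>\<omega>. P \<omega> * iexp (\<theta> * W \<omega>)) + (\<Sum>t=1..T. expectation (R t))"
    unfolding decomp using Rint cmult_int[OF sqP, of "\<lambda>\<omega>. \<theta> * W \<omega>"]
      cmult_int[OF sqY, of "\<lambda>\<omega>. \<theta> * (W \<omega> - V _ \<omega>)"] by simp
  also have "\<dots> = \<i> * \<theta> * expectation (\<lambda>\<omega>. P \<omega> * iexp (\<theta> * W \<omega>)) + (\<Sum>t=1..T. expectation (R t))"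
    using zero by simp
  finally have "expectation (\<lambda>\<omega>. W \<omega> * iexp (\<theta> * W \<omega>)) - \<i> * \<theta> * \<sigma>2 * expectation (\<lambda>\<omega>. iexp (\<theta> * W \<omega>))
     = \<i> * \<theta> * (expectation (\<lambda>\<omega>. P \<omega> * iexp (\<theta> * W \<omega>)) - \<sigma>2 * expectation (\<lambda>\<omega>. iexp (\<theta> * W \<omega>))) + (\<Sum>t=1..T. expectation (R t))"
    by (simp add: algebra_simps)
  also have "expectation (\<lambda>\<omega>. P \<omega> * iexp (\<theta> * W \<omega>)) - \<sigma>2 * expectation (\<lambda>\<omega>. iexp (\<theta> * W \<omega>))
     = expectation (\<lambda>\<omega>. complex_of_real (P \<omega> - \<sigma>2) * iexp (\<theta> * W \<omega>))"
    using cmult_int[OF sqP, of "\<lambda>\<omega>. \<theta> * W \<omega>"] iexp_int[of "\<lambda>\<omega>. \<theta> * W \<omega>"] by (simp add: left_diff_distrib)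
  also have "norm (\<i> * \<theta> * expectation (\<lambda>\<omega>. complex_of_real (P \<omega> - \<sigma>2) * iexp (\<theta> * W \<omega>)) + (\<Sum>t=1..T. expectation (R t)))
     \<le> \<bar>\<theta>\<bar> * (sqrt (6 * q * T) * (2 * q * b\<^sup>2)) + (\<Sum>t=1..T. \<theta>\<^sup>2 * (2 * q\<^sup>2 * b^3))"
  proof (rule norm_triangle_mono)
    have "norm (expectation (\<lambda>\<omega>. complex_of_real (P \<omega> - \<sigma>2) * iexp (\<theta> * W \<omega>)))
       \<le> expectation (\<lambda>\<omega>. norm (complex_of_real (P \<omega> - \<sigma>2) * iexp (\<theta> * W \<omega>)))"
      by (rule integral_norm_bound)
    also have "\<dots> \<le> sqrt (6 * q * T) * (2 * q * b\<^sup>2)"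
      using absP by (simp add: norm_mult norm_of_real del: of_real_diff)
    finally show "norm (\<i> * \<theta> * expectation (\<lambda>\<omega>. complex_of_real (P \<omega> - \<sigma>2) * iexp (\<theta> * W \<omega>)))
       \<le> \<bar>\<theta>\<bar> * (sqrt (6 * q * T) * (2 * q * b\<^sup>2))"
      by (simp add: norm_mult mult_left_mono del: of_real_diff)
    show "norm (\<Sum>t=1..T. expectation (R t)) \<le> (\<Sum>t=1..T. \<theta>\<^sup>2 * (2 * q\<^sup>2 * b^3))"
    proof (rule sum_norm_le)
      fix t
      have "norm (expectation (R t)) \<le> expectation (\<lambda>\<omega>. norm (R t \<omega>))" by (rule integral_norm_bound)
      also have "\<dots> \<le> expectation (\<lambda>\<omega>. \<theta>\<^sup>2 * (2 * q\<^sup>2 * b^3))"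
        using Rb Rint by (intro integral_mono) auto
      finally show "norm (expectation (R t)) \<le> \<theta>\<^sup>2 * (2 * q\<^sup>2 * b^3)" by (simp add: prob_space)
    qed
  qed
  finally show ?thesis by (simp add: mult_ac)
qed

text \<open>\<open>dependent_sum_stein\<close> is an approximate linear differential equation for
  the characteristic function. With the integrating factor
  \<open>exp (u\<^sup>2 * \<sigma>2 / 2)\<close> its error becomes the derivative of
  \<open>g\<close>, and the mean value inequality starting from \<open>g 0 = 1\<close> gives the
  bound.\<close>

lemma dependent_sum_char_bound:
  fixes Y :: "nat \<Rightarrow> 'a \<Rightarrow> real" and \<theta> b \<sigma>2 :: real and T q :: nat and W :: "'a \<Rightarrow> real"
  assumes Y: "\<And>t. Y t \<in> borel_measurable (G {int t - int q<..int t})"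
    and bdd: "\<And>t \<omega>. \<omega> \<in> space M \<Longrightarrow> \<bar>Y t \<omega>\<bar> \<le> b" and mean: "\<And>t. expectation (Y t) = 0" and "0 \<le> b"
  defines "W \<equiv> (\<lambda>\<omega>. \<Sum>t=1..T. Y t \<omega>)"
  defines "\<sigma>2 \<equiv> expectation (\<lambda>\<omega>. (W \<omega>)\<^sup>2)"
  shows "norm (expectation (\<lambda>\<omega>. iexp (\<theta> * W \<omega>)) - exp (- \<theta>\<^sup>2 * \<sigma>2 / 2))
    \<le> \<theta>\<^sup>2 * (sqrt (6 * q * T) * (2 * q * b\<^sup>2)) + \<bar>\<theta>\<bar>^3 * (2 * q\<^sup>2 * b^3 * T)"
proof -
  define K where "K = \<bar>\<theta>\<bar> * (sqrt (6 * q * T) * (2 * q * b\<^sup>2)) + \<theta>\<^sup>2 * (2 * q\<^sup>2 * b^3 * T)"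
  have "0 \<le> \<sigma>2" by (simp add: \<sigma>2_def)
  have "0 \<le> K" using \<open>0 \<le> b\<close> by (simp add: K_def)
  have sqW: "square_integrable M W" unfolding W_def
    using bdd measurable_G[OF Y] by (intro square_integrable_sum square_integrable_bounded[where B = b])
  define \<phi> where "\<phi> u = expectation (\<lambda>\<omega>. iexp (u * W \<omega>))" for u
  define D where "D u = \<i> * expectation (\<lambda>\<omega>. W \<omega> * iexp (u * W \<omega>))" for u
  define g where "g u = \<phi> u * complex_of_real (exp (u\<^sup>2 * \<sigma>2 / 2))" for u
  define g' where "g' u = \<phi> u * complex_of_real (u * \<sigma>2 * exp (u\<^sup>2 * \<sigma>2 / 2)) + D u * complex_of_real (exp (u\<^sup>2 * \<sigma>2 / 2))" for u
  have \<phi>': "(\<phi> has_vector_derivative D u) (at u)" for u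
    unfolding \<phi>_def[abs_def] D_def by (rule expectation_iexp_has_vector_derivative[OF sqW])
  have "((\<lambda>u. exp (u\<^sup>2 * \<sigma>2 / 2)) has_real_derivative u * \<sigma>2 * exp (u\<^sup>2 * \<sigma>2 / 2)) (at u)" for u
    by (auto intro!: derivative_eq_intros)
  then have "((\<lambda>u. complex_of_real (exp (u\<^sup>2 * \<sigma>2 / 2))) has_vector_derivative complex_of_real (u * \<sigma>2 * exp (u\<^sup>2 * \<sigma>2 / 2))) (at u)" for u
    by (intro has_vector_derivative_of_real) (simp add: has_real_derivative_iff_has_vector_derivative)
  from has_vector_derivative_mult[OF \<phi>' this] have g': "(g has_vector_derivative g' u) (at u)" for u
    unfolding g_def[abs_def] g'_def by simp
  have g'_le: "norm (g' u) \<le> exp (\<theta>\<^sup>2 * \<sigma>2 / 2) * K" if "\<bar>u\<bar> \<le> \<bar>\<theta>\<bar>" for u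
  proof -
    have u2: "u\<^sup>2 \<le> \<theta>\<^sup>2" using that by (simp add: abs_le_square_iff)
    have "g' u = \<i> * complex_of_real (exp (u\<^sup>2 * \<sigma>2 / 2)) * (expectation (\<lambda>\<omega>. W \<omega> * iexp (u * W \<omega>)) - \<i> * u * \<sigma>2 * \<phi> u)"
      by (simp add: g'_def D_def algebra_simps)
    then have "norm (g' u) = exp (u\<^sup>2 * \<sigma>2 / 2) * norm (expectation (\<lambda>\<omega>. W \<omega> * iexp (u * W \<omega>)) - \<i> * u * \<sigma>2 * \<phi> u)"
      by (simp add: norm_mult)
    also have "\<dots> \<le> exp (\<theta>\<^sup>2 * \<sigma>2 / 2) * (\<bar>u\<bar> * (sqrt (6 * q * T) * (2 * q * b\<^sup>2)) + u\<^sup>2 * (2 * q\<^sup>2 * b^3 * T))"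
    proof (rule mult_mono)
      show "exp (u\<^sup>2 * \<sigma>2 / 2) \<le> exp (\<theta>\<^sup>2 * \<sigma>2 / 2)"
        using u2 \<open>0 \<le> \<sigma>2\<close> by (simp add: mult_right_mono)
      show "norm (expectation (\<lambda>\<omega>. W \<omega> * iexp (u * W \<omega>)) - \<i> * u * \<sigma>2 * \<phi> u)
        \<le> \<bar>u\<bar> * (sqrt (6 * q * T) * (2 * q * b\<^sup>2)) + u\<^sup>2 * (2 * q\<^sup>2 * b^3 * T)"
        unfolding \<phi>_def \<sigma>2_def W_def by (rule dependent_sum_stein[OF Y bdd mean \<open>0 \<le> b\<close>])
    qed auto
    also have "\<dots> \<le> exp (\<theta>\<^sup>2 * \<sigma>2 / 2) * K"
      unfolding K_def using that u2 \<open>0 \<le> b\<close> by (intro mult_left_mono add_mono mult_right_mono) auto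
    finally show ?thesis .
  qed
  \<comment> \<open>The interval is symmetric around 0, so that both signs of
    \<open>\<theta>\<close> are covered.\<close>
  have "norm (g \<theta> - g 0) \<le> exp (\<theta>\<^sup>2 * \<sigma>2 / 2) * K * norm (\<theta> - 0)"
  proof (rule differentiable_bound[where S = "{- \<bar>\<theta>\<bar>..\<bar>\<theta>\<bar>}" and f' = "\<lambda>u h. h *\<^sub>R g' u"])
    show "(g has_derivative (\<lambda>h. h *\<^sub>R g' u)) (at u within {- \<bar>\<theta>\<bar>..\<bar>\<theta>\<bar>})" for u
      using g'[of u] unfolding has_vector_derivative_def by (rule has_derivative_at_withinI)
    show "onorm (\<lambda>h. h *\<^sub>R g' u) \<le> exp (\<theta>\<^sup>2 * \<sigma>2 / 2) * K" if "u \<in> {- \<bar>\<theta>\<bar>..\<bar>\<theta>\<bar>}" for u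
    proof (rule onorm_le)
      show "norm (h *\<^sub>R g' u) \<le> exp (\<theta>\<^sup>2 * \<sigma>2 / 2) * K * norm h" for h
        using g'_le[of u] that by (simp add: mult.commute[of _ "\<bar>h\<bar>"] mult_left_mono abs_le_iff)
    qed
  qed auto
  moreover have "g 0 = 1" by (simp add: g_def \<phi>_def prob_space)
  ultimately have "norm (g \<theta> - 1) \<le> exp (\<theta>\<^sup>2 * \<sigma>2 / 2) * K * \<bar>\<theta>\<bar>" by simp
  \<comment> \<open>Undoing the integrating factor cancels the exponential in the bound, so the
    final estimate does not involve \<open>\<sigma>2\<close>.\<close>
  moreover have ee: "exp (- \<theta>\<^sup>2 * \<sigma>2 / 2) * exp (\<theta>\<^sup>2 * \<sigma>2 / 2) = 1"
    by (simp add: exp_add[symmetric])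
  have "complex_of_real c * (\<phi> \<theta> * complex_of_real d - 1) = \<phi> \<theta> * complex_of_real (c * d) - complex_of_real c" for c d
    by (simp add: algebra_simps)
  from this[of "exp (- \<theta>\<^sup>2 * \<sigma>2 / 2)" "exp (\<theta>\<^sup>2 * \<sigma>2 / 2)"]
  have "\<phi> \<theta> - complex_of_real (exp (- \<theta>\<^sup>2 * \<sigma>2 / 2)) = complex_of_real (exp (- \<theta>\<^sup>2 * \<sigma>2 / 2)) * (g \<theta> - 1)"
    unfolding ee g_def by simp
  then have "norm (\<phi> \<theta> - complex_of_real (exp (- \<theta>\<^sup>2 * \<sigma>2 / 2))) = exp (- \<theta>\<^sup>2 * \<sigma>2 / 2) * norm (g \<theta> - 1)"
    by (simp only: norm_mult norm_of_real abs_exp_cancel)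
  ultimately have "norm (\<phi> \<theta> - complex_of_real (exp (- \<theta>\<^sup>2 * \<sigma>2 / 2))) \<le> exp (- \<theta>\<^sup>2 * \<sigma>2 / 2) * (exp (\<theta>\<^sup>2 * \<sigma>2 / 2) * K * \<bar>\<theta>\<bar>)"
    by (simp only: mult_left_mono exp_ge_zero)
  also have "\<dots> = (exp (- \<theta>\<^sup>2 * \<sigma>2 / 2) * exp (\<theta>\<^sup>2 * \<sigma>2 / 2)) * (K * \<bar>\<theta>\<bar>)" by (simp only: mult.assoc)
  also have "\<dots> = K * \<bar>\<theta>\<bar>" unfolding ee by simp
  also have "\<dots> = \<theta>\<^sup>2 * (sqrt (6 * q * T) * (2 * q * b\<^sup>2)) + \<bar>\<theta>\<bar>^3 * (2 * q\<^sup>2 * b^3 * T)"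
    unfolding K_def distrib_right
    by (simp add: power3_eq_cube mult_ac) (simp add: power2_eq_square)
  finally show ?thesis by (simp add: \<phi>_def)
qed

text \<open>Three comparisons: \<open>W\<close> with the sum \<open>W'\<close> of the centred
  approximants, \<open>W'\<close> with a normal law of its own variance, and that law with the
  standard one. The first and the third cost powers of \<open>\<eta>\<close>; only the second
  involves \<open>q\<close> and \<open>B\<close>, and it carries the factor
  \<open>1 / sqrt T\<close>.\<close>

lemma char_approx_error:
  fixes X X' :: "nat \<Rightarrow> 'a \<Rightarrow> real" and a :: "nat \<Rightarrow> real" and T q :: nat
    and A B \<eta> \<theta> :: real and W :: "'a \<Rightarrow> real"
  assumes X: "\<And>t. square_integrable M (X t)"
    and X': "\<And>t. X' t \<in> borel_measurable (G {int t - int q<..int t})"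
    and X'_bdd: "\<And>t \<omega>. \<omega> \<in> space M \<Longrightarrow> \<bar>X' t \<omega>\<bar> \<le> B" and "0 \<le> B"
    and a: "\<And>t. \<bar>a t\<bar> \<le> A" and "0 < T" and "0 \<le> \<eta>"
    and close: "expectation (\<lambda>\<omega>. (\<Sum>t=1..T. a t * ((X t \<omega> - X' t \<omega>) - expectation (\<lambda>\<omega>. X t \<omega> - X' t \<omega>)))\<^sup>2) \<le> \<eta>\<^sup>2 * T"
  defines "W \<equiv> (\<lambda>\<omega>. (\<Sum>t=1..T. a t * (X t \<omega> - expectation (X t))) / sqrt T)"
  assumes norm1: "expectation (\<lambda>\<omega>. (W \<omega>)\<^sup>2) = 1"
  shows "norm (expectation (\<lambda>\<omega>. iexp (\<theta> * W \<omega>)) - exp (- \<theta>\<^sup>2 / 2))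
    \<le> \<bar>\<theta>\<bar> * \<eta> + \<theta>\<^sup>2 / 2 * (\<eta>\<^sup>2 + 2 * \<eta>)
      + (\<theta>\<^sup>2 * (sqrt (6 * q) * (2 * q * (2 * A * B)\<^sup>2)) + \<bar>\<theta>\<bar>^3 * (2 * q\<^sup>2 * (2 * A * B)^3)) / sqrt T"
proof -
  have "0 \<le> A" using a[of 0] by linarith
  have sqX': "square_integrable M (X' t)" for t
    using X'_bdd measurable_G[OF X'] by (intro square_integrable_bounded[where B = B])
  have EX'_bdd: "\<bar>expectation (X' t)\<bar> \<le> B" for t
  proof -
    have "\<bar>expectation (X' t)\<bar> \<le> expectation (\<lambda>\<omega>. \<bar>X' t \<omega>\<bar>)" by (rule integral_abs_bound)
    also have "\<dots> \<le> expectation (\<lambda>\<omega>. B)"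
      using X'_bdd square_integrable_integrable[OF sqX'] by (intro integral_mono) auto
    finally show ?thesis by (simp add: prob_space)
  qed
  define Y where "Y t \<omega> = a t / sqrt T * (X' t \<omega> - expectation (X' t))" for t \<omega>
  define W' where "W' = (\<lambda>\<omega>. \<Sum>t=1..T. Y t \<omega>)"
  \<comment> \<open>Centring doubles the bound \<open>B\<close>. As \<open>b\<close> is of order
    \<open>1 / sqrt T\<close>, both \<open>sqrt T * b\<^sup>2\<close> and \<open>T * b^3\<close> are
    of order \<open>1 / sqrt T\<close>.\<close>
  define b where "b = 2 * A * B / sqrt T"
  define \<sigma>2 where "\<sigma>2 = expectation (\<lambda>\<omega>. (W' \<omega>)\<^sup>2)"
  define \<Delta> where "\<Delta> = (\<lambda>\<omega>. W' \<omega> - W \<omega>)"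
  have sqY: "square_integrable M (Y t)" for t
    unfolding Y_def by (intro square_integrable_cmult square_integrable_diff sqX' square_integrable_const)
  have sqW': "square_integrable M W'"
    unfolding W'_def by (intro square_integrable_sum sqY)
  have sqW: "square_integrable M W"
    unfolding W_def divide_inverse mult.commute[of _ "inverse _"]
    by (intro square_integrable_cmult square_integrable_sum square_integrable_diff X square_integrable_const)
  have sqD: "square_integrable M \<Delta>"
    unfolding \<Delta>_def by (intro square_integrable_diff sqW sqW')
  note [measurable] = sqW[THEN square_integrable_measurable] sqW'[THEN square_integrable_measurable]
  have "\<Delta> \<omega> = - (\<Sum>t=1..T. a t * ((X t \<omega> - X' t \<omega>) - expectation (\<lambda>\<omega>. X t \<omega> - X' t \<omega>))) / sqrt T" for \<omega>
  proof -
    have "\<Delta> \<omega> = (\<Sum>t=1..T. a t * (X' t \<omega> - expectation (X' t)) / sqrt T - a t * (X t \<omega> - expectation (X t)) / sqrt T)"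
      by (simp add: \<Delta>_def W'_def W_def Y_def sum_subtractf sum_divide_distrib)
    also have "\<dots> = (\<Sum>t=1..T. - (a t * ((X t \<omega> - X' t \<omega>) - expectation (\<lambda>\<omega>. X t \<omega> - X' t \<omega>))) / sqrt T)"
      using X sqX' by (intro sum.cong refl) (simp add: square_integrable_integrable diff_divide_distrib add_divide_distrib algebra_simps)
    finally show ?thesis by (simp add: sum_negf sum_divide_distrib)
  qed
  then have "expectation (\<lambda>\<omega>. (\<Delta> \<omega>)\<^sup>2) = expectation (\<lambda>\<omega>. (\<Sum>t=1..T. a t * ((X t \<omega> - X' t \<omega>) - expectation (\<lambda>\<omega>. X t \<omega> - X' t \<omega>)))\<^sup>2) / T"
    by (simp add: power_divide)
  with close \<open>0 < T\<close> have D2: "expectation (\<lambda>\<omega>. (\<Delta> \<omega>)\<^sup>2) \<le> \<eta>\<^sup>2"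
    by (simp add: divide_le_eq)
  then have D1: "sqrt (expectation (\<lambda>\<omega>. (\<Delta> \<omega>)\<^sup>2)) \<le> \<eta>"
    using \<open>0 \<le> \<eta>\<close> by (intro real_le_lsqrt) auto
  have step1: "norm (expectation (\<lambda>\<omega>. iexp (\<theta> * W \<omega>)) - expectation (\<lambda>\<omega>. iexp (\<theta> * W' \<omega>))) \<le> \<bar>\<theta>\<bar> * \<eta>"
  proof -
    have "norm (expectation (\<lambda>\<omega>. iexp (\<theta> * W \<omega>)) - expectation (\<lambda>\<omega>. iexp (\<theta> * W' \<omega>)))
      \<le> expectation (\<lambda>\<omega>. \<bar>\<theta>\<bar> * \<bar>\<Delta> \<omega>\<bar>)"
    proof (rule norm_expectation_iexp_diff_le)
      show "AE \<omega> in M. \<bar>\<theta> * W \<omega> - \<theta> * W' \<omega>\<bar> \<le> \<bar>\<theta>\<bar> * \<bar>\<Delta> \<omega>\<bar>"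
        by (simp add: \<Delta>_def abs_minus_commute flip: abs_mult right_diff_distrib)
    qed (use square_integrable_integrable[OF sqD] in auto)
    also have "\<dots> = \<bar>\<theta>\<bar> * expectation (\<lambda>\<omega>. \<bar>\<Delta> \<omega>\<bar>)" by simp
    also have "\<dots> \<le> \<bar>\<theta>\<bar> * \<eta>"
      using expectation_abs_le_sqrt[OF sqD] D1 by (intro mult_left_mono) auto
    finally show ?thesis .
  qed
  have step2: "norm (expectation (\<lambda>\<omega>. iexp (\<theta> * W' \<omega>)) - exp (- \<theta>\<^sup>2 * \<sigma>2 / 2))
    \<le> \<theta>\<^sup>2 * (sqrt (6 * q * T) * (2 * q * b\<^sup>2)) + \<bar>\<theta>\<bar>^3 * (2 * q\<^sup>2 * b^3 * T)"
    unfolding W'_def \<sigma>2_def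
  proof (rule dependent_sum_char_bound)
    fix t
    have [measurable]: "X' t \<in> borel_measurable (G {int t - int q<..int t})" by fact
    show "Y t \<in> borel_measurable (G {int t - int q<..int t})" unfolding Y_def by measurable
    show "expectation (Y t) = 0"
      using square_integrable_integrable[OF sqX'] by (simp add: Y_def[abs_def] prob_space)
    fix \<omega> assume "\<omega> \<in> space M"
    then have "\<bar>X' t \<omega> - expectation (X' t)\<bar> \<le> 2 * B"
      using X'_bdd[of \<omega> t] EX'_bdd[of t] by linarith
    then have "\<bar>a t\<bar> * \<bar>X' t \<omega> - expectation (X' t)\<bar> \<le> A * (2 * B)"
      using a[of t] \<open>0 \<le> A\<close> by (intro mult_mono) auto
    then show "\<bar>Y t \<omega>\<bar> \<le> b"
      by (simp add: Y_def b_def abs_mult divide_right_mono mult_ac)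
  qed (use \<open>0 \<le> A\<close> \<open>0 \<le> B\<close> in \<open>simp add: b_def\<close>)
  also have "\<dots> = (\<theta>\<^sup>2 * (sqrt (6 * q) * (2 * q * (2 * A * B)\<^sup>2)) + \<bar>\<theta>\<bar>^3 * (2 * q\<^sup>2 * (2 * A * B)^3)) / sqrt T"
  proof -
    have TT: "real T = sqrt T * sqrt T" by simp
    have "\<theta>\<^sup>2 * (sqrt (6 * q * T) * (2 * q * b\<^sup>2)) = \<theta>\<^sup>2 * (sqrt (6 * q) * (2 * q * (2 * A * B)\<^sup>2)) / sqrt T"
      using \<open>0 < T\<close> by (simp add: b_def power_divide real_sqrt_mult field_simps)
    moreover have "b^3 * T = (2 * A * B)^3 / sqrt T"
      unfolding b_def power_divide using \<open>0 < T\<close>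
      by (subst TT) (simp add: power3_eq_cube field_simps del: real_sqrt_mult_self)
    then have "\<bar>\<theta>\<bar>^3 * (2 * q\<^sup>2 * b^3 * T) = \<bar>\<theta>\<bar>^3 * (2 * q\<^sup>2 * (2 * A * B)^3) / sqrt T"
      by (simp add: mult.assoc)
    ultimately show ?thesis by (simp only: add_divide_distrib)
  qed
  finally have step2: "norm (expectation (\<lambda>\<omega>. iexp (\<theta> * W' \<omega>)) - exp (- \<theta>\<^sup>2 * \<sigma>2 / 2)) \<le> \<dots>" .
  have step3: "norm (complex_of_real (exp (- \<theta>\<^sup>2 * \<sigma>2 / 2)) - complex_of_real (exp (- \<theta>\<^sup>2 / 2))) \<le> \<theta>\<^sup>2 / 2 * (\<eta>\<^sup>2 + 2 * \<eta>)"
  proof -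
    have "0 \<le> \<sigma>2" by (simp add: \<sigma>2_def)
    \<comment> \<open>Since \<open>W\<close> has second moment 1, expanding the square of
      \<open>W + \<Delta>\<close> leaves a cross term of at most \<open>2 * \<eta>\<close> by
      Cauchy-Schwarz.\<close>
    have "\<sigma>2 = expectation (\<lambda>\<omega>. (W \<omega>)\<^sup>2 + (\<Delta> \<omega>)\<^sup>2 + 2 * (W \<omega> * \<Delta> \<omega>))"
      unfolding \<sigma>2_def by (rule Bochner_Integration.integral_cong) (auto simp: \<Delta>_def power2_eq_square algebra_simps)
    also have "\<dots> = 1 + expectation (\<lambda>\<omega>. (\<Delta> \<omega>)\<^sup>2) + 2 * expectation (\<lambda>\<omega>. W \<omega> * \<Delta> \<omega>)"
      using sqW sqD square_integrable_mult[OF sqW sqD] by (simp add: square_integrable_def norm1)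
    finally have "\<bar>\<sigma>2 - 1\<bar> \<le> \<bar>expectation (\<lambda>\<omega>. (\<Delta> \<omega>)\<^sup>2)\<bar> + 2 * \<bar>expectation (\<lambda>\<omega>. W \<omega> * \<Delta> \<omega>)\<bar>" by linarith
    moreover have "\<bar>expectation (\<lambda>\<omega>. W \<omega> * \<Delta> \<omega>)\<bar> \<le> \<eta>"
      using abs_integral_mult_le[OF sqW sqD] D1 by (simp add: norm1)
    ultimately have s: "\<bar>\<sigma>2 - 1\<bar> \<le> \<eta>\<^sup>2 + 2 * \<eta>" using D2 by simp
    have "norm (complex_of_real (exp (- \<theta>\<^sup>2 * \<sigma>2 / 2)) - complex_of_real (exp (- \<theta>\<^sup>2 / 2))) = \<bar>exp (- (\<theta>\<^sup>2 * \<sigma>2 / 2)) - exp (- (\<theta>\<^sup>2 / 2))\<bar>"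
      by (simp only: norm_of_real of_real_diff[symmetric] minus_mult_left[symmetric] minus_divide_left)
    also have "\<dots> \<le> \<bar>\<theta>\<^sup>2 * \<sigma>2 / 2 - \<theta>\<^sup>2 / 2\<bar>"
      using \<open>0 \<le> \<sigma>2\<close> by (intro abs_exp_minus_diff_le) auto
    also have "\<dots> = \<theta>\<^sup>2 / 2 * \<bar>\<sigma>2 - 1\<bar>"
    proof -
      have "\<theta>\<^sup>2 * \<sigma>2 / 2 - \<theta>\<^sup>2 / 2 = \<theta>\<^sup>2 / 2 * (\<sigma>2 - 1)" by (simp add: field_simps)
      then show ?thesis by (simp only: abs_mult) simp
    qed
    also have "\<dots> \<le> \<theta>\<^sup>2 / 2 * (\<eta>\<^sup>2 + 2 * \<eta>)" using s by (intro mult_left_mono) auto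
    finally show ?thesis .
  qed
  show ?thesis
    using step1 step2 step3
      norm_triangle_ineq[of "expectation (\<lambda>\<omega>. iexp (\<theta> * W \<omega>)) - expectation (\<lambda>\<omega>. iexp (\<theta> * W' \<omega>))"
        "expectation (\<lambda>\<omega>. iexp (\<theta> * W' \<omega>)) - exp (- \<theta>\<^sup>2 * \<sigma>2 / 2)"]
      norm_triangle_ineq[of "expectation (\<lambda>\<omega>. iexp (\<theta> * W \<omega>)) - exp (- \<theta>\<^sup>2 * \<sigma>2 / 2)"
        "complex_of_real (exp (- \<theta>\<^sup>2 * \<sigma>2 / 2)) - complex_of_real (exp (- \<theta>\<^sup>2 / 2))"]
    unfolding diff_add_cancel add_diff_eq by linarith
qed

text \<open>In \<open>approx\<close> the approximants are chosen before \<open>T\<close>,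
  \<open>a\<close> and \<open>A\<close>, so one choice serves all sample sizes. The tolerance
  \<open>r\<close> therefore fixes \<open>\<eta>\<close>, then \<open>q\<close> and
  \<open>B\<close>, and the remaining error \<open>C / sqrt T\<close> vanishes with these
  frozen.\<close>

lemma char_normalised_sum_tendsto:
  fixes X :: "nat \<Rightarrow> 'a \<Rightarrow> real" and a :: "nat \<Rightarrow> nat \<Rightarrow> real" and A \<theta> :: real
    and W :: "nat \<Rightarrow> 'a \<Rightarrow> real"
  assumes X: "\<And>t. square_integrable M (X t)"
    and approx: "\<And>\<epsilon>. 0 < \<epsilon> \<Longrightarrow> \<exists>q B X'. (\<forall>t. X' t \<in> borel_measurable (G {int t - int q<..int t})) \<and>
      (\<forall>t. \<forall>\<omega>\<in>space M. \<bar>X' t \<omega>\<bar> \<le> B) \<and> (\<forall>T a A. (\<forall>t. \<bar>a t\<bar> \<le> A) \<longrightarrow>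
      expectation (\<lambda>\<omega>. (\<Sum>t=1..T. a t * ((X t \<omega> - X' t \<omega>) - expectation (\<lambda>\<omega>. X t \<omega> - X' t \<omega>)))\<^sup>2)
        \<le> A\<^sup>2 * \<epsilon> * real T)"
    and a: "\<forall>\<^sub>F T in sequentially. \<forall>t. \<bar>a T t\<bar> \<le> A"
  defines "W \<equiv> (\<lambda>T \<omega>. (\<Sum>t=1..T. a T t * (X t \<omega> - expectation (X t))) / sqrt T)"
  assumes norm1: "\<forall>\<^sub>F T in sequentially. expectation (\<lambda>\<omega>. (W T \<omega>)\<^sup>2) = 1"
  shows "(\<lambda>T. expectation (\<lambda>\<omega>. iexp (\<theta> * W T \<omega>))) \<longlonglongrightarrow> exp (- \<theta>\<^sup>2 / 2)"
proof (rule tendstoI)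
  fix r :: real assume "0 < r"
  \<comment> \<open>\<open>\<eta> \<le> 1\<close> gives \<open>\<eta>\<^sup>2 \<le> \<eta>\<close>,
    so the errors that do not decay in \<open>T\<close> add up to at most
    \<open>\<eta> * (\<bar>\<theta>\<bar> + 3 * \<theta>\<^sup>2 / 2)\<close>; the extra 1 in the
    denominator covers \<open>\<theta> = 0\<close>.\<close>
  define \<eta> where "\<eta> = min 1 (r / (2 * (\<bar>\<theta>\<bar> + 3 * \<theta>\<^sup>2 / 2 + 1)))"
  have pos: "0 < \<bar>\<theta>\<bar> + 3 * \<theta>\<^sup>2 / 2 + 1"
    using zero_le_power2[of \<theta>] abs_ge_zero[of \<theta>] by linarith
  then have \<eta>: "0 < \<eta>" "\<eta> \<le> 1" and \<eta>r: "\<eta> * (\<bar>\<theta>\<bar> + 3 * \<theta>\<^sup>2 / 2 + 1) \<le> r / 2"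
    using \<open>0 < r\<close> by (auto simp: \<eta>_def min_def divide_simps)
  have half: "\<bar>\<theta>\<bar> * \<eta> + \<theta>\<^sup>2 / 2 * (\<eta>\<^sup>2 + 2 * \<eta>) \<le> r / 2"
  proof -
    have "\<eta>\<^sup>2 \<le> \<eta>" using \<eta> by (simp add: power2_eq_square mult_left_le)
    then have "\<theta>\<^sup>2 / 2 * (\<eta>\<^sup>2 + 2 * \<eta>) \<le> \<theta>\<^sup>2 / 2 * (3 * \<eta>)" by (intro mult_left_mono) auto
    then have "\<bar>\<theta>\<bar> * \<eta> + \<theta>\<^sup>2 / 2 * (\<eta>\<^sup>2 + 2 * \<eta>) \<le> \<eta> * (\<bar>\<theta>\<bar> + 3 * \<theta>\<^sup>2 / 2 + 1)"
      using \<eta> by (simp add: algebra_simps)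
    with \<eta>r show ?thesis by linarith
  qed
  \<comment> \<open>Adding 1 allows division by \<open>A'\<^sup>2\<close> in the tolerance handed to
    \<open>approx\<close>, even if \<open>A = 0\<close>.\<close>
  define A' where "A' = \<bar>A\<bar> + 1"
  have "0 < A'" by (simp add: A'_def)
  have "0 < \<eta>\<^sup>2 / A'\<^sup>2" using \<eta> \<open>0 < A'\<close> by simp
  from approx[OF this] obtain q B X' where *: "\<forall>t. X' t \<in> borel_measurable (G {int t - int q<..int t})"
      "\<forall>t. \<forall>\<omega>\<in>space M. \<bar>X' t \<omega>\<bar> \<le> B"
      "\<forall>T a A. (\<forall>t. \<bar>a t\<bar> \<le> A) \<longrightarrow> expectation (\<lambda>\<omega>. (\<Sum>t=1..T. a t * ((X t \<omega> - X' t \<omega>) - expectation (\<lambda>\<omega>. X t \<omega> - X' t \<omega>)))\<^sup>2)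
        \<le> A\<^sup>2 * (\<eta>\<^sup>2 / A'\<^sup>2) * real T"
    by (elim exE conjE) (rule that)
  note X' = *(1)[rule_format] *(2)[rule_format] *(3)[rule_format]
  have "0 \<le> B" using X'(2) not_empty by fastforce
  define C where "C = \<theta>\<^sup>2 * (sqrt (6 * q) * (2 * q * (2 * A' * B)\<^sup>2)) + \<bar>\<theta>\<bar>^3 * (2 * q\<^sup>2 * (2 * A' * B)^3)"
  have "(\<lambda>T. C / sqrt (real T)) \<longlonglongrightarrow> 0"
    by (intro real_tendsto_divide_at_top[OF tendsto_const] filterlim_compose[OF sqrt_at_top filterlim_real_sequentially])
  then have "\<forall>\<^sub>F T in sequentially. C / sqrt (real T) < r / 2"
    using \<open>0 < r\<close> by (intro order_tendstoD(2)) auto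
  then show "\<forall>\<^sub>F T in sequentially. dist (expectation (\<lambda>\<omega>. iexp (\<theta> * W T \<omega>))) (exp (- \<theta>\<^sup>2 / 2)) < r"
    using a norm1 eventually_gt_at_top[of 0]
  proof eventually_elim
    case (elim T)
    have a': "\<bar>a T t\<bar> \<le> A'" for t using elim(2)[rule_format, of t] by (simp add: A'_def)
    have "norm (expectation (\<lambda>\<omega>. iexp (\<theta> * W T \<omega>)) - exp (- \<theta>\<^sup>2 / 2))
       \<le> \<bar>\<theta>\<bar> * \<eta> + \<theta>\<^sup>2 / 2 * (\<eta>\<^sup>2 + 2 * \<eta>) + C / sqrt T"
      unfolding W_def C_def
    proof (rule char_approx_error[OF X X'(1) X'(2) \<open>0 \<le> B\<close> a' elim(4)])
      show "expectation (\<lambda>\<omega>. (\<Sum>t=1..T. a T t * ((X t \<omega> - X' t \<omega>) - expectation (\<lambda>\<omega>. X t \<omega> - X' t \<omega>)))\<^sup>2) \<le> \<eta>\<^sup>2 * T"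
        using X'(3)[of "a T", OF a'] \<open>0 < A'\<close> by simp
    qed (use elim(3) \<eta> in \<open>simp_all add: W_def\<close>)
    with half elim(1) show ?case unfolding dist_norm by linarith
  qed
qed

end

section \<open>Linear processes and their truncations\<close>

text \<open>Cauchy-Schwarz with respect to the weights \<open>c\<close> bounds the squared series by
  \<open>suminf c\<close> times the series of \<open>c j * (Y j)\<^sup>2\<close>, and Tonelli
  integrates the latter term by term. The \<open>Y j\<close> may depend on each other in any
  way.\<close>

lemma weighted_series_second_moment:
  fixes c :: "nat \<Rightarrow> real" and Y :: "nat \<Rightarrow> 'a \<Rightarrow> real"
  assumes c: "\<And>j. 0 \<le> c j" "summable c" and Y[measurable]: "\<And>j. Y j \<in> borel_measurable M"
    and mom: "\<And>j. (\<integral>\<^sup>+\<omega>. ennreal ((Y j \<omega>)\<^sup>2) \<partial>M) \<le> ennreal \<kappa>" and "0 \<le> \<kappa>"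
  shows "AE \<omega> in M. summable (\<lambda>j. c j * \<bar>Y j \<omega>\<bar>)"
    and "(\<integral>\<^sup>+\<omega>. ennreal ((\<Sum>j. c j * \<bar>Y j \<omega>\<bar>)\<^sup>2) \<partial>M) \<le> ennreal ((suminf c)\<^sup>2 * \<kappa>)"
proof -
  \<comment> \<open>As an extended real sum, \<open>S\<close> can be integrated before convergence
    is known; its finite mean then yields convergence almost everywhere.\<close>
  define S where "S \<omega> = (\<Sum>j. ennreal (c j * (Y j \<omega>)\<^sup>2))" for \<omega>
  have [measurable]: "S \<in> borel_measurable M" unfolding S_def by measurable
  have sc: "0 \<le> suminf c" using c by (intro suminf_nonneg) auto
  have "(\<integral>\<^sup>+\<omega>. S \<omega> \<partial>M) = (\<Sum>j. \<integral>\<^sup>+\<omega>. ennreal (c j * (Y j \<omega>)\<^sup>2) \<partial>M)"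
    unfolding S_def by (intro nn_integral_suminf) measurable
  also have "\<dots> = (\<Sum>j. ennreal (c j) * (\<integral>\<^sup>+\<omega>. ennreal ((Y j \<omega>)\<^sup>2) \<partial>M))"
    using c by (simp add: ennreal_mult nn_integral_cmult)
  also have "\<dots> \<le> (\<Sum>j. ennreal (c j) * ennreal \<kappa>)"
    by (intro suminf_le mult_left_mono mom) auto
  also have "\<dots> = (\<Sum>j. ennreal (c j * \<kappa>))"
    using c \<open>0 \<le> \<kappa>\<close> by (simp add: ennreal_mult)
  also have "\<dots> = ennreal (suminf c * \<kappa>)"
    using c \<open>0 \<le> \<kappa>\<close> by (subst suminf_ennreal2) (auto simp: suminf_mult2 summable_mult2)
  finally have S_le: "(\<integral>\<^sup>+\<omega>. S \<omega> \<partial>M) \<le> ennreal (suminf c * \<kappa>)" .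
  then have "(\<integral>\<^sup>+\<omega>. S \<omega> \<partial>M) \<noteq> \<infinity>"
    by (auto simp: top_unique)
  then have fin: "AE \<omega> in M. S \<omega> \<noteq> \<infinity>"
    by (intro nn_integral_PInf_AE) auto
  have sumY2: "summable (\<lambda>j. c j * (Y j \<omega>)\<^sup>2)" if "S \<omega> \<noteq> \<infinity>" for \<omega>
    using that c unfolding S_def by (intro summable_suminf_not_top) auto
  have sumY: "summable (\<lambda>j. c j * \<bar>Y j \<omega>\<bar>)" if "S \<omega> \<noteq> \<infinity>" for \<omega>
  proof (rule summable_comparison_test')
    show "summable (\<lambda>j. c j + c j * (Y j \<omega>)\<^sup>2)"
      using sumY2[OF that] c by (intro summable_add)
    have "\<bar>y\<bar> \<le> 1 + y\<^sup>2" for y :: real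
      using sum_squares_bound[of 1 "\<bar>y\<bar>"] by simp
    from mult_left_mono[OF this c(1)] show "norm (c j * \<bar>Y j \<omega>\<bar>) \<le> c j + c j * (Y j \<omega>)\<^sup>2" for j
      using c(1)[of j] by (simp add: abs_mult distrib_left)
  qed
  then show "AE \<omega> in M. summable (\<lambda>j. c j * \<bar>Y j \<omega>\<bar>)" using fin by auto
  have CS: "(\<Sum>j. c j * \<bar>Y j \<omega>\<bar>)\<^sup>2 \<le> suminf c * (\<Sum>j. c j * (Y j \<omega>)\<^sup>2)" if "S \<omega> \<noteq> \<infinity>" for \<omega>
  proof (rule LIMSEQ_le)
    show "(\<lambda>n. (\<Sum>j<n. c j * \<bar>Y j \<omega>\<bar>)\<^sup>2) \<longlonglongrightarrow> (\<Sum>j. c j * \<bar>Y j \<omega>\<bar>)\<^sup>2"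
      using sumY[OF that] by (intro tendsto_power summable_LIMSEQ)
    show "(\<lambda>n. (\<Sum>j<n. c j) * (\<Sum>j<n. c j * (Y j \<omega>)\<^sup>2)) \<longlonglongrightarrow> suminf c * (\<Sum>j. c j * (Y j \<omega>)\<^sup>2)"
      using sumY2[OF that] c by (intro tendsto_mult summable_LIMSEQ)
    have "(\<Sum>j<n. c j * \<bar>Y j \<omega>\<bar>)\<^sup>2 \<le> (\<Sum>j<n. c j) * (\<Sum>j<n. c j * (Y j \<omega>)\<^sup>2)" for n
      using Cauchy_Schwarz_ineq_sum[of "\<lambda>j. sqrt (c j)" "\<lambda>j. sqrt (c j) * \<bar>Y j \<omega>\<bar>" "{..<n}"] c
      by (simp add: power_mult_distrib mult.assoc[symmetric])
    then show "\<exists>N. \<forall>n\<ge>N. (\<Sum>j<n. c j * \<bar>Y j \<omega>\<bar>)\<^sup>2 \<le> (\<Sum>j<n. c j) * (\<Sum>j<n. c j * (Y j \<omega>)\<^sup>2)"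
      by blast
  qed
  have "(\<integral>\<^sup>+\<omega>. ennreal ((\<Sum>j. c j * \<bar>Y j \<omega>\<bar>)\<^sup>2) \<partial>M) \<le> (\<integral>\<^sup>+\<omega>. ennreal (suminf c) * S \<omega> \<partial>M)"
  proof (rule nn_integral_mono_AE)
    show "AE \<omega> in M. ennreal ((\<Sum>j. c j * \<bar>Y j \<omega>\<bar>)\<^sup>2) \<le> ennreal (suminf c) * S \<omega>"
      using fin
    proof eventually_elim
      case (elim \<omega>)
      have "S \<omega> = ennreal (\<Sum>j. c j * (Y j \<omega>)\<^sup>2)"
        unfolding S_def using c sumY2[OF elim] by (intro suminf_ennreal2) auto
      with CS[OF elim] show ?case
        using sc by (simp add: ennreal_mult'[symmetric] ennreal_leI)
    qed
  qed
  also have "\<dots> = ennreal (suminf c) * (\<integral>\<^sup>+\<omega>. S \<omega> \<partial>M)"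
    by (rule nn_integral_cmult) measurable
  also have "\<dots> \<le> ennreal (suminf c) * ennreal (suminf c * \<kappa>)"
    by (intro mult_left_mono S_le) auto
  also have "\<dots> = ennreal ((suminf c)\<^sup>2 * \<kappa>)"
    using sc \<open>0 \<le> \<kappa>\<close> by (simp add: ennreal_mult'[symmetric] power2_eq_square mult.assoc)
  finally show "(\<integral>\<^sup>+\<omega>. ennreal ((\<Sum>j. c j * \<bar>Y j \<omega>\<bar>)\<^sup>2) \<partial>M) \<le> ennreal ((suminf c)\<^sup>2 * \<kappa>)" .
qed

text \<open>Two dominations with different tasks: the one by \<open>c\<close> and \<open>Y\<close>
  makes both series converge almost everywhere, so that each \<open>suminf\<close> is a genuine sum;
  the one by \<open>c'\<close> and \<open>Z\<close> measures how far they are apart.\<close>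

lemma series_diff_second_moment:
  fixes V1 V2 :: "nat \<Rightarrow> 'a \<Rightarrow> 'b::banach" and Y Z :: "nat \<Rightarrow> 'a \<Rightarrow> real"
  assumes c: "\<And>j. 0 \<le> c j" "summable c" and Y: "\<And>j. Y j \<in> borel_measurable M"
    and momY: "\<And>j. (\<integral>\<^sup>+\<omega>. ennreal ((Y j \<omega>)\<^sup>2) \<partial>M) \<le> ennreal \<kappa>" and "0 \<le> \<kappa>"
    and c': "\<And>j. 0 \<le> c' j" "summable c'" and Z: "\<And>j. Z j \<in> borel_measurable M"
    and momZ: "\<And>j. (\<integral>\<^sup>+\<omega>. ennreal ((Z j \<omega>)\<^sup>2) \<partial>M) \<le> ennreal \<kappa>'" and "0 \<le> \<kappa>'"
    and V1: "\<And>j \<omega>. norm (V1 j \<omega>) \<le> c j * \<bar>Y j \<omega>\<bar>" and V2: "\<And>j \<omega>. norm (V2 j \<omega>) \<le> c j * \<bar>Y j \<omega>\<bar>"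
    and V: "\<And>j \<omega>. norm (V1 j \<omega> - V2 j \<omega>) \<le> c' j * \<bar>Z j \<omega>\<bar>"
  shows "(\<integral>\<^sup>+\<omega>. ennreal ((norm ((\<Sum>j. V1 j \<omega>) - (\<Sum>j. V2 j \<omega>)))\<^sup>2) \<partial>M) \<le> ennreal ((suminf c')\<^sup>2 * \<kappa>')"
proof -
  have Y': "AE \<omega> in M. summable (\<lambda>j. c j * \<bar>Y j \<omega>\<bar>)"
    using c Y momY \<open>0 \<le> \<kappa>\<close> by (rule weighted_series_second_moment)
  have Z': "AE \<omega> in M. summable (\<lambda>j. c' j * \<bar>Z j \<omega>\<bar>)"
    using c' Z momZ \<open>0 \<le> \<kappa>'\<close> by (rule weighted_series_second_moment)
  have "(\<integral>\<^sup>+\<omega>. ennreal ((norm ((\<Sum>j. V1 j \<omega>) - (\<Sum>j. V2 j \<omega>)))\<^sup>2) \<partial>M) \<le> (\<integral>\<^sup>+\<omega>. ennreal ((\<Sum>j. c' j * \<bar>Z j \<omega>\<bar>)\<^sup>2) \<partial>M)"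
  proof (rule nn_integral_mono_AE)
    show "AE \<omega> in M. ennreal ((norm ((\<Sum>j. V1 j \<omega>) - (\<Sum>j. V2 j \<omega>)))\<^sup>2) \<le> ennreal ((\<Sum>j. c' j * \<bar>Z j \<omega>\<bar>)\<^sup>2)"
      using Y' Z'
    proof eventually_elim
      case (elim \<omega>)
      have s: "summable (\<lambda>j. V1 j \<omega>)" "summable (\<lambda>j. V2 j \<omega>)"
        by (rule summable_comparison_test'[OF elim(1)], rule V1)
          (rule summable_comparison_test'[OF elim(1)], rule V2)
      have "norm ((\<Sum>j. V1 j \<omega>) - (\<Sum>j. V2 j \<omega>)) = norm (\<Sum>j. V1 j \<omega> - V2 j \<omega>)"
        using s by (simp add: suminf_diff)
      also have "\<dots> \<le> (\<Sum>j. c' j * \<bar>Z j \<omega>\<bar>)"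
        using elim(2) V by (intro norm_suminf_le) auto
      finally show ?case by (intro ennreal_leI power_mono) auto
    qed
  qed
  also have "\<dots> \<le> ennreal ((suminf c')\<^sup>2 * \<kappa>')"
    using c' Z momZ \<open>0 \<le> \<kappa>'\<close> by (rule weighted_series_second_moment)
  finally show ?thesis .
qed

text \<open>Written as a series over all lags with weight zero below \<open>k\<close>, so that it
  appears directly as the total weight in \<open>series_diff_second_moment\<close>. Its order is
  \<open>k powr (-2)\<close>.\<close>

definition cubic_tail :: "nat \<Rightarrow> real"
  where "cubic_tail k = (\<Sum>j. if k \<le> j then real (Suc j) powr (-3) else 0)"

lemma summable_cubic: "summable (\<lambda>j. if k \<le> j then real (Suc j) powr (-3) else 0)"
proof (rule summable_comparison_test')
  show "summable (\<lambda>j. real (Suc j) powr (-3))"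
    by (subst summable_Suc_iff) (simp add: summable_real_powr_iff)
qed auto

lemma cubic_tail_nonneg: "0 \<le> cubic_tail k"
  unfolding cubic_tail_def by (intro suminf_nonneg summable_cubic) auto

text \<open>For \<open>j \<ge> k\<close> half of the exponent can be spent on \<open>k\<close>: the
  tail is at most a constant times \<open>Suc k powr (-3/2)\<close>, which is already
  summable.\<close>

lemma summable_cubic_tail: "summable cubic_tail"
proof (rule summable_comparison_test')
  have s: "summable (\<lambda>j. real (Suc j) powr (-3/2))"
    by (subst summable_Suc_iff) (simp add: summable_real_powr_iff)
  then show "summable (\<lambda>k. real (Suc k) powr (-3/2) * (\<Sum>j. real (Suc j) powr (-3/2)))"
    by (rule summable_mult2)
  fix k
  have "cubic_tail k \<le> (\<Sum>j. real (Suc k) powr (-3/2) * real (Suc j) powr (-3/2))"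
    unfolding cubic_tail_def
  proof (intro suminf_le summable_cubic summable_mult s)
    fix j
    have "real (Suc j) powr (-3) = real (Suc j) powr (-3/2) * real (Suc j) powr (-3/2)"
      by (simp add: powr_add[symmetric])
    also have "\<dots> \<le> real (Suc k) powr (-3/2) * real (Suc j) powr (-3/2)" if "k \<le> j"
      using that by (intro mult_right_mono powr_mono2') auto
    finally show "(if k \<le> j then real (Suc j) powr (-3) else 0) \<le> real (Suc k) powr (-3/2) * real (Suc j) powr (-3/2)"
      by auto
  qed
  then show "norm (cubic_tail k) \<le> real (Suc k) powr (-3/2) * (\<Sum>j. real (Suc j) powr (-3/2))"
    using cubic_tail_nonneg[of k] s by (simp add: suminf_mult)
qed

section \<open>Vector norms, clipping and measurability\<close>

lemma norm_matrix_vector_mult_le: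
  fixes C :: "real^'n^'m"
  assumes C: "\<And>i j. \<bar>C $ i $ j\<bar> \<le> c"
  shows "norm (C *v y) \<le> real CARD('m) * real CARD('n) * c * norm y"
proof -
  have "0 \<le> c" using C[of undefined undefined] by linarith
  have "norm (C *v y) \<le> (\<Sum>i\<in>UNIV. \<bar>(C *v y) $ i\<bar>)" by (rule norm_le_l1_cart)
  also have "\<dots> \<le> (\<Sum>i\<in>(UNIV::'m set). \<Sum>j\<in>(UNIV::'n set). c * norm y)"
  proof (rule sum_mono)
    fix i
    have "\<bar>(C *v y) $ i\<bar> \<le> (\<Sum>j\<in>UNIV. \<bar>C $ i $ j * y $ j\<bar>)"
      unfolding matrix_vector_mult_def by (simp add: sum_abs)
    also have "\<dots> \<le> (\<Sum>j\<in>(UNIV::'n set). c * norm y)"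
      using C \<open>0 \<le> c\<close> by (intro sum_mono) (auto simp: abs_mult intro!: mult_mono component_le_norm_cart)
    finally show "\<bar>(C *v y) $ i\<bar> \<le> (\<Sum>j\<in>(UNIV::'n set). c * norm y)" .
  qed
  finally show ?thesis by (simp add: mult_ac)
qed

lemma power2_norm_vec: "(norm (x :: real^'n))\<^sup>2 = (\<Sum>i\<in>UNIV. (x $ i)\<^sup>2)"
  unfolding power2_norm_eq_inner inner_vec_def by (simp add: power2_eq_square)

lemma power2_sum_le_card:
  fixes f :: "'i \<Rightarrow> real"
  shows "(\<Sum>i\<in>A. f i)\<^sup>2 \<le> real (card A) * (\<Sum>i\<in>A. (f i)\<^sup>2)"
  using Cauchy_Schwarz_ineq_sum[of "\<lambda>_. 1" f A] by simp

text \<open>A continuous map of each coordinate: clipped innovations stay measurable with respect to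
  the same \<open>G I\<close>, so independence is kept. Their means may shift, which the later
  recentring of the approximants absorbs.\<close>

definition clip_vec :: "real \<Rightarrow> real^'n \<Rightarrow> real^'n"
  where "clip_vec b y = (\<chi> i. max (- b) (min b (y $ i)))"

lemma clip_vec_measurable [measurable]: "clip_vec b \<in> borel_measurable borel"
proof -
  have "continuous_on UNIV (clip_vec b :: real^'n \<Rightarrow> _)"
    unfolding clip_vec_def by (intro continuous_intros)
  then show ?thesis by (rule borel_measurable_continuous_onI)
qed

lemma norm_clip_vec_le:
  assumes "0 \<le> b"
  shows "norm (clip_vec b y) \<le> norm y"
  unfolding clip_vec_def norm_vec_def using assms by (intro L2_set_mono) (auto simp: max_def min_def)

lemma norm_clip_vec_le_bound:
  assumes "0 \<le> b"
  shows "norm (clip_vec b (y :: real^'n)) \<le> real CARD('n) * b"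
proof -
  have "norm (clip_vec b y) \<le> (\<Sum>i\<in>UNIV. \<bar>clip_vec b y $ i\<bar>)" by (rule norm_le_l1_cart)
  also have "\<dots> \<le> real CARD('n) * b"
    using assms by (intro sum_bounded_above) (auto simp: clip_vec_def max_def min_def)
  finally show ?thesis .
qed

text \<open>Where clipping acts, \<open>\<bar>y\<bar> > b\<close>, so a factor
  \<open>(\<bar>y\<bar> / b) powr \<delta>\<close> above 1 can be inserted. Here the moment of order
  \<open>2 + \<delta>\<close> becomes a clipping error of order
  \<open>b powr (- \<delta>)\<close>.\<close>

lemma clip_error_square_le:
  fixes y b \<delta> :: real
  assumes "0 < b" "0 < \<delta>"
  shows "(y - max (- b) (min b y))\<^sup>2 \<le> \<bar>y\<bar> powr (2 + \<delta>) / b powr \<delta>"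
proof (cases "\<bar>y\<bar> \<le> b")
  case True
  then have "max (- b) (min b y) = y" by auto
  then show ?thesis by simp
next
  case False
  have "\<bar>y - max (- b) (min b y)\<bar> \<le> \<bar>y\<bar>" using assms by (auto simp: max_def min_def)
  then have "(y - max (- b) (min b y))\<^sup>2 \<le> y\<^sup>2" by (simp add: abs_le_square_iff)
  moreover have "y\<^sup>2 * b powr \<delta> \<le> y\<^sup>2 * \<bar>y\<bar> powr \<delta>"
    using False assms by (intro mult_left_mono powr_mono2) auto
  then have "y\<^sup>2 * b powr \<delta> \<le> \<bar>y\<bar> powr (2 + \<delta>)"
    using False assms by (simp add: powr_add)
  then have "y\<^sup>2 \<le> \<bar>y\<bar> powr (2 + \<delta>) / b powr \<delta>"
    using assms by (simp add: le_divide_eq)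
  ultimately show ?thesis by linarith
qed

lemma square_le_one_plus_powr:
  fixes y \<delta> :: real
  assumes "0 < \<delta>"
  shows "y\<^sup>2 \<le> 1 + \<bar>y\<bar> powr (2 + \<delta>)"
proof (cases "\<bar>y\<bar> \<le> 1")
  case True
  then have "y\<^sup>2 \<le> 1" by (simp add: abs_square_le_1)
  then show ?thesis by (simp add: add_increasing2)
next
  case False
  then have "\<bar>y\<bar> powr 2 \<le> \<bar>y\<bar> powr (2 + \<delta>)"
    using assms by (intro powr_mono) auto
  then show ?thesis using False by simp
qed

lemma borel_measurable_vec_component [measurable (raw)]:
  fixes f :: "'a \<Rightarrow> real^'n"
  assumes "f \<in> borel_measurable M"
  shows "(\<lambda>\<omega>. f \<omega> $ i) \<in> borel_measurable M"
  using borel_measurable_inner[OF assms borel_measurable_const[of "axis i 1"]] by (simp add: inner_axis)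

lemma nn_integral_norm_vec_square_le:
  fixes Y :: "'a \<Rightarrow> real^'n"
  assumes [measurable]: "Y \<in> borel_measurable M" and "0 \<le> \<kappa>"
    and le: "\<And>i. (\<integral>\<^sup>+\<omega>. ennreal ((Y \<omega> $ i)\<^sup>2) \<partial>M) \<le> ennreal \<kappa>"
  shows "(\<integral>\<^sup>+\<omega>. ennreal ((norm (Y \<omega>))\<^sup>2) \<partial>M) \<le> ennreal (real CARD('n) * \<kappa>)"
proof -
  have "(\<integral>\<^sup>+\<omega>. ennreal ((norm (Y \<omega>))\<^sup>2) \<partial>M) = (\<integral>\<^sup>+\<omega>. (\<Sum>i\<in>UNIV. ennreal ((Y \<omega> $ i)\<^sup>2)) \<partial>M)"
    by (simp add: power2_norm_vec)
  also have "\<dots> = (\<Sum>i\<in>UNIV. \<integral>\<^sup>+\<omega>. ennreal ((Y \<omega> $ i)\<^sup>2) \<partial>M)"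
    by (intro nn_integral_sum) measurable
  also have "\<dots> \<le> (\<Sum>i\<in>(UNIV::'n set). ennreal \<kappa>)"
    by (intro sum_mono le)
  also have "\<dots> = ennreal (real CARD('n) * \<kappa>)"
    using \<open>0 \<le> \<kappa>\<close> by (simp add: ennreal_mult ennreal_of_nat_eq_real_of_nat)
  finally show ?thesis .
qed

lemma matrix_vector_mult_measurable:
  assumes "Y \<in> borel_measurable N"
  shows "(\<lambda>\<omega>. (A :: real^'n^'k) *v Y \<omega>) \<in> borel_measurable N"
  using borel_measurable_continuous_onI[OF linear_continuous_on[OF matrix_vector_mul_bounded_linear[of A]]] assms
  by (rule measurable_compose[rotated])

text \<open>The model reduced to uniform constants. \<open>P\<close> bounds the loadings at the
  sampled sites and is at least 1 because the idiosyncratic noise enters with weight one and is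
  treated as the process with index 0. \<open>coeff\<close> uses \<open>Suc j\<close>, so that lag 0
  needs no separate case.\<close>

locale spatial_factor_errors = prob_space M
  for M :: "'a measure" +
  fixes L m :: nat and phi :: "'d::finite \<Rightarrow> nat \<Rightarrow> real" and dd :: "real^'q \<Rightarrow> real^'q \<Rightarrow> real"
    and r s :: "nat \<Rightarrow> real^'q" and Cm :: "nat \<Rightarrow> nat \<Rightarrow> real^'d^'d"
    and eps :: "nat \<Rightarrow> int \<Rightarrow> 'a \<Rightarrow> real^'d" and H :: "(nat \<Rightarrow> real^'d) \<Rightarrow> real^'d"
    and \<delta> \<mu> K LH P :: real
  assumes indep: "indep_vars (\<lambda>_. borel) (\<lambda>(l, t). eps l t) ({..L} \<times> UNIV)"
    and \<delta>_pos: "0 < \<delta>" and \<mu>_nonneg: "0 \<le> \<mu>"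
    and moment: "\<And>l t \<nu>. l \<le> L \<Longrightarrow> (\<integral>\<^sup>+\<omega>. ennreal (\<bar>eps l t \<omega> $ \<nu>\<bar> powr (2 + \<delta>)) \<partial>M) \<le> ennreal \<mu>"
    and coeff: "\<And>l j y. l \<le> L \<Longrightarrow> norm (Cm l j *v y) \<le> K * real (Suc j) powr (-3) * norm y"
    and weight: "\<And>\<nu> l t. l \<le> L \<Longrightarrow> \<bar>phi \<nu> l * dd (s t) (r l)\<bar> \<le> P" and P_ge_1: "1 \<le> P"
    and lipschitz: "\<And>\<nu> A B. \<bar>H A $ \<nu> - H B $ \<nu>\<bar> \<le> LH * sqrt (\<Sum>k\<le>m. (norm (A k - B k))\<^sup>2)"
    and K_nonneg: "0 \<le> K"
begin

definition G :: "int set \<Rightarrow> 'a measure"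
  where "G I = sigma (space M) (\<Union>(l, t)\<in>{..L} \<times> I. {eps l t -` A \<inter> space M |A. A \<in> sets borel})"

text \<open>The uncentred error with coefficients and innovations as parameters: truncation changes
  \<open>C\<close>, clipping changes \<open>e\<close>, and all approximants are instances of one
  function.\<close>

definition hproc :: "(nat \<Rightarrow> nat \<Rightarrow> real^'d^'d) \<Rightarrow> (nat \<Rightarrow> int \<Rightarrow> 'a \<Rightarrow> real^'d) \<Rightarrow> nat \<Rightarrow> 'd \<Rightarrow> 'a \<Rightarrow> real"
  where "hproc C e t \<nu> \<omega> = H (H_arg m (U_field L phi dd r C e) s t \<omega>) $ \<nu>"

definition trunc :: "nat \<Rightarrow> nat \<Rightarrow> nat \<Rightarrow> real^'d^'d"
  where "trunc k l j = (if j < k then Cm l j else 0)"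

definition clipped :: "real \<Rightarrow> nat \<Rightarrow> int \<Rightarrow> 'a \<Rightarrow> real^'d"
  where "clipped b l t \<omega> = clip_vec b (eps l t \<omega>)"

lemma eps_measurable: "l \<le> L \<Longrightarrow> eps l t \<in> borel_measurable M"
  using indep unfolding indep_vars_def by auto

lemma sets_G: "sets (G I) = sigma_sets (space M) (\<Union>(l, t)\<in>{..L} \<times> I. {eps l t -` A \<inter> space M |A. A \<in> sets borel})"
  unfolding G_def by (rule sets_measure_of) auto

lemma space_G: "space (G I) = space M"
  unfolding G_def by (rule space_measure_of) auto

lemma eps_measurable_G: "l \<le> L \<Longrightarrow> t \<in> I \<Longrightarrow> eps l t \<in> borel_measurable (G I)"
  by (rule measurableI) (auto simp: space_G sets_G intro!: sigma_sets.Basic)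

text \<open>Grouping of independent families: the preimage systems of single innovations are stable
  under intersection, and disjoint time sets give disjoint blocks of indices
  \<open>(l, t)\<close>.\<close>

lemma indep_time_algebras_G: "indep_time_algebras M G"
proof unfold_locales
  fix I J :: "int set"
  show "space (G I) = space M" by (rule space_G)
  show "sets (G I) \<subseteq> sets M"
    unfolding sets_G using eps_measurable
    by (intro sets.sigma_sets_subset) (auto intro: measurable_sets)
  show "I \<subseteq> J \<Longrightarrow> sets (G I) \<subseteq> sets (G J)"
    unfolding sets_G by (intro sigma_sets_mono') blast
  assume "I \<inter> J = {}"
  define E where "E = (\<lambda>(l, t). {eps l t -` A \<inter> space M |A. A \<in> sets borel})"
  define T where "T = case_bool ({..L} \<times> I) ({..L} \<times> J)"
  have G_eq: "sets (G I') = sigma_sets (space M) (\<Union>i\<in>{..L} \<times> I'. E i)" for I'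
    unfolding sets_G E_def by (rule arg_cong[where f = "sigma_sets (space M)"]) auto
  have "indep_sets E ({..L} \<times> UNIV)"
    using indep unfolding indep_vars_def2 E_def by (simp add: split_beta')
  then have "indep_sets E (\<Union>j\<in>UNIV. T j)"
    by (rule indep_sets_mono_index[rotated]) (auto simp: T_def UNIV_bool)
  then have "indep_sets (\<lambda>j. sigma_sets (space M) (\<Union>i\<in>T j. E i)) UNIV"
  proof (rule indep_sets_collect_sigma)
    fix i
    show "Int_stable (E i)"
    proof (rule Int_stableI)
      fix a b assume "a \<in> E i" "b \<in> E i"
      then obtain A B where "A \<in> sets borel" "B \<in> sets borel"
        "a = eps (fst i) (snd i) -` A \<inter> space M" "b = eps (fst i) (snd i) -` B \<inter> space M"
        by (auto simp: E_def split_beta')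
      then show "a \<inter> b \<in> E i"
        by (auto simp: E_def split_beta' intro!: exI[of _ "A \<inter> B"])
    qed
    show "disjoint_family_on T UNIV"
      using \<open>I \<inter> J = {}\<close> by (auto simp: T_def disjoint_family_on_def UNIV_bool)
  qed
  also have "(\<lambda>j. sigma_sets (space M) (\<Union>i\<in>T j. E i)) = case_bool (sets (G I)) (sets (G J))"
    by (rule ext) (simp add: T_def G_eq split: bool.split)
  finally show "indep_set (sets (G I)) (sets (G J))" unfolding indep_set_def .
qed

text \<open>The domain consists of all sequences with the product topology. The Lipschitz bound
  involves the coordinates up to \<open>m\<close> only, finitely many, so it gives continuity in
  that topology.\<close>

lemma H_measurable: "(\<lambda>A. H A $ \<nu>) \<in> borel_measurable borel"
proof (rule borel_measurable_continuous_onI)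
  show "continuous_on UNIV (\<lambda>A. H A $ \<nu>)"
    unfolding continuous_on_def
  proof
    fix B :: "nat \<Rightarrow> real^'d"
    have "continuous_on UNIV (\<lambda>A :: nat \<Rightarrow> real^'d. A k)" for k
      by (rule continuous_on_product_coordinates)
    then have cont: "((\<lambda>A. A k) \<longlongrightarrow> B k) (at B)" for k
      unfolding continuous_on_def by simp
    have "((\<lambda>A. LH * sqrt (\<Sum>k\<le>m. (norm (A k - B k))\<^sup>2)) \<longlongrightarrow> LH * sqrt (\<Sum>k\<le>m. (norm (B k - B k))\<^sup>2)) (at B)"
      by (rule tendsto_mult_left, rule tendsto_real_sqrt, rule tendsto_sum, rule tendsto_power, rule tendsto_norm,
          rule tendsto_diff, rule cont, rule tendsto_const)
    then have "((\<lambda>A. LH * sqrt (\<Sum>k\<le>m. (norm (A k - B k))\<^sup>2)) \<longlongrightarrow> 0) (at B)" by simp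
    then have "((\<lambda>A. H A $ \<nu> - H B $ \<nu>) \<longlongrightarrow> 0) (at B)"
      by (rule Lim_null_comparison[rotated]) (simp add: lipschitz)
    then show "((\<lambda>A. H A $ \<nu>) \<longlongrightarrow> H B $ \<nu>) (at B)"
      by (rule LIM_zero_cancel)
  qed
qed

text \<open>The hypothesis concerns the products of coefficient and innovation, so lags with zero
  coefficient impose nothing. Stated for any \<open>N\<close>, it covers the algebras
  \<open>G I\<close> of time windows.\<close>

lemma hproc_measurable:
  assumes "\<And>l k j. l \<le> L \<Longrightarrow> k \<le> m \<Longrightarrow> (\<lambda>\<omega>. C l j *v e l (int t - int k - int j) \<omega>) \<in> borel_measurable N"
  shows "hproc C e t \<nu> \<in> borel_measurable N"
proof -
  have lin: "lin_proc C e l (int t - int k) \<in> borel_measurable N" if "l \<le> L" "k \<le> m" for l k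
    unfolding lin_proc_def using assms[OF that] by (intro borel_measurable_suminf)
  have comp: "(\<lambda>\<omega>. lin_proc C e l (int t - int k) \<omega> $ i) \<in> borel_measurable N" if "l \<le> L" "k \<le> m" for l k i
    using lin[OF that] by (rule borel_measurable_vec_component)
  have "(\<lambda>\<omega>. U_field L phi dd r C e (int t - int k) (s t) \<omega>) \<in> borel_measurable N" if "k \<le> m" for k
    unfolding U_field_def
  proof (subst borel_measurable_euclidean_space, rule ballI)
    fix b :: "real^'d" assume "b \<in> Basis"
    then obtain i where b: "b = axis i 1" by (auto simp: Basis_vec_def)
    show "(\<lambda>\<omega>. (\<chi> \<nu>. (\<Sum>l=1..L. phi \<nu> l * dd (s t) (r l) * lin_proc C e l (int t - int k) \<omega> $ \<nu>)
        + lin_proc C e 0 (int t - int k) \<omega> $ \<nu>) \<bullet> b) \<in> borel_measurable N"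
      unfolding b inner_axis using that
      by (auto intro!: borel_measurable_add borel_measurable_sum borel_measurable_times borel_measurable_const comp)
  qed
  then have "(\<lambda>\<omega>. H_arg m (U_field L phi dd r C e) s t \<omega> k) \<in> borel_measurable N" for k
    by (cases "k \<le> m") (simp_all add: H_arg_def)
  then have "(\<lambda>\<omega>. H_arg m (U_field L phi dd r C e) s t \<omega>) \<in> borel_measurable N"
    by (rule measurable_coordinatewise_then_product)
  from measurable_compose[OF this H_measurable] show ?thesis
    unfolding hproc_def[abs_def] .
qed

text \<open>Pathwise, by the Lipschitz property and Cauchy-Schwarz for the \<open>Suc L\<close>
  component processes. It holds also where a defining series diverges, since only the values of
  \<open>lin_proc\<close> enter.\<close>

lemma hproc_diff_square_le:
  "(hproc C1 e1 t \<nu> \<omega> - hproc C2 e2 t \<nu> \<omega>)\<^sup>2 \<le> LH\<^sup>2 * (real CARD('d) * (real (Suc L) * P\<^sup>2)) *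
    (\<Sum>k\<le>m. \<Sum>l\<le>L. (norm (lin_proc C1 e1 l (int t - int k) \<omega> - lin_proc C2 e2 l (int t - int k) \<omega>))\<^sup>2)"
proof -
  let ?U1 = "U_field L phi dd r C1 e1" and ?U2 = "U_field L phi dd r C2 e2"
  define N where "N l k = norm (lin_proc C1 e1 l (int t - int k) \<omega> - lin_proc C2 e2 l (int t - int k) \<omega>)" for l k
  have U: "(norm (?U1 (int t - int k) (s t) \<omega> - ?U2 (int t - int k) (s t) \<omega>))\<^sup>2
      \<le> real CARD('d) * (real (Suc L) * P\<^sup>2) * (\<Sum>l\<le>L. (N l k)\<^sup>2)" for k
  proof -
    have comp: "((?U1 (int t - int k) (s t) \<omega> - ?U2 (int t - int k) (s t) \<omega>) $ i)\<^sup>2 \<le> real (Suc L) * P\<^sup>2 * (\<Sum>l\<le>L. (N l k)\<^sup>2)" for i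
    proof -
      \<comment> \<open>The idiosyncratic noise becomes the summand \<open>l = 0\<close> with weight
        1, replacing whatever value \<open>phi i 0\<close> has.\<close>
      define w where "w l = (if l = 0 then 1 else phi i l * dd (s t) (r l))" for l
      have w: "\<bar>w l\<bar> \<le> P" if "l \<le> L" for l using weight[OF that] P_ge_1 by (simp add: w_def)
      have split: "{..L} = insert 0 {1..L}" by auto
      have "(?U1 (int t - int k) (s t) \<omega> - ?U2 (int t - int k) (s t) \<omega>) $ i
        = (\<Sum>l\<le>L. w l * (lin_proc C1 e1 l (int t - int k) \<omega> - lin_proc C2 e2 l (int t - int k) \<omega>) $ i)"
        unfolding split by (simp add: U_field_def w_def right_diff_distrib sum_subtractf)
      then have "((?U1 (int t - int k) (s t) \<omega> - ?U2 (int t - int k) (s t) \<omega>) $ i)\<^sup>2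
        \<le> real (card {..L}) * (\<Sum>l\<le>L. (w l * (lin_proc C1 e1 l (int t - int k) \<omega> - lin_proc C2 e2 l (int t - int k) \<omega>) $ i)\<^sup>2)"
        by (simp only: power2_sum_le_card)
      also have "\<dots> \<le> real (card {..L}) * (\<Sum>l\<le>L. (P * N l k)\<^sup>2)"
      proof (intro mult_left_mono sum_mono)
        fix l assume "l \<in> {..L}"
        then have "\<bar>w l * (lin_proc C1 e1 l (int t - int k) \<omega> - lin_proc C2 e2 l (int t - int k) \<omega>) $ i\<bar> \<le> P * N l k"
          unfolding abs_mult N_def using w P_ge_1 by (intro mult_mono component_le_norm_cart) auto
        then show "(w l * (lin_proc C1 e1 l (int t - int k) \<omega> - lin_proc C2 e2 l (int t - int k) \<omega>) $ i)\<^sup>2 \<le> (P * N l k)\<^sup>2"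
          by (rule power2_le_iff_abs_le[THEN iffD2, rotated]) (use P_ge_1 in \<open>simp add: N_def\<close>)
      qed auto
      finally show ?thesis by (simp add: power_mult_distrib sum_distrib_left mult.assoc)
    qed
    have "(norm (?U1 (int t - int k) (s t) \<omega> - ?U2 (int t - int k) (s t) \<omega>))\<^sup>2
      \<le> (\<Sum>i\<in>(UNIV::'d set). real (Suc L) * P\<^sup>2 * (\<Sum>l\<le>L. (N l k)\<^sup>2))"
      unfolding power2_norm_vec by (intro sum_mono comp)
    then show ?thesis by (simp add: mult.assoc)
  qed
  define S where "S = (\<Sum>k\<le>m. (norm (H_arg m ?U1 s t \<omega> k - H_arg m ?U2 s t \<omega> k))\<^sup>2)"
  have "\<bar>hproc C1 e1 t \<nu> \<omega> - hproc C2 e2 t \<nu> \<omega>\<bar> \<le> LH * sqrt S"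
    unfolding hproc_def S_def by (rule lipschitz)
  then have "(hproc C1 e1 t \<nu> \<omega> - hproc C2 e2 t \<nu> \<omega>)\<^sup>2 \<le> (LH * sqrt S)\<^sup>2"
    using power_mono[of "\<bar>hproc C1 e1 t \<nu> \<omega> - hproc C2 e2 t \<nu> \<omega>\<bar>" "LH * sqrt S" 2] by simp
  also have "\<dots> = LH\<^sup>2 * S"
    by (simp add: power_mult_distrib S_def sum_nonneg)
  also have "\<dots> \<le> LH\<^sup>2 * (\<Sum>k\<le>m. real CARD('d) * (real (Suc L) * P\<^sup>2) * (\<Sum>l\<le>L. (N l k)\<^sup>2))"
    unfolding S_def using U by (intro mult_left_mono sum_mono) (simp_all add: H_arg_def)
  also have "\<dots> = LH\<^sup>2 * (real CARD('d) * (real (Suc L) * P\<^sup>2)) * (\<Sum>k\<le>m. \<Sum>l\<le>L. (N l k)\<^sup>2)"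
    by (simp only: sum_distrib_left[symmetric] mult.assoc)
  finally show ?thesis unfolding N_def .
qed

section \<open>Second moments of truncation and clipping errors\<close>

interpretation indep_time_algebras M G by (rule indep_time_algebras_G)

text \<open>Bounds the second moment of an innovation vector: each coordinate contributes at most
  \<open>1 + \<mu>\<close>, as a square is at most one plus the power
  \<open>2 + \<delta>\<close>.\<close>

definition v2 :: real where "v2 = real CARD('d) * (1 + \<mu>)"
text \<open>The constant of \<open>hproc_diff_square_le\<close> times the number of pairs of a lag
  \<open>k \<le> m\<close> and a process \<open>l \<le> L\<close>.\<close>

definition \<Lambda> :: real where "\<Lambda> = LH\<^sup>2 * (real CARD('d) * (real (Suc L) * P\<^sup>2)) * (real (Suc m) * real (Suc L))"

lemma v2_nonneg: "0 \<le> v2" using \<mu>_nonneg by (simp add: v2_def)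
lemma \<Lambda>_nonneg: "0 \<le> \<Lambda>" by (simp add: \<Lambda>_def)

lemma eps_second_moment:
  assumes "l \<le> L"
  shows "(\<integral>\<^sup>+\<omega>. ennreal ((norm (eps l t \<omega>))\<^sup>2) \<partial>M) \<le> ennreal v2"
  unfolding v2_def
proof (rule nn_integral_norm_vec_square_le)
  show [measurable]: "eps l t \<in> borel_measurable M" using assms by (rule eps_measurable)
  fix i
  have "(\<integral>\<^sup>+\<omega>. ennreal ((eps l t \<omega> $ i)\<^sup>2) \<partial>M) \<le> (\<integral>\<^sup>+\<omega>. 1 + ennreal (\<bar>eps l t \<omega> $ i\<bar> powr (2 + \<delta>)) \<partial>M)"
    using square_le_one_plus_powr[OF \<delta>_pos]
    by (intro nn_integral_mono) (simp add: ennreal_leI flip: ennreal_1 ennreal_plus)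
  also have "\<dots> = 1 + (\<integral>\<^sup>+\<omega>. ennreal (\<bar>eps l t \<omega> $ i\<bar> powr (2 + \<delta>)) \<partial>M)"
    by (subst nn_integral_add) (auto simp: emeasure_space_1)
  also have "\<dots> \<le> 1 + ennreal \<mu>"
    by (intro add_left_mono moment assms)
  also have "\<dots> = ennreal (1 + \<mu>)"
    using \<mu>_nonneg by (simp add: ennreal_plus)
  finally show "(\<integral>\<^sup>+\<omega>. ennreal ((eps l t \<omega> $ i)\<^sup>2) \<partial>M) \<le> ennreal (1 + \<mu>)" .
qed (use \<mu>_nonneg in simp)

lemma clip_second_moment:
  assumes "l \<le> L" "0 < b"
  shows "(\<integral>\<^sup>+\<omega>. ennreal ((norm (eps l t \<omega> - clipped b l t \<omega>))\<^sup>2) \<partial>M) \<le> ennreal (real CARD('d) * (\<mu> / b powr \<delta>))"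
proof (rule nn_integral_norm_vec_square_le)
  have [measurable]: "eps l t \<in> borel_measurable M" using assms(1) by (rule eps_measurable)
  show "(\<lambda>\<omega>. eps l t \<omega> - clipped b l t \<omega>) \<in> borel_measurable M" unfolding clipped_def by measurable
  fix i
  have "(\<integral>\<^sup>+\<omega>. ennreal (((eps l t \<omega> - clipped b l t \<omega>) $ i)\<^sup>2) \<partial>M)
      \<le> (\<integral>\<^sup>+\<omega>. ennreal (1 / b powr \<delta>) * ennreal (\<bar>eps l t \<omega> $ i\<bar> powr (2 + \<delta>)) \<partial>M)"
    using clip_error_square_le[OF assms(2) \<delta>_pos]
    by (intro nn_integral_mono) (simp add: clipped_def clip_vec_def ennreal_leI flip: ennreal_mult)
  also have "\<dots> = ennreal (1 / b powr \<delta>) * (\<integral>\<^sup>+\<omega>. ennreal (\<bar>eps l t \<omega> $ i\<bar> powr (2 + \<delta>)) \<partial>M)"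
    by (rule nn_integral_cmult) measurable
  also have "\<dots> \<le> ennreal (1 / b powr \<delta>) * ennreal \<mu>"
    by (intro mult_left_mono moment assms) auto
  also have "\<dots> = ennreal (\<mu> / b powr \<delta>)"
    using \<mu>_nonneg by (simp flip: ennreal_mult)
  finally show "(\<integral>\<^sup>+\<omega>. ennreal (((eps l t \<omega> - clipped b l t \<omega>) $ i)\<^sup>2) \<partial>M) \<le> ennreal (\<mu> / b powr \<delta>)" .
qed (use \<mu>_nonneg in simp)

lemma hproc_diff_moment:
  assumes "0 \<le> \<kappa>"
    and m1: "\<And>l t. l \<le> L \<Longrightarrow> e1 l t \<in> borel_measurable M" and m2: "\<And>l t. l \<le> L \<Longrightarrow> e2 l t \<in> borel_measurable M"
    and le: "\<And>l t. l \<le> L \<Longrightarrow> (\<integral>\<^sup>+\<omega>. ennreal ((norm (lin_proc C1 e1 l t \<omega> - lin_proc C2 e2 l t \<omega>))\<^sup>2) \<partial>M) \<le> ennreal \<kappa>"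
  shows "(\<integral>\<^sup>+\<omega>. ennreal ((hproc C1 e1 t \<nu> \<omega> - hproc C2 e2 t \<nu> \<omega>)\<^sup>2) \<partial>M) \<le> ennreal (\<Lambda> * \<kappa>)"
proof -
  define c where "c = LH\<^sup>2 * (real CARD('d) * (real (Suc L) * P\<^sup>2))"
  define N where "N l k \<omega> = (norm (lin_proc C1 e1 l (int t - int k) \<omega> - lin_proc C2 e2 l (int t - int k) \<omega>))\<^sup>2" for l k \<omega>
  have lin: "lin_proc C e l t \<in> borel_measurable M" if "\<And>l t. l \<le> L \<Longrightarrow> e l t \<in> borel_measurable M" "l \<le> L" for C e l t
    unfolding lin_proc_def using that by (intro borel_measurable_suminf matrix_vector_mult_measurable) auto
  have N[measurable]: "N l k \<in> borel_measurable M" if "l \<le> L" for l k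
    unfolding N_def using lin[OF m1 that] lin[OF m2 that] by measurable
  have "0 \<le> c" by (simp add: c_def)
  have "(\<integral>\<^sup>+\<omega>. ennreal ((hproc C1 e1 t \<nu> \<omega> - hproc C2 e2 t \<nu> \<omega>)\<^sup>2) \<partial>M)
      \<le> (\<integral>\<^sup>+\<omega>. ennreal c * (\<Sum>k\<le>m. \<Sum>l\<le>L. ennreal (N l k \<omega>)) \<partial>M)"
  proof (rule nn_integral_mono)
    fix \<omega>
    have "ennreal ((hproc C1 e1 t \<nu> \<omega> - hproc C2 e2 t \<nu> \<omega>)\<^sup>2) \<le> ennreal (c * (\<Sum>k\<le>m. \<Sum>l\<le>L. N l k \<omega>))"
      unfolding c_def N_def by (intro ennreal_leI hproc_diff_square_le)
    also have "\<dots> = ennreal c * ennreal (\<Sum>k\<le>m. \<Sum>l\<le>L. N l k \<omega>)"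
      using \<open>0 \<le> c\<close> by (intro ennreal_mult) (auto simp: N_def intro!: sum_nonneg)
    also have "ennreal (\<Sum>k\<le>m. \<Sum>l\<le>L. N l k \<omega>) = (\<Sum>k\<le>m. \<Sum>l\<le>L. ennreal (N l k \<omega>))"
      by (simp add: N_def sum_nonneg)
    finally show "ennreal ((hproc C1 e1 t \<nu> \<omega> - hproc C2 e2 t \<nu> \<omega>)\<^sup>2) \<le> ennreal c * (\<Sum>k\<le>m. \<Sum>l\<le>L. ennreal (N l k \<omega>))" .
  qed
  also have "\<dots> = ennreal c * (\<Sum>k\<le>m. \<Sum>l\<le>L. \<integral>\<^sup>+\<omega>. ennreal (N l k \<omega>) \<partial>M)"
  proof -
    have "(\<integral>\<^sup>+\<omega>. (\<Sum>l\<le>L. ennreal (N l k \<omega>)) \<partial>M) = (\<Sum>l\<le>L. \<integral>\<^sup>+\<omega>. ennreal (N l k \<omega>) \<partial>M)" for k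
      by (rule nn_integral_sum) simp
    then show ?thesis
      by (subst nn_integral_cmult) (auto simp: nn_integral_sum)
  qed
  also have "\<dots> \<le> ennreal c * (\<Sum>k\<le>m. \<Sum>l\<le>L. ennreal \<kappa>)"
    unfolding N_def by (intro mult_left_mono sum_mono le) auto
  also have "\<dots> = ennreal c * ennreal (real (Suc m) * real (Suc L) * \<kappa>)"
  proof -
    have "(\<Sum>k\<le>m. \<Sum>l\<le>L. ennreal \<kappa>) = ennreal (\<Sum>k\<le>m. \<Sum>l\<le>L. \<kappa>)"
      using \<open>0 \<le> \<kappa>\<close> by (simp add: sum_ennreal sum_nonneg del: sum_constant)
    then show ?thesis by (simp add: mult.assoc)
  qed
  also have "\<dots> = ennreal (\<Lambda> * \<kappa>)"
    using \<open>0 \<le> c\<close> \<open>0 \<le> \<kappa>\<close> by (simp add: \<Lambda>_def c_def mult.assoc flip: ennreal_mult)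
  finally show ?thesis .
qed

text \<open>Covers the full coefficients, their truncations and zero; together with
  \<open>sub_noise\<close> it lets one estimate serve every combination.\<close>

definition sub_coeff :: "(nat \<Rightarrow> nat \<Rightarrow> real^'d^'d) \<Rightarrow> bool"
  where "sub_coeff C \<longleftrightarrow> (\<forall>l j. C l j = Cm l j \<or> C l j = 0)"

text \<open>Adapted to \<open>G\<close> and dominated by the original innovations; domination
  carries their second moment bound over to the clipped ones.\<close>

definition sub_noise :: "(nat \<Rightarrow> int \<Rightarrow> 'a \<Rightarrow> real^'d) \<Rightarrow> bool"
  where "sub_noise e \<longleftrightarrow> (\<forall>l t I. l \<le> L \<longrightarrow> t \<in> I \<longrightarrow> e l t \<in> borel_measurable (G I)) \<and>
    (\<forall>l t \<omega>. norm (e l t \<omega>) \<le> norm (eps l t \<omega>))"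

lemma sub_coeff_Cm: "sub_coeff Cm" and sub_coeff_trunc: "sub_coeff (trunc k)"
  and sub_coeff_0: "sub_coeff (\<lambda>_ _. 0)"
  by (auto simp: sub_coeff_def trunc_def)

lemma sub_noise_eps: "sub_noise eps"
  by (auto simp: sub_noise_def eps_measurable_G)

lemma sub_noise_clipped: "0 \<le> b \<Longrightarrow> sub_noise (clipped b)"
  unfolding sub_noise_def clipped_def
  by (auto intro!: norm_clip_vec_le measurable_compose[OF eps_measurable_G clip_vec_measurable])

lemma sub_noise_measurable: "sub_noise e \<Longrightarrow> l \<le> L \<Longrightarrow> e l t \<in> borel_measurable M"
  using measurable_G[of "e l t" UNIV] by (auto simp: sub_noise_def)

lemma sub_coeff_term_le:
  assumes "sub_coeff C" "sub_noise e" "l \<le> L"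
  shows "norm (C l j *v e l t \<omega>) \<le> K * real (Suc j) powr (-3) * \<bar>norm (eps l t \<omega>)\<bar>"
proof -
  have "norm (C l j *v e l t \<omega>) \<le> norm (Cm l j *v e l t \<omega>)"
    using assms(1) unfolding sub_coeff_def by (metis matrix_vector_mult_0 norm_ge_zero norm_zero order_refl)
  also have "\<dots> \<le> K * real (Suc j) powr (-3) * norm (e l t \<omega>)" by (rule coeff[OF assms(3)])
  also have "\<dots> \<le> K * real (Suc j) powr (-3) * \<bar>norm (eps l t \<omega>)\<bar>"
    using assms(2) K_nonneg by (intro mult_left_mono) (auto simp: sub_noise_def)
  finally show ?thesis .
qed

lemma summable_weight: "summable (\<lambda>j. K * (if n \<le> j then real (Suc j) powr (-3) else 0))"
  "(\<Sum>j. K * (if n \<le> j then real (Suc j) powr (-3) else 0)) = K * cubic_tail n"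
  using summable_cubic[of n] by (auto intro: summable_mult simp: suminf_mult cubic_tail_def)

text \<open>Families that agree below lag \<open>n\<close> differ by series terms from
  \<open>n\<close> on, whose total weight is \<open>K * cubic_tail n\<close>. The case
  \<open>n = 0\<close> with zero coefficients bounds the process itself.\<close>

lemma hproc_trunc_moment:
  assumes C: "sub_coeff C1" "sub_coeff C2" and e: "sub_noise e" and eq: "\<And>l j. j < n \<Longrightarrow> C1 l j = C2 l j"
  shows "(\<integral>\<^sup>+\<omega>. ennreal ((hproc C1 e t \<nu> \<omega> - hproc C2 e t \<nu> \<omega>)\<^sup>2) \<partial>M) \<le> ennreal (\<Lambda> * ((K * cubic_tail n)\<^sup>2 * v2))"
proof (rule hproc_diff_moment)
  fix l t assume l: "l \<le> L"
  show "(\<integral>\<^sup>+\<omega>. ennreal ((norm (lin_proc C1 e l t \<omega> - lin_proc C2 e l t \<omega>))\<^sup>2) \<partial>M) \<le> ennreal ((K * cubic_tail n)\<^sup>2 * v2)"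
    unfolding lin_proc_def summable_weight(2)[symmetric]
  proof (rule series_diff_second_moment[where c = "\<lambda>j. K * (if 0 \<le> j then real (Suc j) powr (-3) else 0)"
        and Y = "\<lambda>j \<omega>. norm (eps l (t - int j) \<omega>)" and \<kappa> = v2 and Z = "\<lambda>j \<omega>. norm (eps l (t - int j) \<omega>)"])
    show "norm (C1 l j *v e l (t - int j) \<omega>) \<le> K * (if 0 \<le> j then real (Suc j) powr (-3) else 0) * \<bar>norm (eps l (t - int j) \<omega>)\<bar>" for j \<omega>
      using sub_coeff_term_le[OF C(1) e l] by simp
    show "norm (C2 l j *v e l (t - int j) \<omega>) \<le> K * (if 0 \<le> j then real (Suc j) powr (-3) else 0) * \<bar>norm (eps l (t - int j) \<omega>)\<bar>" for j \<omega>
      using sub_coeff_term_le[OF C(2) e l] by simp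
    show "norm (C1 l j *v e l (t - int j) \<omega> - C2 l j *v e l (t - int j) \<omega>)
        \<le> K * (if n \<le> j then real (Suc j) powr (-3) else 0) * \<bar>norm (eps l (t - int j) \<omega>)\<bar>" for j \<omega>
    proof -
      \<comment> \<open>Two choices between \<open>Cm l j\<close> and zero that differ have one
        member zero, so the difference costs no factor 2.\<close>
      have "C1 l j = C2 l j \<or> C1 l j = 0 \<or> C2 l j = 0"
        using C unfolding sub_coeff_def by metis
      then show ?thesis
        using sub_coeff_term_le[OF C(1) e l, of j "t - int j" \<omega>] sub_coeff_term_le[OF C(2) e l, of j "t - int j" \<omega>] eq[of j l] K_nonneg
        by (cases "n \<le> j") auto
    qed
  qed (use l K_nonneg v2_nonneg eps_second_moment eps_measurable summable_weight(1)[of 0] summable_weight(1)[of n] in auto)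
qed (use v2_nonneg e sub_noise_measurable in auto)

text \<open>The clipping error passes through the linear filter with the full weight
  \<open>K * cubic_tail 0\<close>; it is the factor \<open>b powr \<delta>\<close> in the
  denominator that makes it small.\<close>

lemma hproc_clip_moment:
  assumes C: "sub_coeff C" and b: "0 < b"
  shows "(\<integral>\<^sup>+\<omega>. ennreal ((hproc C eps t \<nu> \<omega> - hproc C (clipped b) t \<nu> \<omega>)\<^sup>2) \<partial>M)
    \<le> ennreal (\<Lambda> * ((K * cubic_tail 0)\<^sup>2 * (real CARD('d) * (\<mu> / b powr \<delta>))))"
proof (rule hproc_diff_moment)
  have e: "sub_noise (clipped b)" using b by (intro sub_noise_clipped) simp
  show "\<And>l t. l \<le> L \<Longrightarrow> clipped b l t \<in> borel_measurable M" by (rule sub_noise_measurable[OF e])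
  fix l t assume l: "l \<le> L"
  have [measurable]: "clipped b l t \<in> borel_measurable M" "eps l t \<in> borel_measurable M" for t
    using sub_noise_measurable[OF e l] eps_measurable[OF l] by auto
  show "(\<integral>\<^sup>+\<omega>. ennreal ((norm (lin_proc C eps l t \<omega> - lin_proc C (clipped b) l t \<omega>))\<^sup>2) \<partial>M)
      \<le> ennreal ((K * cubic_tail 0)\<^sup>2 * (real CARD('d) * (\<mu> / b powr \<delta>)))"
    unfolding lin_proc_def summable_weight(2)[symmetric]
  proof (rule series_diff_second_moment[where c = "\<lambda>j. K * (if 0 \<le> j then real (Suc j) powr (-3) else 0)"
        and Y = "\<lambda>j \<omega>. norm (eps l (t - int j) \<omega>)" and \<kappa> = v2
        and Z = "\<lambda>j \<omega>. norm (eps l (t - int j) \<omega> - clipped b l (t - int j) \<omega>)"])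
    show "norm (C l j *v eps l (t - int j) \<omega>) \<le> K * (if 0 \<le> j then real (Suc j) powr (-3) else 0) * \<bar>norm (eps l (t - int j) \<omega>)\<bar>" for j \<omega>
      using sub_coeff_term_le[OF C sub_noise_eps l] by simp
    show "norm (C l j *v clipped b l (t - int j) \<omega>) \<le> K * (if 0 \<le> j then real (Suc j) powr (-3) else 0) * \<bar>norm (eps l (t - int j) \<omega>)\<bar>" for j \<omega>
      using sub_coeff_term_le[OF C e l] by simp
    show "norm (C l j *v eps l (t - int j) \<omega> - C l j *v clipped b l (t - int j) \<omega>)
        \<le> K * (if 0 \<le> j then real (Suc j) powr (-3) else 0) * \<bar>norm (eps l (t - int j) \<omega> - clipped b l (t - int j) \<omega>)\<bar>" for j \<omega>
    proof (cases "C l j = 0")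
      case False
      then have "C l j = Cm l j" using C unfolding sub_coeff_def by metis
      then show ?thesis
        using coeff[OF l, of j "eps l (t - int j) \<omega> - clipped b l (t - int j) \<omega>"]
        by (simp add: matrix_vector_mult_diff_distrib)
    qed (use K_nonneg in simp)
  qed (use l K_nonneg v2_nonneg \<mu>_nonneg b eps_second_moment clip_second_moment summable_weight(1)[of 0] in auto)
qed (use \<mu>_nonneg eps_measurable in auto)

text \<open>A constant reference point: comparison with it yields square integrability and
  boundedness of other versions.\<close>

lemma hproc_zero: "hproc (\<lambda>_ _. 0) e t \<nu> \<omega> = H (\<lambda>_. 0) $ \<nu>"
proof -
  have "H_arg m (U_field L phi dd r (\<lambda>_ _. 0) e) s t \<omega> = (\<lambda>_. 0)"
    by (auto simp: fun_eq_iff H_arg_def U_field_def lin_proc_def vec_eq_iff)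
  then show ?thesis by (simp add: hproc_def)
qed

lemma hproc_measurable_past:
  assumes "sub_noise e"
  shows "hproc C e t \<nu> \<in> borel_measurable (G {..int t})"
  using assms by (intro hproc_measurable matrix_vector_mult_measurable) (auto simp: sub_noise_def)

text \<open>The oldest innovation involved has time \<open>t - m - (n - 1)\<close>, which lies after
  \<open>t - h\<close> since \<open>n \<le> h - m\<close>. If \<open>h \<le> m\<close>, truncated
  subtraction forces \<open>n = 0\<close> and no innovation is left.\<close>

lemma hproc_trunc_measurable:
  assumes e: "sub_noise e" and n: "n \<le> h - m"
  shows "hproc (trunc n) e t \<nu> \<in> borel_measurable (G {int t - int h<..int t})"
proof (rule hproc_measurable)
  fix l k j assume "l \<le> L" "k \<le> m"
  show "(\<lambda>\<omega>. trunc n l j *v e l (int t - int k - int j) \<omega>) \<in> borel_measurable (G {int t - int h<..int t})"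
  proof (cases "j < n")
    case True
    then have "int t - int k - int j \<in> {int t - int h<..int t}" using n \<open>k \<le> m\<close> by auto
    then show ?thesis
      using e \<open>l \<le> L\<close> by (intro matrix_vector_mult_measurable) (simp add: sub_noise_def)
  qed (simp add: trunc_def)
qed

lemma hproc_measurable_M: "sub_noise e \<Longrightarrow> hproc C e t \<nu> \<in> borel_measurable M"
  using hproc_measurable_past by (rule measurable_G)

lemma hproc_trunc_error:
  assumes C: "sub_coeff C1" "sub_coeff C2" and e: "sub_noise e" and eq: "\<And>l j. j < n \<Longrightarrow> C1 l j = C2 l j"
  shows "square_integrable M (\<lambda>\<omega>. hproc C1 e t \<nu> \<omega> - hproc C2 e t \<nu> \<omega>)"
    and "expectation (\<lambda>\<omega>. (hproc C1 e t \<nu> \<omega> - hproc C2 e t \<nu> \<omega>)\<^sup>2) \<le> \<Lambda> * ((K * cubic_tail n)\<^sup>2 * v2)"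
proof -
  have m: "(\<lambda>\<omega>. hproc C1 e t \<nu> \<omega> - hproc C2 e t \<nu> \<omega>) \<in> borel_measurable M"
    using hproc_measurable_M[OF e] by (intro borel_measurable_diff)
  have nn: "0 \<le> \<Lambda> * ((K * cubic_tail n)\<^sup>2 * v2)" using \<Lambda>_nonneg v2_nonneg by simp
  note * = square_integrable_nn_integral[OF m nn hproc_trunc_moment[OF C e eq]]
  from * show "square_integrable M (\<lambda>\<omega>. hproc C1 e t \<nu> \<omega> - hproc C2 e t \<nu> \<omega>)"
    "expectation (\<lambda>\<omega>. (hproc C1 e t \<nu> \<omega> - hproc C2 e t \<nu> \<omega>)\<^sup>2) \<le> \<Lambda> * ((K * cubic_tail n)\<^sup>2 * v2)"
    by auto
qed

lemma hproc_clip_error: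
  assumes C: "sub_coeff C" and b: "0 < b"
  shows "square_integrable M (\<lambda>\<omega>. hproc C eps t \<nu> \<omega> - hproc C (clipped b) t \<nu> \<omega>)"
    and "expectation (\<lambda>\<omega>. (hproc C eps t \<nu> \<omega> - hproc C (clipped b) t \<nu> \<omega>)\<^sup>2)
      \<le> \<Lambda> * ((K * cubic_tail 0)\<^sup>2 * (real CARD('d) * (\<mu> / b powr \<delta>)))"
proof -
  have m: "(\<lambda>\<omega>. hproc C eps t \<nu> \<omega> - hproc C (clipped b) t \<nu> \<omega>) \<in> borel_measurable M"
    using hproc_measurable_M sub_noise_eps sub_noise_clipped b by (intro borel_measurable_diff) auto
  have nn: "0 \<le> \<Lambda> * ((K * cubic_tail 0)\<^sup>2 * (real CARD('d) * (\<mu> / b powr \<delta>)))" using \<Lambda>_nonneg \<mu>_nonneg by simp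
  note * = square_integrable_nn_integral[OF m nn hproc_clip_moment[OF C b]]
  from * show "square_integrable M (\<lambda>\<omega>. hproc C eps t \<nu> \<omega> - hproc C (clipped b) t \<nu> \<omega>)"
    "expectation (\<lambda>\<omega>. (hproc C eps t \<nu> \<omega> - hproc C (clipped b) t \<nu> \<omega>)\<^sup>2)
      \<le> \<Lambda> * ((K * cubic_tail 0)\<^sup>2 * (real CARD('d) * (\<mu> / b powr \<delta>)))" by auto
qed

lemma hproc_square_integrable:
  assumes "sub_coeff C" "sub_noise e"
  shows "square_integrable M (hproc C e t \<nu>)"
  using square_integrable_add[OF hproc_trunc_error(1)[OF assms(1) sub_coeff_0 assms(2), of 0 t \<nu>] square_integrable_const[of "H (\<lambda>_. 0) $ \<nu>"]]
  by (simp add: hproc_zero)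

text \<open>After truncation each process is a sum of \<open>k\<close> bounded vectors, and the
  Lipschitz property bounds the distance from the value of \<open>H\<close> at zero. The bound
  depends on \<open>k\<close> and \<open>b\<close> but not on \<open>t\<close>.\<close>

lemma hproc_bounded:
  assumes "0 \<le> b"
  shows "\<exists>B. \<forall>t \<omega>. \<bar>hproc (trunc k) (clipped b) t \<nu> \<omega>\<bar> \<le> B"
proof -
  define R where "R = real k * (K * (real CARD('d) * b))"
  define c where "c = LH\<^sup>2 * (real CARD('d) * (real (Suc L) * P\<^sup>2)) * (\<Sum>j\<le>m. \<Sum>l\<le>L. R\<^sup>2)"
  have lin: "norm (lin_proc (trunc k) (clipped b) l t \<omega>) \<le> R" if "l \<le> L" for l t \<omega>
  proof -
    have "lin_proc (trunc k) (clipped b) l t \<omega> = (\<Sum>j<k. trunc k l j *v clipped b l (t - int j) \<omega>)"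
      unfolding lin_proc_def by (intro suminf_finite) (auto simp: trunc_def)
    also have "norm \<dots> \<le> (\<Sum>j<k. norm (trunc k l j *v clipped b l (t - int j) \<omega>))" by (rule norm_sum)
    also have "\<dots> \<le> of_nat (card {..<k}) * (K * (real CARD('d) * b))"
    proof (rule sum_bounded_above)
      fix j assume "j \<in> {..<k}"
      then have "norm (trunc k l j *v clipped b l (t - int j) \<omega>) \<le> K * real (Suc j) powr (-3) * norm (clipped b l (t - int j) \<omega>)"
        using coeff[OF that] by (simp add: trunc_def)
      also have "\<dots> \<le> K * 1 * (real CARD('d) * b)"
      proof (intro mult_mono mult_left_mono K_nonneg)
        show "real (Suc j) powr (-3) \<le> 1" using powr_mono[of "-3" 0 "real (Suc j)"] by simp
        show "norm (clipped b l (t - int j) \<omega>) \<le> real CARD('d) * b"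
          unfolding clipped_def by (rule norm_clip_vec_le_bound[OF assms])
      qed (use K_nonneg assms in auto)
      finally show "norm (trunc k l j *v clipped b l (t - int j) \<omega>) \<le> K * (real CARD('d) * b)" by simp
    qed
    finally show ?thesis by (simp add: R_def)
  qed
  have "\<bar>hproc (trunc k) (clipped b) t \<nu> \<omega>\<bar> \<le> sqrt c + \<bar>H (\<lambda>_. 0) $ \<nu>\<bar>" for t \<omega>
  proof -
    have "(hproc (trunc k) (clipped b) t \<nu> \<omega> - hproc (\<lambda>_ _. 0) eps t \<nu> \<omega>)\<^sup>2 \<le> c"
    proof (rule order_trans[OF hproc_diff_square_le], unfold c_def, intro mult_left_mono sum_mono power_mono)
      fix j l assume "l \<in> {..L}"
      then show "norm (lin_proc (trunc k) (clipped b) l (int t - int j) \<omega> - lin_proc (\<lambda>_ _. 0) eps l (int t - int j) \<omega>) \<le> R"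
        using lin[of l] by (simp add: lin_proc_def[of "\<lambda>_ _. 0"])
    qed auto
    then have "\<bar>hproc (trunc k) (clipped b) t \<nu> \<omega> - H (\<lambda>_. 0) $ \<nu>\<bar> \<le> sqrt c"
      unfolding hproc_zero by (metis real_sqrt_abs real_sqrt_le_mono)
    then show ?thesis by linarith
  qed
  then show ?thesis by blast
qed

text \<open>Rate at which the lag versions converge in L2. The argument is \<open>h - m\<close>
  because \<open>H\<close> itself looks back \<open>m\<close> steps; the factor 2 leaves room for a
  difference of two processes, each with its own tail, combined by
  \<open>square_mean_diff_le\<close>.\<close>

definition \<rho> :: "nat \<Rightarrow> real"
  where "\<rho> h = 2 * (sqrt (\<Lambda> * v2) * (K * cubic_tail (h - m)))"

lemma \<rho>_nonneg: "0 \<le> \<rho> h"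
  using \<Lambda>_nonneg v2_nonneg K_nonneg cubic_tail_nonneg by (simp add: \<rho>_def)

lemma summable_\<rho>: "summable \<rho>"
proof -
  have "summable (\<lambda>h. cubic_tail (h - m))"
    using summable_cubic_tail by (subst summable_iff_shift[symmetric, of _ m]) simp
  then show ?thesis unfolding \<rho>_def[abs_def] by (intro summable_mult)
qed

lemma \<rho>_square: "(\<rho> h)\<^sup>2 = 4 * (\<Lambda> * ((K * cubic_tail (h - m))\<^sup>2 * v2))"
  using \<Lambda>_nonneg v2_nonneg by (simp add: \<rho>_def power_mult_distrib)

text \<open>\<open>weighted_sum_variance_le\<close> applied to the errors themselves in place of
  differences; it later bounds \<open>g\<close>, the normalised sum of
  \<open>e t *\<^sub>R x t\<close>.\<close>

lemma hproc_sum_variance_bound: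
  "\<exists>B\<ge>0. \<forall>T a A. (\<forall>t. \<bar>a t\<bar> \<le> A) \<longrightarrow>
    expectation (\<lambda>\<omega>. (\<Sum>t=1..T. a t * (hproc Cm eps t \<nu> \<omega> - expectation (hproc Cm eps t \<nu>)))\<^sup>2) \<le> A\<^sup>2 * B * real T"
proof -
  \<comment> \<open>Second moment of the distance from the constant value at zero, plus the square
    of this constant, each doubled by \<open>square_mean_add_le\<close>.\<close>
  define \<epsilon>2 where "\<epsilon>2 = 2 * (\<Lambda> * ((K * cubic_tail 0)\<^sup>2 * v2)) + 2 * (H (\<lambda>_. 0) $ \<nu>)\<^sup>2"
  have \<epsilon>2: "0 \<le> \<epsilon>2" using \<Lambda>_nonneg v2_nonneg by (simp add: \<epsilon>2_def)
  have "expectation (\<lambda>\<omega>. (\<Sum>t=1..T. a t * (hproc Cm eps t \<nu> \<omega> - expectation (hproc Cm eps t \<nu>)))\<^sup>2)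
      \<le> 2 * A\<^sup>2 * sqrt \<epsilon>2 * suminf \<rho> * real T" if a: "\<And>t. \<bar>a t\<bar> \<le> A" for T a A
  proof (rule weighted_sum_variance_le[where D' = "\<lambda>h t. hproc (trunc (h - m)) eps t \<nu>"])
    fix h t
    show "hproc Cm eps t \<nu> \<in> borel_measurable (G {..int t})"
      by (rule hproc_measurable_past[OF sub_noise_eps])
    show "square_integrable M (hproc Cm eps t \<nu>)"
      by (rule hproc_square_integrable[OF sub_coeff_Cm sub_noise_eps])
    show "hproc (trunc (h - m)) eps t \<nu> \<in> borel_measurable (G {int t - int h<..int t})"
      by (rule hproc_trunc_measurable[OF sub_noise_eps]) simp
    show "square_integrable M (hproc (trunc (h - m)) eps t \<nu>)"
      by (rule hproc_square_integrable[OF sub_coeff_trunc sub_noise_eps])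
    have "expectation (\<lambda>\<omega>. (hproc Cm eps t \<nu> \<omega> - hproc (trunc (h - m)) eps t \<nu> \<omega>)\<^sup>2) \<le> \<Lambda> * ((K * cubic_tail (h - m))\<^sup>2 * v2)"
      by (rule hproc_trunc_error[OF sub_coeff_Cm sub_coeff_trunc sub_noise_eps]) (simp add: trunc_def)
    also have "\<dots> \<le> (\<rho> h)\<^sup>2"
      using \<Lambda>_nonneg v2_nonneg by (simp add: \<rho>_square)
    finally show "expectation (\<lambda>\<omega>. (hproc Cm eps t \<nu> \<omega> - hproc (trunc (h - m)) eps t \<nu> \<omega>)\<^sup>2) \<le> (\<rho> h)\<^sup>2" .
    have "expectation (\<lambda>\<omega>. (hproc Cm eps t \<nu> \<omega>)\<^sup>2)
        = expectation (\<lambda>\<omega>. ((hproc Cm eps t \<nu> \<omega> - hproc (\<lambda>_ _. 0) eps t \<nu> \<omega>) + H (\<lambda>_. 0) $ \<nu>)\<^sup>2)"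
      by (simp add: hproc_zero)
    also have "\<dots> \<le> 2 * expectation (\<lambda>\<omega>. (hproc Cm eps t \<nu> \<omega> - hproc (\<lambda>_ _. 0) eps t \<nu> \<omega>)\<^sup>2) + 2 * expectation (\<lambda>\<omega>. (H (\<lambda>_. 0) $ \<nu>)\<^sup>2)"
      by (intro square_mean_add_le square_integrable_const hproc_trunc_error(1)[OF sub_coeff_Cm sub_coeff_0 sub_noise_eps, of 0]) simp
    also have "\<dots> \<le> \<epsilon>2"
      using hproc_trunc_error(2)[OF sub_coeff_Cm sub_coeff_0 sub_noise_eps, of 0 t \<nu>] by (simp add: \<epsilon>2_def prob_space)
    finally show "expectation (\<lambda>\<omega>. (hproc Cm eps t \<nu> \<omega>)\<^sup>2) \<le> (sqrt \<epsilon>2)\<^sup>2" using \<epsilon>2 by simp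
  qed (use summable_\<rho> \<rho>_nonneg \<epsilon>2 a in auto)
  then show ?thesis
    using \<epsilon>2 suminf_nonneg[OF summable_\<rho> \<rho>_nonneg]
    by (intro exI[of _ "2 * sqrt \<epsilon>2 * suminf \<rho>"]) (auto simp: mult_ac)
qed

text \<open>The approximants are truncated at lag \<open>k\<close> and clipped at \<open>b\<close>,
  with range \<open>k + m\<close>. Their distance from the errors is small in L2, while the lag
  versions of this distance converge at the rate \<open>\<rho>\<close> whatever \<open>k\<close> and
  \<open>b\<close> are.\<close>

lemma hproc_approx:
  assumes "0 < \<epsilon>"
  shows "\<exists>q B X'. (\<forall>t. X' t \<in> borel_measurable (G {int t - int q<..int t})) \<and>
      (\<forall>t. \<forall>\<omega>\<in>space M. \<bar>X' t \<omega>\<bar> \<le> B) \<and> (\<forall>T a A. (\<forall>t. \<bar>a t\<bar> \<le> A) \<longrightarrow>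
      expectation (\<lambda>\<omega>. (\<Sum>t=1..T. a t * ((hproc Cm eps t \<nu> \<omega> - X' t \<omega>) - expectation (\<lambda>\<omega>. hproc Cm eps t \<nu> \<omega> - X' t \<omega>)))\<^sup>2)
        \<le> A\<^sup>2 * \<epsilon> * real T)"
proof -
  have S: "0 \<le> suminf \<rho>" using suminf_nonneg[OF summable_\<rho> \<rho>_nonneg] .
  \<comment> \<open>\<open>weighted_sum_variance_le\<close> produces
    \<open>2 * \<epsilon>1 * suminf \<rho>\<close>; the added 1 keeps the denominator positive.
    Truncation and clipping each get half of \<open>\<epsilon>1\<^sup>2\<close>.\<close>
  define \<epsilon>1 where "\<epsilon>1 = \<epsilon> / (2 * suminf \<rho> + 1)"
  have \<epsilon>1: "0 < \<epsilon>1" "2 * \<epsilon>1 * suminf \<rho> \<le> \<epsilon>"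
    using S assms by (auto simp: \<epsilon>1_def field_simps)
  have "(\<lambda>k. 2 * (\<Lambda> * ((K * cubic_tail k)\<^sup>2 * v2))) \<longlonglongrightarrow> 2 * (\<Lambda> * ((K * 0)\<^sup>2 * v2))"
    by (intro tendsto_intros summable_LIMSEQ_zero summable_cubic_tail)
  then have "\<forall>\<^sub>F k in sequentially. 2 * (\<Lambda> * ((K * cubic_tail k)\<^sup>2 * v2)) < \<epsilon>1\<^sup>2 / 2"
    by (rule order_tendstoD(2)) (use \<epsilon>1 in simp)
  then obtain k where k: "2 * (\<Lambda> * ((K * cubic_tail k)\<^sup>2 * v2)) < \<epsilon>1\<^sup>2 / 2"
    by (auto simp: eventually_sequentially)
  define c where "c = 2 * (\<Lambda> * ((K * cubic_tail 0)\<^sup>2 * (real CARD('d) * \<mu>)))"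
  \<comment> \<open>Chosen so that \<open>b powr \<delta>\<close> exceeds
    \<open>c / (\<epsilon>1\<^sup>2 / 2)\<close>, which makes the clipping error
    \<open>c / b powr \<delta>\<close> smaller than \<open>\<epsilon>1\<^sup>2 / 2\<close>.\<close>
  define b where "b = (c / (\<epsilon>1\<^sup>2 / 2) + 1) powr (1 / \<delta>)"
  have "0 \<le> c" using \<Lambda>_nonneg \<mu>_nonneg by (simp add: c_def)
  then have c1: "0 < c / (\<epsilon>1\<^sup>2 / 2) + 1" using \<epsilon>1 by (intro add_nonneg_pos) auto
  then have b\<delta>: "b powr \<delta> = c / (\<epsilon>1\<^sup>2 / 2) + 1" using \<delta>_pos by (simp add: b_def powr_powr)
  have "c / b powr \<delta> < \<epsilon>1\<^sup>2 / 2"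
    unfolding b\<delta> using c1 \<epsilon>1 by (simp add: pos_divide_less_eq distrib_left)
  moreover have "0 < b" unfolding b_def using c1 by simp
  ultimately have b: "0 < b" "2 * (\<Lambda> * ((K * cubic_tail 0)\<^sup>2 * (real CARD('d) * (\<mu> / b powr \<delta>)))) < \<epsilon>1\<^sup>2 / 2"
    by (simp_all add: c_def)
  have e: "sub_noise (clipped b)" using b by (intro sub_noise_clipped) simp
  define X' where "X' t = hproc (trunc k) (clipped b) t \<nu>" for t
  obtain B where B: "\<And>t \<omega>. \<bar>X' t \<omega>\<bar> \<le> B"
    using hproc_bounded[of b k \<nu>] b unfolding X'_def by auto
  have X'_m: "X' t \<in> borel_measurable (G {int t - int (k + m)<..int t})" for t
    unfolding X'_def by (rule hproc_trunc_measurable[OF e]) simp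
  have "expectation (\<lambda>\<omega>. (\<Sum>t=1..T. a t * ((hproc Cm eps t \<nu> \<omega> - X' t \<omega>) - expectation (\<lambda>\<omega>. hproc Cm eps t \<nu> \<omega> - X' t \<omega>)))\<^sup>2)
        \<le> 2 * A\<^sup>2 * \<epsilon>1 * suminf \<rho> * real T" if a: "\<And>t. \<bar>a t\<bar> \<le> A" for T a A
  proof (rule weighted_sum_variance_le[where
        D' = "\<lambda>h t \<omega>. hproc (trunc (h - m)) eps t \<nu> \<omega> - hproc (trunc (min k (h - m))) (clipped b) t \<nu> \<omega>"])
    fix h t
    show "(\<lambda>\<omega>. hproc Cm eps t \<nu> \<omega> - X' t \<omega>) \<in> borel_measurable (G {..int t})"
      unfolding X'_def by (intro borel_measurable_diff hproc_measurable_past sub_noise_eps e)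
    show "square_integrable M (\<lambda>\<omega>. hproc Cm eps t \<nu> \<omega> - X' t \<omega>)"
      unfolding X'_def by (intro square_integrable_diff hproc_square_integrable sub_coeff_Cm sub_coeff_trunc sub_noise_eps e)
    show "(\<lambda>\<omega>. hproc (trunc (h - m)) eps t \<nu> \<omega> - hproc (trunc (min k (h - m))) (clipped b) t \<nu> \<omega>)
        \<in> borel_measurable (G {int t - int h<..int t})"
      by (intro borel_measurable_diff hproc_trunc_measurable sub_noise_eps e) auto
    show "square_integrable M (\<lambda>\<omega>. hproc (trunc (h - m)) eps t \<nu> \<omega> - hproc (trunc (min k (h - m))) (clipped b) t \<nu> \<omega>)"
      by (intro square_integrable_diff hproc_square_integrable sub_coeff_trunc sub_noise_eps e)
    \<comment> \<open>The lag version cuts both members of the difference at \<open>h - m\<close>;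
      as \<open>X'\<close> is already cut at \<open>k\<close>, it is cut at the minimum. Regrouping
      pairs each member with its own cut, and both pairs have the same tail bound.\<close>
    let ?X1 = "\<lambda>\<omega>. hproc Cm eps t \<nu> \<omega> - hproc (trunc (h - m)) eps t \<nu> \<omega>"
    let ?X2 = "\<lambda>\<omega>. hproc (trunc k) (clipped b) t \<nu> \<omega> - hproc (trunc (min k (h - m))) (clipped b) t \<nu> \<omega>"
    have X1: "square_integrable M ?X1" "expectation (\<lambda>\<omega>. (?X1 \<omega>)\<^sup>2) \<le> \<Lambda> * ((K * cubic_tail (h - m))\<^sup>2 * v2)"
      by (rule hproc_trunc_error[OF sub_coeff_Cm sub_coeff_trunc sub_noise_eps, where n = "h - m"], simp add: trunc_def)+
    have X2: "square_integrable M ?X2" "expectation (\<lambda>\<omega>. (?X2 \<omega>)\<^sup>2) \<le> \<Lambda> * ((K * cubic_tail (h - m))\<^sup>2 * v2)"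
      by (rule hproc_trunc_error[OF sub_coeff_trunc sub_coeff_trunc e, where n = "h - m"], simp add: trunc_def)+
    have "expectation (\<lambda>\<omega>. (hproc Cm eps t \<nu> \<omega> - X' t \<omega> -
        (hproc (trunc (h - m)) eps t \<nu> \<omega> - hproc (trunc (min k (h - m))) (clipped b) t \<nu> \<omega>))\<^sup>2)
      = expectation (\<lambda>\<omega>. (?X1 \<omega> - ?X2 \<omega>)\<^sup>2)"
      unfolding X'_def by (intro Bochner_Integration.integral_cong) (auto simp: algebra_simps)
    also have "\<dots> \<le> 2 * expectation (\<lambda>\<omega>. (?X1 \<omega>)\<^sup>2) + 2 * expectation (\<lambda>\<omega>. (?X2 \<omega>)\<^sup>2)"
      by (rule square_mean_diff_le[OF X1(1) X2(1)])
    also have "\<dots> \<le> (\<rho> h)\<^sup>2"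
      using X1(2) X2(2) unfolding \<rho>_square by linarith
    finally show "expectation (\<lambda>\<omega>. (hproc Cm eps t \<nu> \<omega> - X' t \<omega> -
        (hproc (trunc (h - m)) eps t \<nu> \<omega> - hproc (trunc (min k (h - m))) (clipped b) t \<nu> \<omega>))\<^sup>2) \<le> (\<rho> h)\<^sup>2" .
    let ?Z1 = "\<lambda>\<omega>. hproc Cm eps t \<nu> \<omega> - hproc (trunc k) eps t \<nu> \<omega>"
    let ?Z2 = "\<lambda>\<omega>. hproc (trunc k) eps t \<nu> \<omega> - hproc (trunc k) (clipped b) t \<nu> \<omega>"
    have Z1: "square_integrable M ?Z1" "expectation (\<lambda>\<omega>. (?Z1 \<omega>)\<^sup>2) \<le> \<Lambda> * ((K * cubic_tail k)\<^sup>2 * v2)"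
      by (rule hproc_trunc_error[OF sub_coeff_Cm sub_coeff_trunc sub_noise_eps, where n = k], simp add: trunc_def)+
    note Z2 = hproc_clip_error[OF sub_coeff_trunc b(1), of k t \<nu>]
    have "expectation (\<lambda>\<omega>. (hproc Cm eps t \<nu> \<omega> - X' t \<omega>)\<^sup>2) = expectation (\<lambda>\<omega>. (?Z1 \<omega> + ?Z2 \<omega>)\<^sup>2)"
      unfolding X'_def by (intro Bochner_Integration.integral_cong) auto
    also have "\<dots> \<le> 2 * expectation (\<lambda>\<omega>. (?Z1 \<omega>)\<^sup>2) + 2 * expectation (\<lambda>\<omega>. (?Z2 \<omega>)\<^sup>2)"
      by (rule square_mean_add_le[OF Z1(1) Z2(1)])
    also have "\<dots> \<le> \<epsilon>1\<^sup>2"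
      using Z1(2) Z2(2) k b(2) by linarith
    finally show "expectation (\<lambda>\<omega>. (hproc Cm eps t \<nu> \<omega> - X' t \<omega>)\<^sup>2) \<le> \<epsilon>1\<^sup>2" .
  qed (use summable_\<rho> \<rho>_nonneg \<epsilon>1 a in auto)
  moreover have "2 * A\<^sup>2 * \<epsilon>1 * suminf \<rho> * real T \<le> A\<^sup>2 * \<epsilon> * real T" for A T
    using mult_left_mono[OF \<epsilon>1(2), of "A\<^sup>2 * real T"] by (simp add: mult_ac)
  ultimately have "\<forall>T a A. (\<forall>t. \<bar>a t\<bar> \<le> A) \<longrightarrow> expectation (\<lambda>\<omega>. (\<Sum>t=1..T. a t * ((hproc Cm eps t \<nu> \<omega> - X' t \<omega>) - expectation (\<lambda>\<omega>. hproc Cm eps t \<nu> \<omega> - X' t \<omega>)))\<^sup>2)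
        \<le> A\<^sup>2 * \<epsilon> * real T" using order_trans by blast
  then show ?thesis using X'_m B by blast
qed

end

section \<open>Symmetric matrices and the ridge estimator\<close>

lemma inner_matrix_vector_symmetric:
  fixes A :: "real^'n^'n"
  assumes "transpose A = A"
  shows "u \<bullet> (A *v v) = (A *v u) \<bullet> v"
  by (metis assms dot_lmul_matrix vector_transpose_matrix)

text \<open>By compactness the quadratic form has a minimum on the unit sphere, which serves as
  \<open>\<mu>\<close>; a minimiser is shown to be an eigenvector by a first-order
  variation.\<close>

lemma symmetric_quadratic_form_ge_eigenvalue:
  fixes A :: "real^'n^'n"
  assumes sym: "transpose A = A"
  obtains \<mu> where "\<mu> \<in> real_eigs A" "\<And>v. \<mu> * (v \<bullet> v) \<le> v \<bullet> (A *v v)"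
proof -
  have "continuous_on (sphere 0 1) (\<lambda>v. v \<bullet> (A *v v))"
    by (intro continuous_intros linear_continuous_on matrix_vector_mul_bounded_linear)
  moreover have "sphere 0 1 \<noteq> ({} :: (real^'n) set)" by simp
  ultimately obtain v0 where v0: "v0 \<in> sphere 0 1" "\<And>v. v \<in> sphere 0 1 \<Longrightarrow> v0 \<bullet> (A *v v0) \<le> v \<bullet> (A *v v)"
    using continuous_attains_inf[OF compact_sphere] by blast
  define \<mu> where "\<mu> = v0 \<bullet> (A *v v0)"
  have n0: "v0 \<bullet> v0 = 1" using v0(1) by (simp add: norm_eq_1)
  have ge: "\<mu> * (v \<bullet> v) \<le> v \<bullet> (A *v v)" for v
  proof (cases "v = 0")
    case False
    define w where "w = (1 / norm v) *\<^sub>R v"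
    have vw: "v = norm v *\<^sub>R w" using False by (simp add: w_def)
    have "w \<in> sphere 0 1" using False by (simp add: w_def)
    then have "\<mu> \<le> w \<bullet> (A *v w)" using v0(2) by (simp add: \<mu>_def)
    then have "\<mu> * (norm v)\<^sup>2 \<le> (w \<bullet> (A *v w)) * (norm v)\<^sup>2" by (rule mult_right_mono) simp
    also have "\<dots> = (norm v *\<^sub>R w) \<bullet> (A *v (norm v *\<^sub>R w))"
      by (simp add: power2_eq_square matrix_vector_mult_scaleR)
    finally show ?thesis by (simp add: vw[symmetric] power2_norm_eq_inner)
  qed simp
  \<comment> \<open>\<open>w\<close> is the residual of the eigenvalue equation at the minimiser.
    Moving from \<open>v0\<close> along \<open>- w\<close> changes the form at first order by
    \<open>- 2 * s * (w \<bullet> w)\<close>, and minimality leaves only the second-order term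
    \<open>s\<^sup>2 * g\<close> to compensate.\<close>
  define w where "w = A *v v0 - \<mu> *\<^sub>R v0"
  define g where "g = w \<bullet> (A *v w) - \<mu> * (w \<bullet> w)"
  have "0 \<le> g" using ge[of w] by (simp add: g_def)
  have key: "2 * s * (w \<bullet> w) \<le> s\<^sup>2 * g" for s
  proof -
    have "0 \<le> (v0 - s *\<^sub>R w) \<bullet> (A *v (v0 - s *\<^sub>R w)) - \<mu> * ((v0 - s *\<^sub>R w) \<bullet> (v0 - s *\<^sub>R w))"
      using ge[of "v0 - s *\<^sub>R w"] by simp
    also have "(v0 - s *\<^sub>R w) \<bullet> (A *v (v0 - s *\<^sub>R w)) = \<mu> - 2 * s * (w \<bullet> (A *v v0)) + s\<^sup>2 * (w \<bullet> (A *v w))"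
      using inner_matrix_vector_symmetric[OF sym, of v0 w]
      by (simp add: matrix_vector_mult_diff_distrib matrix_vector_mult_scaleR inner_diff_left inner_diff_right
          \<mu>_def inner_commute power2_eq_square algebra_simps)
    also have "(v0 - s *\<^sub>R w) \<bullet> (v0 - s *\<^sub>R w) = 1 - 2 * s * (w \<bullet> v0) + s\<^sup>2 * (w \<bullet> w)"
      by (simp add: inner_diff_left inner_diff_right n0 inner_commute power2_eq_square algebra_simps)
    also have "\<mu> - 2 * s * (w \<bullet> (A *v v0)) + s\<^sup>2 * (w \<bullet> (A *v w)) - \<mu> * (1 - 2 * s * (w \<bullet> v0) + s\<^sup>2 * (w \<bullet> w))
      = s\<^sup>2 * g - 2 * s * (w \<bullet> (A *v v0 - \<mu> *\<^sub>R v0))"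
      by (simp add: g_def inner_diff_right algebra_simps)
    finally show ?thesis by (simp add: w_def[symmetric])
  qed
  have "w = 0"
  proof (rule ccontr)
    assume "w \<noteq> 0"
    \<comment> \<open>Small enough for the first-order term to win: the inequality becomes
      \<open>2 * (s * (g + 1)) \<le> s * g\<close>.\<close>
    define s where "s = (w \<bullet> w) / (g + 1)"
    have s: "0 < s" "s * (g + 1) = w \<bullet> w" using \<open>w \<noteq> 0\<close> \<open>0 \<le> g\<close> by (auto simp: s_def)
    have "s * (2 * (w \<bullet> w)) \<le> s * (s * g)" using key[of s] by (simp add: power2_eq_square mult_ac)
    then have "2 * (w \<bullet> w) \<le> s * g" using s by simp
    then have "2 * (s * (g + 1)) \<le> s * g" by (simp only: s(2))
    then have "s * g + 2 * s \<le> 0" by (simp add: algebra_simps)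
    moreover have "0 \<le> s * g" using s \<open>0 \<le> g\<close> by simp
    ultimately show False using s by linarith
  qed
  then have "\<mu> \<in> real_eigs A"
    using n0 unfolding real_eigs_def w_def by (auto intro!: exI[of _ v0])
  with ge show thesis using that by blast
qed

text \<open>Eigenvectors for different eigenvalues are orthogonal, hence independent. Finiteness is
  what gives the \<open>Min\<close> in \<open>lambda_min\<close> its meaning.\<close>

lemma finite_real_eigs_symmetric:
  fixes A :: "real^'n^'n"
  assumes sym: "transpose A = A"
  shows "finite (real_eigs A)"
proof -
  define f where "f \<mu> = (SOME v. v \<noteq> 0 \<and> A *v v = \<mu> *\<^sub>R v)" for \<mu>
  have f: "f \<mu> \<noteq> 0 \<and> A *v f \<mu> = \<mu> *\<^sub>R f \<mu>" if "\<mu> \<in> real_eigs A" for \<mu>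
    unfolding f_def by (rule someI_ex) (use that in \<open>simp add: real_eigs_def\<close>)
  have orth: "f \<mu> \<bullet> f \<mu>' = 0" if "\<mu> \<in> real_eigs A" "\<mu>' \<in> real_eigs A" "\<mu> \<noteq> \<mu>'" for \<mu> \<mu>'
  proof -
    have "\<mu>' * (f \<mu> \<bullet> f \<mu>') = \<mu> * (f \<mu> \<bullet> f \<mu>')"
      using inner_matrix_vector_symmetric[OF sym, of "f \<mu>" "f \<mu>'"] f[OF that(1)] f[OF that(2)] by simp
    then show ?thesis using that(3) by simp
  qed
  have inj: "inj_on f (real_eigs A)"
    using orth f by (auto simp: inj_on_def) (metis inner_eq_zero_iff)
  have "pairwise orthogonal (f ` real_eigs A)"
    using orth by (auto simp: pairwise_def orthogonal_def)
  moreover have "0 \<notin> f ` real_eigs A" using f by auto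
  ultimately have "independent (f ` real_eigs A)" by (rule pairwise_orthogonal_independent)
  then have "finite (f ` real_eigs A)" using independent_bound by blast
  then show ?thesis using inj finite_imageD by blast
qed

lemma lambda_min_le_quadratic_form:
  fixes A :: "real^'n^'n"
  assumes "transpose A = A"
  shows "lambda_min A * (v \<bullet> v) \<le> v \<bullet> (A *v v)"
proof -
  obtain \<mu> where \<mu>: "\<mu> \<in> real_eigs A" "\<And>v. \<mu> * (v \<bullet> v) \<le> v \<bullet> (A *v v)"
    using symmetric_quadratic_form_ge_eigenvalue[OF assms] by blast
  have "lambda_min A \<le> \<mu>"
    unfolding lambda_min_def by (intro Min_le finite_real_eigs_symmetric assms \<mu>)
  then have "lambda_min A * (v \<bullet> v) \<le> \<mu> * (v \<bullet> v)" by (rule mult_right_mono) simp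
  with \<mu>(2)[of v] show ?thesis by linarith
qed

text \<open>The least eigenvalue serves as \<open>c\<close>: the form is positive at its
  eigenvector.\<close>

lemma sym_pd_coercive:
  assumes "sym_pd S"
  obtains c where "0 < c" "\<And>v. c * (v \<bullet> v) \<le> v \<bullet> (S *v v)"
proof -
  obtain \<mu> where \<mu>: "\<mu> \<in> real_eigs S" "\<And>v. \<mu> * (v \<bullet> v) \<le> v \<bullet> (S *v v)"
    using symmetric_quadratic_form_ge_eigenvalue[of S] assms unfolding sym_pd_def by blast
  then obtain v where v: "v \<noteq> 0" "S *v v = \<mu> *\<^sub>R v" unfolding real_eigs_def by blast
  then have "0 < v \<bullet> (S *v v)" using assms unfolding sym_pd_def by blast
  then have "0 < \<mu> * (v \<bullet> v)" by (simp add: v(2))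
  then have "0 < \<mu>" unfolding zero_less_mult_iff using inner_ge_zero[of v] by linarith
  with \<mu>(2) show thesis using that by blast
qed

text \<open>\<open>matrix_inv\<close> is defined by choice, so its equations become available only
  once some inverse is exhibited; coercivity makes the kernel trivial.\<close>

lemma coercive_matrix_inv:
  fixes A :: "real^'n^'n"
  assumes "0 < c" and ge: "\<And>v. c * (v \<bullet> v) \<le> v \<bullet> (A *v v)"
  shows "A ** matrix_inv A = mat 1" "matrix_inv A ** A = mat 1" "det A \<noteq> 0"
proof -
  have "x = 0" if "A *v x = 0" for x
    using ge[of x] that \<open>0 < c\<close> by (simp add: mult_le_0_iff) (metis inner_gt_zero_iff not_le)
  then obtain B where B: "B ** A = mat 1" using matrix_left_invertible_ker by blast
  then have "A ** B = mat 1" by (simp add: matrix_left_right_inverse)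
  with B have ex: "\<exists>B. A ** B = mat 1 \<and> B ** A = mat 1" by blast
  show "A ** matrix_inv A = mat 1" "matrix_inv A ** A = mat 1"
    using someI_ex[OF ex] unfolding matrix_inv_def by blast+
  show "det A \<noteq> 0" using ex unfolding invertible_det_nz[symmetric] invertible_def .
qed

lemma coercive_norm_le:
  fixes A :: "real^'n^'n"
  assumes "0 < c" and ge: "\<And>v. c * (v \<bullet> v) \<le> v \<bullet> (A *v v)"
  shows "c * norm z \<le> norm (A *v z)"
proof (cases "z = 0")
  case False
  have "c * norm z * norm z \<le> norm z * norm (A *v z)"
    using ge[of z] norm_cauchy_schwarz[of z "A *v z"]
    by (simp add: power2_norm_eq_inner[symmetric] power2_eq_square mult.assoc)
  then show ?thesis using False by (simp add: mult.commute)
qed simp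

section \<open>Gram matrices, the ridge estimator and the covariance matrix of the score\<close>

lemma gram_mult_vec: "gram x T *v v = (\<Sum>t=1..T. (x t \<bullet> v) *\<^sub>R x t)"
proof -
  have "(\<Sum>j\<in>UNIV. (\<Sum>t=1..T. x t $ i * x t $ j) * v $ j) = (\<Sum>t=1..T. (\<Sum>j\<in>UNIV. x t $ j * v $ j) * x t $ i)" for i
    unfolding sum_distrib_right by (subst sum.swap) (simp add: mult_ac)
  then show ?thesis
    by (simp add: gram_def matrix_vector_mult_def vec_eq_iff inner_vec_def)
qed

lemma gram_nonneg: "0 \<le> v \<bullet> (gram x T *v v)"
  by (simp add: gram_mult_vec inner_sum_right inner_commute sum_nonneg)

lemma ridge_matrix_coercive:
  "lam * (v \<bullet> v) \<le> v \<bullet> ((gram x T + lam *\<^sub>R mat 1) *v v)"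
  using gram_nonneg[of v x T]
  by (simp add: matrix_vector_mult_add_rdistrib scaleR_matrix_vector_assoc[symmetric] inner_add_right)

lemma borel_measurable_vec_lambda:
  fixes f :: "'n::finite \<Rightarrow> 'a \<Rightarrow> real"
  assumes "\<And>i. f i \<in> borel_measurable M"
  shows "(\<lambda>\<omega>. \<chi> i. f i \<omega>) \<in> borel_measurable M"
proof (subst borel_measurable_euclidean_space, rule ballI)
  fix b :: "real^'n" assume "b \<in> Basis"
  then obtain i where "b = axis i 1" by (auto simp: Basis_vec_def)
  then show "(\<lambda>\<omega>. (\<chi> i. f i \<omega>) \<bullet> b) \<in> borel_measurable M"
    using assms by (simp add: inner_axis)
qed

lemma borel_measurable_det:
  fixes F :: "'a \<Rightarrow> real^'n^'n"
  assumes "\<And>i j. (\<lambda>\<omega>. F \<omega> $ i $ j) \<in> borel_measurable M"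
  shows "(\<lambda>\<omega>. det (F \<omega>)) \<in> borel_measurable M"
  unfolding det_def using assms
  by (intro borel_measurable_sum borel_measurable_times borel_measurable_prod borel_measurable_const)

text \<open>For a positive penalty the regularised Gram matrix is invertible and Cramer's rule applies; at
  penalty zero it may be singular, but there the (possibly arbitrary) inverse is a constant matrix.\<close>
lemma ridge_measurable:
  fixes x :: "nat \<Rightarrow> real^'p"
  assumes Lam[measurable]: "Lam \<in> borel_measurable M" and nonneg: "\<And>\<omega>. \<omega> \<in> space M \<Longrightarrow> 0 \<le> Lam \<omega>"
    and Y[measurable]: "\<And>t. Y t \<in> borel_measurable M"
  shows "(\<lambda>\<omega>. ridge x (\<lambda>t. Y t \<omega>) T (Lam \<omega>)) \<in> borel_measurable M"
proof -
  define y where "y \<omega> = (\<Sum>t=1..T. Y t \<omega> *\<^sub>R x t)" for \<omega>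
  define A where "A \<omega> = gram x T + Lam \<omega> *\<^sub>R mat 1" for \<omega>
  have y[measurable]: "y \<in> borel_measurable M" unfolding y_def by measurable
  have A[measurable]: "(\<lambda>\<omega>. A \<omega> $ i $ j) \<in> borel_measurable M" for i j
    unfolding A_def by (simp add: mat_def)
  have "(\<lambda>\<omega>. if Lam \<omega> = 0 then matrix_inv (gram x T) *v y \<omega>
      else \<chi> k. det (\<chi> i j. if j = k then y \<omega> $ i else A \<omega> $ i $ j) / det (A \<omega>)) \<in> borel_measurable M"
  proof (rule measurable_If)
    show "(\<lambda>\<omega>. matrix_inv (gram x T) *v y \<omega>) \<in> borel_measurable M"
      using y by (rule matrix_vector_mult_measurable)
    show "(\<lambda>\<omega>. \<chi> k. det (\<chi> i j. if j = k then y \<omega> $ i else A \<omega> $ i $ j) / det (A \<omega>)) \<in> borel_measurable M"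
    proof (intro borel_measurable_vec_lambda borel_measurable_divide borel_measurable_det A)
      show "(\<lambda>\<omega>. (\<chi> i j. if j = k then y \<omega> $ i else A \<omega> $ i $ j) $ i $ j) \<in> borel_measurable M" for i j k
        by (cases "j = k") (simp_all add: A borel_measurable_vec_component y)
    qed
  qed measurable
  moreover have "ridge x (\<lambda>t. Y t \<omega>) T (Lam \<omega>) = (if Lam \<omega> = 0 then matrix_inv (gram x T) *v y \<omega>
      else \<chi> k. det (\<chi> i j. if j = k then y \<omega> $ i else A \<omega> $ i $ j) / det (A \<omega>))" if "\<omega> \<in> space M" for \<omega>
  proof (cases "Lam \<omega> = 0")
    case False
    with nonneg[OF that] have pos: "0 < Lam \<omega>" by simp
    note inv = coercive_matrix_inv[OF pos ridge_matrix_coercive[of "Lam \<omega>" _ x T], folded A_def]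
    have "A \<omega> *v (matrix_inv (A \<omega>) *v y \<omega>) = y \<omega>"
      by (simp add: matrix_vector_mul_assoc inv(1))
    then have "matrix_inv (A \<omega>) *v y \<omega> = (\<chi> k. det (\<chi> i j. if j = k then y \<omega> $ i else A \<omega> $ i $ j) / det (A \<omega>))"
      using cramer[OF inv(3)] by blast
    then show ?thesis using False unfolding ridge_def y_def[symmetric] A_def[symmetric] by simp
  qed (simp add: ridge_def y_def)
  ultimately show ?thesis by (subst measurable_cong) auto
qed

text \<open>Both vectors solve linear systems:
  \<open>A *v Z = T *\<^sub>R g - (sqrt T * lam) *\<^sub>R \<beta>\<close> and
  \<open>S *v Z0 = g\<close>. Applying \<open>A\<close> to \<open>Z - Z0\<close> leaves only the
  deviation of the Gram matrix and the penalty acting on \<open>Z0\<close>, plus a bias term;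
  coercivity of \<open>A\<close> inverts this. No randomness enters.\<close>

lemma ridge_linearisation_error:
  fixes x :: "nat \<Rightarrow> real^'p" and S :: "real^'p^'p" and \<beta> g :: "real^'p" and e :: "nat \<Rightarrow> real"
  assumes "0 < T" "0 \<le> lam" "0 < c"
    and S: "\<And>v. c * (v \<bullet> v) \<le> v \<bullet> (S *v v)"
    and near: "\<And>v. norm (((1 / real T) *\<^sub>R gram x T - S) *v v) \<le> \<eta> * norm v" and "\<eta> \<le> c / 2"
  defines "g \<equiv> (1 / sqrt T) *\<^sub>R (\<Sum>t=1..T. e t *\<^sub>R x t)"
  shows "norm (sqrt T *\<^sub>R (ridge x (\<lambda>t. x t \<bullet> \<beta> + e t) T lam - \<beta>) - matrix_inv S *v g)
    \<le> 2 / c * ((\<eta> + lam / T) * (norm g / c) + lam / sqrt T * norm \<beta>)"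
proof -
  define A where "A = gram x T + lam *\<^sub>R mat 1"
  define B where "B = (1 / real T) *\<^sub>R gram x T - S"
  define Z where "Z = sqrt T *\<^sub>R (ridge x (\<lambda>t. x t \<bullet> \<beta> + e t) T lam - \<beta>)"
  define Z0 where "Z0 = matrix_inv S *v g"
  have A_mult: "A *v v = gram x T *v v + lam *\<^sub>R v" for v
    by (simp add: A_def matrix_vector_mult_add_rdistrib scaleR_matrix_vector_assoc[symmetric])
  have gram_eq: "gram x T *v v = real T *\<^sub>R (S *v v + B *v v)" for v
    using \<open>0 < T\<close> by (simp add: B_def matrix_vector_mult_diff_rdistrib scaleR_matrix_vector_assoc[symmetric])
  \<comment> \<open>The perturbation takes away at most \<open>\<eta> \<le> c / 2\<close> of the
    coercivity constant \<open>c\<close>, and the penalty only adds.\<close>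
  have A: "real T * (c / 2) * (v \<bullet> v) \<le> v \<bullet> (A *v v)" for v
  proof -
    have "\<bar>v \<bullet> (B *v v)\<bar> \<le> norm v * norm (B *v v)" by (rule Cauchy_Schwarz_ineq2)
    also have "\<dots> \<le> norm v * (\<eta> * norm v)" unfolding B_def by (intro mult_left_mono near) simp
    also have "\<dots> = \<eta> * (v \<bullet> v)" by (simp add: power2_norm_eq_inner[symmetric] power2_eq_square)
    also have "\<dots> \<le> c / 2 * (v \<bullet> v)" using \<open>\<eta> \<le> c / 2\<close> by (intro mult_right_mono) auto
    finally have "c / 2 * (v \<bullet> v) \<le> v \<bullet> (S *v v) + v \<bullet> (B *v v)" using S[of v] by (simp add: abs_le_iff)
    then have "real T * (c / 2 * (v \<bullet> v)) \<le> real T * (v \<bullet> (S *v v) + v \<bullet> (B *v v))" by (rule mult_left_mono) simp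
    moreover have "0 \<le> lam * (v \<bullet> v)" using \<open>0 \<le> lam\<close> by simp
    ultimately show ?thesis unfolding A_mult gram_eq by (simp add: inner_add_right mult.assoc)
  qed
  have pos: "0 < real T * (c / 2)" using \<open>0 < T\<close> \<open>0 < c\<close> by simp
  have "A *v ridge x (\<lambda>t. x t \<bullet> \<beta> + e t) T lam = (\<Sum>t=1..T. (x t \<bullet> \<beta> + e t) *\<^sub>R x t)"
    unfolding ridge_def A_def[symmetric] using coercive_matrix_inv(1)[OF pos A] by (simp add: matrix_vector_mul_assoc)
  also have "\<dots> = gram x T *v \<beta> + (\<Sum>t=1..T. e t *\<^sub>R x t)"
    by (simp add: gram_mult_vec scaleR_left_distrib sum.distrib)
  finally have "A *v (ridge x (\<lambda>t. x t \<bullet> \<beta> + e t) T lam - \<beta>) = (\<Sum>t=1..T. e t *\<^sub>R x t) - lam *\<^sub>R \<beta>"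
    by (simp add: matrix_vector_mult_diff_distrib A_mult)
  then have "A *v Z = sqrt T *\<^sub>R ((\<Sum>t=1..T. e t *\<^sub>R x t) - lam *\<^sub>R \<beta>)"
    by (simp add: Z_def matrix_vector_mult_scaleR)
  also have "(\<Sum>t=1..T. e t *\<^sub>R x t) = sqrt T *\<^sub>R g" using \<open>0 < T\<close> by (simp add: g_def)
  finally have AZ: "A *v Z = real T *\<^sub>R g - (sqrt T * lam) *\<^sub>R \<beta>"
    by (simp add: scaleR_right_diff_distrib)
  have SZ0: "S *v Z0 = g" using coercive_matrix_inv(1)[OF \<open>0 < c\<close> S] by (simp add: Z0_def matrix_vector_mul_assoc)
  have "A *v (Z - Z0) = - (real T *\<^sub>R (B *v Z0) + lam *\<^sub>R Z0 + (sqrt T * lam) *\<^sub>R \<beta>)"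
    unfolding matrix_vector_mult_diff_distrib AZ A_mult[of Z0] gram_eq[of Z0] SZ0
    by (simp add: scaleR_right_distrib)
  then have "norm (A *v (Z - Z0)) = norm (real T *\<^sub>R (B *v Z0) + lam *\<^sub>R Z0 + (sqrt T * lam) *\<^sub>R \<beta>)"
    by (simp only: norm_minus_cancel)
  also have "\<dots> \<le> real T * (\<eta> * norm Z0) + lam * norm Z0 + sqrt T * lam * norm \<beta>"
  proof (intro norm_triangle_mono)
    show "norm (real T *\<^sub>R (B *v Z0)) \<le> real T * (\<eta> * norm Z0)"
      using near[of Z0] unfolding B_def by (simp add: mult_left_mono)
  qed (use \<open>0 \<le> lam\<close> in \<open>auto simp: abs_mult\<close>)
  finally have "real T * (c / 2) * norm (Z - Z0) \<le> real T * (\<eta> * norm Z0) + lam * norm Z0 + sqrt T * lam * norm \<beta>"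
    using coercive_norm_le[OF pos A, of "Z - Z0"] by linarith
  also have "\<dots> = real T * ((\<eta> + lam / T) * norm Z0 + lam / sqrt T * norm \<beta>)"
  proof -
    have "real T * (lam / sqrt T * norm \<beta>) = real T / sqrt T * lam * norm \<beta>"
      by (simp add: mult_ac)
    then have "real T * (lam / sqrt T * norm \<beta>) = sqrt T * lam * norm \<beta>"
      by (simp add: real_div_sqrt)
    moreover have "real T * ((\<eta> + lam / T) * norm Z0) = real T * (\<eta> * norm Z0) + lam * norm Z0"
      using \<open>0 < T\<close> by (simp add: field_simps)
    ultimately show ?thesis by (simp only: distrib_left)
  qed
  finally have "c / 2 * norm (Z - Z0) \<le> (\<eta> + lam / T) * norm Z0 + lam / sqrt T * norm \<beta>"
    using \<open>0 < T\<close> by (simp add: mult.assoc)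
  also have "\<dots> \<le> (\<eta> + lam / T) * (norm g / c) + lam / sqrt T * norm \<beta>"
  proof (intro add_right_mono mult_left_mono)
    show "norm Z0 \<le> norm g / c"
      using coercive_norm_le[OF \<open>0 < c\<close> S, of Z0] \<open>0 < c\<close> by (simp add: SZ0 field_simps)
    \<comment> \<open>The sign of \<open>\<eta>\<close> is read off from \<open>near\<close> at a
      unit vector.\<close>
    have "0 \<le> \<eta> * norm (axis undefined 1 :: real^'p)" using near[of "axis undefined 1"] norm_ge_zero order_trans by blast
    then show "0 \<le> \<eta> + lam / T" using \<open>0 \<le> lam\<close> by (simp add: norm_axis_1)
  qed
  finally have "2 / c * (c / 2 * norm (Z - Z0)) \<le> 2 / c * ((\<eta> + lam / T) * (norm g / c) + lam / sqrt T * norm \<beta>)"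
    using \<open>0 < c\<close> by (intro mult_left_mono) auto
  then show ?thesis using \<open>0 < c\<close> by (simp add: Z_def Z0_def)
qed

text \<open>Allows the form to be read as the variance of the normalised sum of
  \<open>(b \<bullet> x t) * e t\<close>; the proof only moves the coordinate sums inside the time
  sums.\<close>

lemma Gamma_mat_quadratic_form:
  "b \<bullet> (Gamma_mat M x e T *v b) = (1 / real T) * (\<Sum>s=1..T. \<Sum>t=1..T. (b \<bullet> x s) * (b \<bullet> x t) * covar M (e s) (e t))"
proof -
  define k where "k s t = covar M (e s) (e t)" for s t
  have "b \<bullet> (Gamma_mat M x e T *v b)
      = (\<Sum>i\<in>UNIV. \<Sum>j\<in>UNIV. \<Sum>s=1..T. \<Sum>t=1..T. 1 / real T * (b $ i * x s $ i * (b $ j * x t $ j) * k s t))"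
    unfolding Gamma_mat_def inner_vec_def matrix_vector_mult_def k_def[symmetric]
    by (simp add: sum_distrib_left sum_distrib_right mult_ac)
  also have "\<dots> = (\<Sum>i\<in>UNIV. \<Sum>s=1..T. \<Sum>j\<in>UNIV. \<Sum>t=1..T. 1 / real T * (b $ i * x s $ i * (b $ j * x t $ j) * k s t))"
    by (intro sum.cong refl sum.swap)
  also have "\<dots> = (\<Sum>i\<in>UNIV. \<Sum>s=1..T. \<Sum>t=1..T. \<Sum>j\<in>UNIV. 1 / real T * (b $ i * x s $ i * (b $ j * x t $ j) * k s t))"
    by (intro sum.cong refl sum.swap)
  also have "\<dots> = (\<Sum>s=1..T. \<Sum>i\<in>UNIV. \<Sum>t=1..T. \<Sum>j\<in>UNIV. 1 / real T * (b $ i * x s $ i * (b $ j * x t $ j) * k s t))"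
    by (rule sum.swap)
  also have "\<dots> = (\<Sum>s=1..T. \<Sum>t=1..T. \<Sum>i\<in>UNIV. \<Sum>j\<in>UNIV. 1 / real T * (b $ i * x s $ i * (b $ j * x t $ j) * k s t))"
    by (intro sum.cong refl sum.swap)
  also have "\<dots> = (\<Sum>s=1..T. \<Sum>t=1..T. 1 / real T * ((b \<bullet> x s) * (b \<bullet> x t) * k s t))"
    unfolding inner_vec_def inner_real_def sum_product
    by (simp add: sum_distrib_left sum_distrib_right mult_ac)
  finally show ?thesis by (simp add: k_def sum_distrib_left)
qed

lemma Gamma_mat_symmetric: "transpose (Gamma_mat M x e T) = Gamma_mat M x e T"
proof -
  have "(\<Sum>s=1..T. \<Sum>t=1..T. x s $ j * x t $ i * covar M (e s) (e t))
      = (\<Sum>s=1..T. \<Sum>t=1..T. x s $ i * x t $ j * covar M (e s) (e t))" for i j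
    by (subst sum.swap) (simp add: covar_def mult_ac)
  then show ?thesis by (simp add: transpose_def Gamma_mat_def)
qed

section \<open>Asymptotic normality\<close>

context spatial_factor_errors
begin

interpretation indep_time_algebras M G by (rule indep_time_algebras_G)

text \<open>\<open>AN\<close> tests one direction at a time, so a scalar limit theorem and Levy
  continuity suffice. Comparing characteristic functions asks only for an L1 bound on the
  linearisation error, which second moments of \<open>Lam T\<close> and \<open>g T\<close> provide
  by Cauchy-Schwarz.\<close>

lemma ridge_asymptotically_normal:
  fixes x :: "nat \<Rightarrow> real^'p" and \<beta> :: "real^'p" and S :: "real^'p^'p" and \<nu> :: 'd
    and Lam :: "nat \<Rightarrow> 'a \<Rightarrow> real" and e :: "nat \<Rightarrow> 'a \<Rightarrow> real"
  defines "e \<equiv> (\<lambda>t \<omega>. hproc Cm eps t \<nu> \<omega> - expectation (hproc Cm eps t \<nu>))"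
  assumes x_bdd: "\<And>t. norm (x t) \<le> Bx" and S: "sym_pd S"
    and gram_conv: "\<And>T. 0 < T \<Longrightarrow> onorm (\<lambda>v. ((1 / real T) *\<^sub>R gram x T - S) *v v) \<le> Cx / sqrt T"
    and Gam: "0 < Liminf sequentially (\<lambda>T. ereal (lambda_min (Gamma_mat M x e T)))"
    and Lam: "\<And>T. Lam T \<in> borel_measurable M" "\<And>T \<omega>. \<omega> \<in> space M \<Longrightarrow> 0 \<le> Lam T \<omega>"
    and Lam_lim: "(\<lambda>T. \<integral>\<^sup>+\<omega>. ennreal ((Lam T \<omega>)\<^sup>2) \<partial>M) \<longlonglongrightarrow> 0"
  shows "AN M (\<lambda>T \<omega>. sqrt (real T) *\<^sub>R (ridge x (\<lambda>t. x t \<bullet> \<beta> + e t \<omega>) T (Lam T \<omega>) - \<beta>)) (\<lambda>_. 0)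
    (\<lambda>T. matrix_inv S ** Gamma_mat M x e T ** matrix_inv S)"
  unfolding AN_def
proof (intro allI impI)
  fix a :: "real^'p"
  assume ev: "\<forall>\<^sub>F n in sequentially. 0 < a \<bullet> ((matrix_inv S ** Gamma_mat M x e n ** matrix_inv S) *v a)"
  define X where "X t = hproc Cm eps t \<nu>" for t
  have e_X: "e t = (\<lambda>\<omega>. X t \<omega> - expectation (X t))" for t
    by (simp add: e_def X_def)
  have sqX: "square_integrable M (X t)" for t
    unfolding X_def by (rule hproc_square_integrable[OF sub_coeff_Cm sub_noise_eps])
  have sqe: "square_integrable M (e t)" for t
    unfolding e_X by (intro square_integrable_diff sqX square_integrable_const)
  have [measurable]: "e t \<in> borel_measurable M" for t
    using sqe by (rule square_integrable_measurable)
  have cov_e: "covar M (e s) (e t) = covar M (X s) (X t)" for s t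
    using square_integrable_integrable[OF sqX] by (simp add: covar_def e_X prob_space)
  obtain c where c: "0 < c" "\<And>v. c * (v \<bullet> v) \<le> v \<bullet> (S *v v)"
    using sym_pd_coercive[OF S] by blast
  \<comment> \<open>By symmetry of \<open>S\<close>, testing the linearised estimator with
    \<open>a\<close> is testing \<open>g\<close> with \<open>b\<close>; the variance in
    \<open>AN\<close> becomes the quadratic form of \<open>Gamma_mat\<close> at
    \<open>b\<close>.\<close>
  define b where "b = matrix_inv S *v a"
  have Sb: "S *v b = a"
    using coercive_matrix_inv(1)[OF c] by (simp add: b_def matrix_vector_mul_assoc)
  have a_inv: "a \<bullet> (matrix_inv S *v w) = b \<bullet> w" for w
  proof -
    have "S *v (matrix_inv S *v w) = w"
      using coercive_matrix_inv(1)[OF c] by (simp add: matrix_vector_mul_assoc)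
    moreover have "transpose S = S" using S by (simp add: sym_pd_def)
    ultimately show ?thesis
      using inner_matrix_vector_symmetric[of S b "matrix_inv S *v w"] Sb by simp
  qed
  define \<sigma>2 where "\<sigma>2 T = b \<bullet> (Gamma_mat M x e T *v b)" for T
  have \<sigma>2_eq: "a \<bullet> ((matrix_inv S ** Gamma_mat M x e T ** matrix_inv S) *v a) = \<sigma>2 T" for T
    by (simp add: \<sigma>2_def a_inv b_def[symmetric] flip: matrix_vector_mul_assoc)
  \<comment> \<open>Positivity at a single sample size already excludes
    \<open>b = 0\<close>.\<close>
  obtain n where "0 < a \<bullet> ((matrix_inv S ** Gamma_mat M x e n ** matrix_inv S) *v a)"
    using ev by (auto simp: eventually_sequentially)
  then have "b \<noteq> 0" by (auto simp: \<sigma>2_eq \<sigma>2_def)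
  \<comment> \<open>A level strictly between 0 and the lower limit gives a variance bound
    \<open>s0\<close> valid for all large \<open>T\<close>.\<close>
  obtain l0 where l0: "0 < ereal l0" "ereal l0 < Liminf sequentially (\<lambda>T. ereal (lambda_min (Gamma_mat M x e T)))"
    using ereal_dense2[OF Gam] by blast
  define s0 where "s0 = l0 * (b \<bullet> b)"
  have "0 < s0" using l0 \<open>b \<noteq> 0\<close> by (simp add: s0_def)
  have ev_\<sigma>: "\<forall>\<^sub>F T in sequentially. s0 \<le> \<sigma>2 T"
    using less_LiminfD[OF l0(2)]
  proof eventually_elim
    case (elim T)
    then have "l0 * (b \<bullet> b) \<le> lambda_min (Gamma_mat M x e T) * (b \<bullet> b)" by (intro mult_right_mono) auto
    also have "\<dots> \<le> \<sigma>2 T"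
      unfolding \<sigma>2_def by (rule lambda_min_le_quadratic_form[OF Gamma_mat_symmetric])
    finally show ?case by (simp add: s0_def)
  qed
  \<comment> \<open>These weights carry the normalisation: for large \<open>T\<close> they are
    bounded by \<open>norm b * Bx / sqrt s0\<close> and give \<open>W T\<close> variance exactly
    one.\<close>
  define w where "w T t = (b \<bullet> x t) / sqrt (\<sigma>2 T)" for T t
  define W where "W T \<omega> = (\<Sum>t=1..T. w T t * (X t \<omega> - expectation (X t))) / sqrt T" for T \<omega>
  have sqW: "square_integrable M (W T)" for T
    unfolding W_def divide_inverse mult.commute[of _ "inverse _"]
    by (intro square_integrable_cmult square_integrable_sum square_integrable_diff sqX square_integrable_const)
  note [measurable] = sqW[THEN square_integrable_measurable]
  have W_var: "expectation (\<lambda>\<omega>. (W T \<omega>)\<^sup>2) = 1" if "0 < T" "s0 \<le> \<sigma>2 T" for T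
  proof -
    have pos: "0 < \<sigma>2 T" using that \<open>0 < s0\<close> by simp
    have "expectation (\<lambda>\<omega>. (W T \<omega>)\<^sup>2) = expectation (\<lambda>\<omega>. (\<Sum>t=1..T. w T t * (X t \<omega> - expectation (X t)))\<^sup>2) / T"
      by (simp add: W_def power_divide)
    also have "expectation (\<lambda>\<omega>. (\<Sum>t=1..T. w T t * (X t \<omega> - expectation (X t)))\<^sup>2)
      = (\<Sum>s=1..T. \<Sum>t=1..T. w T s * w T t * covar M (X s) (X t))"
      by (rule expectation_weighted_sum_square) (rule sqX)
    also have "\<dots> = (\<Sum>s=1..T. \<Sum>t=1..T. (b \<bullet> x s) * (b \<bullet> x t) * covar M (e s) (e t)) / \<sigma>2 T"
      using pos by (simp add: w_def cov_e sum_divide_distrib)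
    also have "(\<Sum>s=1..T. \<Sum>t=1..T. (b \<bullet> x s) * (b \<bullet> x t) * covar M (e s) (e t)) = T * \<sigma>2 T"
      using that(1) by (simp add: \<sigma>2_def Gamma_mat_quadratic_form)
    finally show ?thesis using pos that(1) by simp
  qed
  have W_char: "(\<lambda>T. expectation (\<lambda>\<omega>. iexp (\<theta> * W T \<omega>))) \<longlonglongrightarrow> exp (- \<theta>\<^sup>2 / 2)" for \<theta>
    unfolding W_def
  proof (rule char_normalised_sum_tendsto[OF sqX])
    show "\<exists>q B X'. (\<forall>t. X' t \<in> borel_measurable (G {int t - int q<..int t})) \<and>
      (\<forall>t. \<forall>\<omega>\<in>space M. \<bar>X' t \<omega>\<bar> \<le> B) \<and> (\<forall>T a A. (\<forall>t. \<bar>a t\<bar> \<le> A) \<longrightarrow>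
      expectation (\<lambda>\<omega>. (\<Sum>t=1..T. a t * ((X t \<omega> - X' t \<omega>) - expectation (\<lambda>\<omega>. X t \<omega> - X' t \<omega>)))\<^sup>2)
        \<le> A\<^sup>2 * \<epsilon> * real T)" if "0 < \<epsilon>" for \<epsilon>
      unfolding X_def by (rule hproc_approx[OF that])
    show "\<forall>\<^sub>F T in sequentially. \<forall>t. \<bar>w T t\<bar> \<le> norm b * Bx / sqrt s0"
      using ev_\<sigma>
    proof eventually_elim
      case (elim T)
      have bx: "\<bar>b \<bullet> x t\<bar> \<le> norm b * Bx" for t
        using Cauchy_Schwarz_ineq2[of b "x t"] mult_left_mono[OF x_bdd[of t] norm_ge_zero[of b]] by linarith
      moreover have "0 \<le> norm b * Bx" using order_trans[OF abs_ge_zero bx[of 0]] .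
      ultimately show ?case
        using elim \<open>0 < s0\<close> by (auto simp: w_def intro!: frac_le)
    qed
    show "\<forall>\<^sub>F T in sequentially. expectation (\<lambda>\<omega>. ((\<Sum>t=1..T. w T t * (X t \<omega> - expectation (X t))) / sqrt T)\<^sup>2) = 1"
      using ev_\<sigma> eventually_gt_at_top[of 0] unfolding W_def[symmetric]
      by eventually_elim (rule W_var)
  qed
  define g where "g T \<omega> = (1 / sqrt T) *\<^sub>R (\<Sum>t=1..T. e t \<omega> *\<^sub>R x t)" for T \<omega>
  have [measurable]: "g T \<in> borel_measurable M" for T unfolding g_def by measurable
  obtain Bv where Bv: "0 \<le> Bv" "\<And>T a A. (\<And>t. \<bar>a t\<bar> \<le> A) \<Longrightarrow>
      expectation (\<lambda>\<omega>. (\<Sum>t=1..T. a t * (X t \<omega> - expectation (X t)))\<^sup>2) \<le> A\<^sup>2 * Bv * real T"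
    using hproc_sum_variance_bound[of \<nu>] unfolding X_def by blast
  define Kg where "Kg = real CARD('p) * (Bx\<^sup>2 * Bv)"
  have g_i: "g T \<omega> $ i = (\<Sum>t=1..T. x t $ i * (X t \<omega> - expectation (X t))) / sqrt T" for T \<omega> i
    by (simp add: g_def e_X sum_divide_distrib mult.commute)
  have sq_gi: "square_integrable M (\<lambda>\<omega>. g T \<omega> $ i)" for T i
    unfolding g_i divide_inverse mult.commute[of _ "inverse _"]
    by (intro square_integrable_cmult square_integrable_sum square_integrable_diff sqX square_integrable_const)
  have gi_le: "expectation (\<lambda>\<omega>. (g T \<omega> $ i)\<^sup>2) \<le> Bx\<^sup>2 * Bv" if "0 < T" for T i
  proof -
    have "expectation (\<lambda>\<omega>. (g T \<omega> $ i)\<^sup>2) = expectation (\<lambda>\<omega>. (\<Sum>t=1..T. x t $ i * (X t \<omega> - expectation (X t)))\<^sup>2) / T"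
      by (simp add: g_i power_divide)
    also have "\<dots> \<le> Bx\<^sup>2 * Bv * real T / T"
      using order_trans[OF component_le_norm_cart x_bdd] by (intro divide_right_mono Bv) auto
    finally show ?thesis using that by simp
  qed
  have sq_g: "square_integrable M (\<lambda>\<omega>. norm (g T \<omega>))" for T
    using sq_gi[of T] by (simp add: square_integrable_def power2_norm_vec)
  have g_le: "expectation (\<lambda>\<omega>. (norm (g T \<omega>))\<^sup>2) \<le> Kg" if "0 < T" for T
  proof -
    have "expectation (\<lambda>\<omega>. (norm (g T \<omega>))\<^sup>2) = (\<Sum>i\<in>UNIV. expectation (\<lambda>\<omega>. (g T \<omega> $ i)\<^sup>2))"
      unfolding power2_norm_vec using sq_gi[of T] by (intro Bochner_Integration.integral_sum) (auto simp: square_integrable_def)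
    also have "\<dots> \<le> (\<Sum>i\<in>(UNIV::'p set). Bx\<^sup>2 * Bv)" by (intro sum_mono gi_le that)
    finally show ?thesis by (simp add: Kg_def)
  qed
  \<comment> \<open>Provides a nonnegative constant without deriving the sign of
    \<open>Cx\<close>.\<close>
  define Cx' where "Cx' = max Cx 0"
  have near: "norm (((1 / real T) *\<^sub>R gram x T - S) *v v) \<le> Cx' / sqrt T * norm v" if "0 < T" for T v
  proof -
    have "norm (((1 / real T) *\<^sub>R gram x T - S) *v v) \<le> onorm (\<lambda>v. ((1 / real T) *\<^sub>R gram x T - S) *v v) * norm v"
      by (rule onorm[OF matrix_vector_mul_bounded_linear])
    also have "\<dots> \<le> Cx' / sqrt T * norm v"
      by (intro mult_right_mono order_trans[OF gram_conv[OF that]] divide_right_mono) (auto simp: Cx'_def)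
    finally show ?thesis .
  qed
  define Z where "Z T \<omega> = sqrt (real T) *\<^sub>R (ridge x (\<lambda>t. x t \<bullet> \<beta> + e t \<omega>) T (Lam T \<omega>) - \<beta>)" for T \<omega>
  define V where "V T \<omega> = (a \<bullet> Z T \<omega> - a \<bullet> 0) / sqrt (a \<bullet> ((matrix_inv S ** Gamma_mat M x e T ** matrix_inv S) *v a))" for T \<omega>
  have [measurable]: "Z T \<in> borel_measurable M" for T
    unfolding Z_def using Lam by (intro borel_measurable_scaleR borel_measurable_diff ridge_measurable) auto
  have V_m[measurable]: "V T \<in> borel_measurable M" for T unfolding V_def by measurable
  define \<kappa> where "\<kappa> = norm a / sqrt s0 * (2 / c)"
  \<comment> \<open>The bound of \<open>ridge_linearisation_error\<close> at rate
    \<open>Cx' / sqrt T\<close>, times the norm of \<open>a\<close> and divided by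
    \<open>sqrt s0\<close>.\<close>
  define \<Delta> where "\<Delta> T \<omega> = \<kappa> * (Cx' / sqrt T / c * norm (g T \<omega>) + 1 / (T * c) * (Lam T \<omega> * norm (g T \<omega>)) + norm \<beta> / sqrt T * Lam T \<omega>)" for T \<omega>
  have "0 \<le> \<kappa>" using \<open>0 < s0\<close> c by (simp add: \<kappa>_def)
  \<comment> \<open>With bound 1, the L2 norm of \<open>Lam T\<close> disappears from the constant
    \<open>C\<close>.\<close>
  have ev_Lam: "\<forall>\<^sub>F T in sequentially. (\<integral>\<^sup>+\<omega>. ennreal ((Lam T \<omega>)\<^sup>2) \<partial>M) \<le> ennreal 1"
    using order_tendstoD(2)[OF Lam_lim, of 1] by (auto elim!: eventually_mono)
  have "(\<lambda>T. Cx' / sqrt (real T)) \<longlonglongrightarrow> 0"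
    by (intro real_tendsto_divide_at_top[OF tendsto_const] filterlim_compose[OF sqrt_at_top filterlim_real_sequentially])
  then have ev_c: "\<forall>\<^sub>F T in sequentially. Cx' / sqrt (real T) < c / 2"
    by (rule order_tendstoD(2)) (use c in simp)
  define C where "C = \<kappa> * (Cx' / c * sqrt Kg + 1 / c * sqrt Kg + norm \<beta>)"
  have V_W: "norm (expectation (\<lambda>\<omega>. iexp (\<theta> * V T \<omega>)) - expectation (\<lambda>\<omega>. iexp (\<theta> * W T \<omega>))) \<le> \<bar>\<theta>\<bar> * (C / sqrt T)"
    if T: "0 < T" "s0 \<le> \<sigma>2 T" "(\<integral>\<^sup>+\<omega>. ennreal ((Lam T \<omega>)\<^sup>2) \<partial>M) \<le> ennreal 1" "Cx' / sqrt T < c / 2" for T \<theta>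
  proof -
    have sqL: "square_integrable M (Lam T)" and L2: "expectation (\<lambda>\<omega>. (Lam T \<omega>)\<^sup>2) \<le> 1"
      using square_integrable_nn_integral[OF Lam(1) _ T(3)] by auto
    note [measurable] = Lam(1)
    have ints: "integrable M (\<lambda>\<omega>. norm (g T \<omega>))" "integrable M (\<lambda>\<omega>. Lam T \<omega> * norm (g T \<omega>))" "integrable M (Lam T)"
      by (rule square_integrable_integrable[OF sq_g] square_integrable_mult[OF sqL sq_g] square_integrable_integrable[OF sqL])+
    have int\<Delta>: "integrable M (\<Delta> T)" unfolding \<Delta>_def using ints by simp
    have diff: "\<bar>V T \<omega> - W T \<omega>\<bar> \<le> \<Delta> T \<omega>" if "\<omega> \<in> space M" for \<omega>
    proof -
      have pos: "0 < \<sigma>2 T" using T \<open>0 < s0\<close> by simp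
      have "W T \<omega> = (b \<bullet> g T \<omega>) / sqrt (\<sigma>2 T)"
        by (simp add: W_def w_def g_def e_X inner_sum_right sum_divide_distrib mult_ac)
      then have "V T \<omega> - W T \<omega> = a \<bullet> (Z T \<omega> - matrix_inv S *v g T \<omega>) / sqrt (\<sigma>2 T)"
        by (simp add: V_def \<sigma>2_eq a_inv inner_diff_right diff_divide_distrib)
      then have "\<bar>V T \<omega> - W T \<omega>\<bar> = \<bar>a \<bullet> (Z T \<omega> - matrix_inv S *v g T \<omega>)\<bar> / sqrt (\<sigma>2 T)"
        using pos by simp
      also have "\<dots> \<le> (norm a * norm (Z T \<omega> - matrix_inv S *v g T \<omega>)) / sqrt s0"
        using T(2) \<open>0 < s0\<close> by (intro frac_le Cauchy_Schwarz_ineq2) auto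
      also have "\<dots> \<le> norm a * (2 / c * ((Cx' / sqrt T + Lam T \<omega> / T) * (norm (g T \<omega>) / c) + Lam T \<omega> / sqrt T * norm \<beta>)) / sqrt s0"
        unfolding Z_def g_def
        using ridge_linearisation_error[OF T(1) Lam(2)[OF that] c near[OF T(1)]] T(4) \<open>0 < s0\<close>
        by (intro divide_right_mono mult_left_mono) auto
      also have "\<dots> = \<Delta> T \<omega>"
        using c by (simp add: \<Delta>_def \<kappa>_def algebra_simps add_divide_distrib)
      finally show ?thesis .
    qed
    have "expectation (\<Delta> T) = \<kappa> * (Cx' / sqrt T / c * expectation (\<lambda>\<omega>. norm (g T \<omega>))
        + 1 / (T * c) * expectation (\<lambda>\<omega>. Lam T \<omega> * norm (g T \<omega>)) + norm \<beta> / sqrt T * expectation (Lam T))"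
      unfolding \<Delta>_def using ints by simp
    also have "\<dots> \<le> \<kappa> * (Cx' / sqrt T / c * sqrt Kg + 1 / (sqrt T * c) * sqrt Kg + norm \<beta> / sqrt T * 1)"
    proof (intro mult_left_mono add_mono \<open>0 \<le> \<kappa>\<close>)
      have Eg: "sqrt (expectation (\<lambda>\<omega>. (norm (g T \<omega>))\<^sup>2)) \<le> sqrt Kg"
        using g_le[OF T(1)] by simp
      show "expectation (\<lambda>\<omega>. norm (g T \<omega>)) \<le> sqrt Kg"
        using order_trans[OF expectation_abs_le_sqrt[OF sq_g] Eg] by simp
      have E1: "expectation (\<lambda>\<omega>. Lam T \<omega> * norm (g T \<omega>)) \<le> 1 * sqrt Kg"
      proof (rule order_trans[OF abs_le_D1[OF abs_integral_mult_le[OF sqL sq_g]] mult_mono])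
        show "sqrt (expectation (\<lambda>\<omega>. (Lam T \<omega>)\<^sup>2)) \<le> 1" using L2 by simp
      qed (use Eg in auto)
      \<comment> \<open>The smaller order \<open>1 / T\<close> of the mixed term is weakened to
        \<open>1 / sqrt T\<close>, so that all three terms share one rate.\<close>
      have "sqrt T \<le> real T" using T(1) by (intro real_le_lsqrt) (auto simp: power2_eq_square)
      then have "1 / (T * c) \<le> 1 / (sqrt T * c)" using T(1) c by (intro divide_left_mono mult_right_mono mult_pos_pos) auto
      then show "1 / (T * c) * expectation (\<lambda>\<omega>. Lam T \<omega> * norm (g T \<omega>)) \<le> 1 / (sqrt T * c) * sqrt Kg"
        using E1 c Lam(2) by (intro mult_mono) (auto intro!: integral_nonneg_AE)
      have "expectation (Lam T) \<le> expectation (\<lambda>\<omega>. \<bar>Lam T \<omega>\<bar>)" using ints(3) by (intro integral_mono) auto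
      also have "\<dots> \<le> 1"
        using order_trans[OF expectation_abs_le_sqrt[OF sqL] real_sqrt_le_mono[OF L2]] by simp
      finally show "expectation (Lam T) \<le> 1" .
    qed (use c in \<open>auto simp: Cx'_def\<close>)
    also have "\<dots> = C / sqrt T" by (simp add: C_def add_divide_distrib distrib_left mult_ac)
    finally have E\<Delta>: "expectation (\<Delta> T) \<le> C / sqrt T" .
    have "norm (expectation (\<lambda>\<omega>. iexp (\<theta> * V T \<omega>)) - expectation (\<lambda>\<omega>. iexp (\<theta> * W T \<omega>))) \<le> expectation (\<lambda>\<omega>. \<bar>\<theta>\<bar> * \<Delta> T \<omega>)"
    proof (rule norm_expectation_iexp_diff_le)
      show "AE \<omega> in M. \<bar>\<theta> * V T \<omega> - \<theta> * W T \<omega>\<bar> \<le> \<bar>\<theta>\<bar> * \<Delta> T \<omega>"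
        using diff by (auto simp: abs_mult simp flip: right_diff_distrib intro!: mult_left_mono)
    qed (use int\<Delta> in auto)
    also have "\<dots> = \<bar>\<theta>\<bar> * expectation (\<Delta> T)" by simp
    also have "\<dots> \<le> \<bar>\<theta>\<bar> * (C / sqrt T)" using E\<Delta> by (intro mult_left_mono) auto
    finally show ?thesis .
  qed
  have V_char: "(\<lambda>T. expectation (\<lambda>\<omega>. iexp (\<theta> * V T \<omega>))) \<longlonglongrightarrow> exp (- \<theta>\<^sup>2 / 2)" for \<theta>
  proof -
    have "(\<lambda>T. \<bar>\<theta>\<bar> * (C / sqrt (real T))) \<longlonglongrightarrow> \<bar>\<theta>\<bar> * 0"
      by (intro tendsto_mult_left real_tendsto_divide_at_top[OF tendsto_const]
          filterlim_compose[OF sqrt_at_top filterlim_real_sequentially])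
    then have lim0: "(\<lambda>T. \<bar>\<theta>\<bar> * (C / sqrt (real T))) \<longlonglongrightarrow> 0" by simp
    have "(\<lambda>T. expectation (\<lambda>\<omega>. iexp (\<theta> * V T \<omega>)) - expectation (\<lambda>\<omega>. iexp (\<theta> * W T \<omega>))) \<longlonglongrightarrow> 0"
    proof (rule Lim_null_comparison[OF _ lim0])
      show "\<forall>\<^sub>F T in sequentially. norm (expectation (\<lambda>\<omega>. iexp (\<theta> * V T \<omega>)) - expectation (\<lambda>\<omega>. iexp (\<theta> * W T \<omega>))) \<le> \<bar>\<theta>\<bar> * (C / sqrt (real T))"
        using eventually_gt_at_top[of 0] ev_\<sigma> ev_Lam ev_c by eventually_elim (rule V_W)
    qed
    from tendsto_add[OF this W_char[of \<theta>]] show ?thesis by simp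
  qed
  have "weak_conv_m (\<lambda>T. distr M borel (V T)) std_normal_distribution"
  proof (rule levy_continuity)
    show "real_distribution (distr M borel (V T))" for T by (rule real_distribution_distr) measurable
    show "real_distribution std_normal_distribution" by (rule real_dist_normal_dist)
    have "char (distr M borel (V T)) \<theta> = expectation (\<lambda>\<omega>. iexp (\<theta> * V T \<omega>))" for T \<theta>
      unfolding char_def by (rule integral_distr) measurable
    then show "(\<lambda>T. char (distr M borel (V T)) \<theta>) \<longlonglongrightarrow> char std_normal_distribution \<theta>" for \<theta>
      using V_char[of \<theta>] by (simp add: char_std_normal_distribution)
  qed
  then show "weak_conv_m (\<lambda>n. distr M borel (\<lambda>\<omega>. (a \<bullet> (sqrt (real n) *\<^sub>R (ridge x (\<lambda>t. x t \<bullet> \<beta> + e t \<omega>) n (Lam n \<omega>) - \<beta>)) - a \<bullet> 0) /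
      sqrt (a \<bullet> ((matrix_inv S ** Gamma_mat M x e n ** matrix_inv S) *v a)))) std_normal_distribution"
    unfolding V_def Z_def .
qed

end

section \<open>Uniform constants from the model assumptions, and both kinds of penalty\<close>

theorem theorem8:
  fixes M :: "'a measure"
    and x :: "nat \<Rightarrow> real^'p" and s :: "nat \<Rightarrow> real^'q"
    and beta :: "('d::finite) \<Rightarrow> real^'p" and Sigx :: "real^'p^'p"
    and L m :: nat and phi :: "'d \<Rightarrow> nat \<Rightarrow> real" and r :: "nat \<Rightarrow> real^'q"
    and dd :: "real^'q \<Rightarrow> real^'q \<Rightarrow> real"
    and Cm :: "nat \<Rightarrow> nat \<Rightarrow> real^'d^'d"
    and eps :: "nat \<Rightarrow> int \<Rightarrow> 'a \<Rightarrow> real^'d"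
    and Sig Sq :: "nat \<Rightarrow> int \<Rightarrow> real^'d^'d" and u :: "nat \<Rightarrow> int \<Rightarrow> 'a \<Rightarrow> real^'d"
    and H :: "(nat \<Rightarrow> real^'d) \<Rightarrow> real^'d"
    and Xi :: "'a \<Rightarrow> nat \<Rightarrow> real^'d"
    and dens :: "nat \<Rightarrow> int \<Rightarrow> 'd \<Rightarrow> real \<Rightarrow> real"
    and \<delta> :: real
  defines "U \<equiv> U_field L phi dd r Cm eps"
  defines "e \<equiv> err_proc M H m U s"
  defines "Y \<equiv> (\<lambda>t \<nu> \<omega>. x t \<bullet> beta \<nu> + e t \<nu> \<omega>)"
  assumes prob: "prob_space M"
  (* standing regressor assumption (R) *)
    and R_bdd: "\<exists>B. \<forall>t. norm (x t) \<le> B"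
    and R_Sigx: "sym_pd Sigx"
    and R_conv: "\<exists>\<eta> C. 0 \<le> \<eta> \<and> (\<forall>T\<ge>1. onorm (\<lambda>v. ((1 / real T) *\<^sub>R gram x T - Sigx) *v v)
                   \<le> C * real CARD('p) powr \<eta> / sqrt (real T))"
    and R_spec: "\<exists>a1 a2. 0 < a1 \<and> a1 \<le> a2 \<and>
                   (\<forall>\<^sub>F T in sequentially. real_eigs ((1 / real T) *\<^sub>R gram x T) \<subseteq> {a1..a2})"
  (* spatial structure *)
    and s_cube: "\<forall>t i. 0 \<le> s t $ i \<and> s t $ i \<le> 1"
    and r_cube: "\<forall>l i. 0 \<le> r l $ i \<and> r l $ i \<le> 1"
    and dd_range: "\<forall>a b. (\<forall>i. 0 \<le> a $ i \<and> a $ i \<le> 1) \<longrightarrow> (\<forall>i. 0 \<le> b $ i \<and> b $ i \<le> 1)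
                      \<longrightarrow> 0 \<le> dd a b \<and> dd a b \<le> 1"
  (* (E1) *)
    and E1_indep: "prob_space.indep_vars M (\<lambda>_. borel) (\<lambda>(l, t). eps l t) ({..L} \<times> UNIV)"
    and E1_Sig: "\<forall>l\<le>L. \<forall>t. sym_pd (Sig l t) \<and> sym_pd (Sq l t) \<and> Sq l t ** Sq l t = Sig l t"
    and E1_rep: "\<forall>l\<le>L. \<forall>t. \<forall>\<omega>\<in>space M. eps l t \<omega> = Sq l t *v u l t \<omega>"
    and E1_u: "\<forall>l\<le>L. \<forall>t. (\<forall>i. integrable M (\<lambda>\<omega>. u l t \<omega> $ i) \<and> (\<integral>\<omega>. u l t \<omega> $ i \<partial>M) = 0)
                 \<and> prob_space.indep_vars M (\<lambda>_. borel) (\<lambda>i \<omega>. u l t \<omega> $ i) UNIV"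
    and E1_mean: "\<forall>l\<le>L. \<forall>t. \<forall>\<nu>. integrable M (\<lambda>\<omega>. eps l t \<omega> $ \<nu>) \<and> (\<integral>\<omega>. eps l t \<omega> $ \<nu> \<partial>M) = 0"
  (* (E2) *)
    and \<delta>_pos: "0 < \<delta>"
    and E2: "\<exists>B. \<forall>l\<le>L. \<forall>t \<nu>. (\<integral>\<^sup>+\<omega>. ennreal (\<bar>eps l t \<omega> $ \<nu>\<bar> powr (2 + \<delta>)) \<partial>M) \<le> ennreal B"
  (* (E3) *)
    and E3: "CARD('d) = 1 \<longrightarrow>
               (\<exists>B. \<forall>l\<le>L. \<forall>t \<nu>. (\<integral>\<^sup>+\<omega>. ennreal ((eps l t \<omega> $ \<nu>)\<^sup>2) \<partial>M) \<le> ennreal B)"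
  (* (E4) *)
    and E4: "(CARD('d) = 1 \<longrightarrow> (\<exists>\<sigma>0>0. \<forall>t \<nu>. (\<integral>\<omega>. (eps 0 t \<omega> $ \<nu>)\<^sup>2 \<partial>M) \<ge> \<sigma>0\<^sup>2))
           \<and> (CARD('d) > 1 \<longrightarrow> (\<exists>lmin0>0. \<forall>t. lambda_min (Sig 0 t) \<ge> lmin0))"
  (* (E5) *)
    and E5_dens: "\<forall>l\<le>L. \<forall>t \<nu>. (\<forall>z. 0 \<le> dens l t \<nu> z) \<and>
                   distributed M lborel (\<lambda>\<omega>. eps l t \<omega> $ \<nu>) (\<lambda>z. ennreal (dens l t \<nu> z))"
    and E5_lip: "\<exists>K. \<forall>l\<le>L. \<forall>t \<nu> h.
                   (\<integral>\<^sup>+z. ennreal \<bar>dens l t \<nu> (z + h) - dens l t \<nu> z\<bar> \<partial>lborel) \<le> ennreal (K * \<bar>h\<bar>)"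
  (* (E6) *)
    and E6: "\<exists>K \<theta>. 0 < \<theta> \<and> (\<forall>l\<le>L. \<forall>j \<nu> i.
                   \<bar>Cm l j $ \<nu> $ i\<bar> \<le> K * real (max j 1) powr (- 7 / 2 - \<theta>))"
  (* (E7) *)
    and E7_lip: "\<exists>LH. \<forall>\<nu> A B. \<bar>H A $ \<nu> - H B $ \<nu>\<bar> \<le> LH * sqrt (\<Sum>k\<le>m. (norm (A k - B k))\<^sup>2)"
    and E7_Xi_meas: "Xi \<in> M \<rightarrow>\<^sub>M PiM {..m} (\<lambda>_. borel)"
    and E7_Xi_indep: "prob_space.indep_set M
                  (sets (vimage_algebra (space M) Xi (PiM {..m} (\<lambda>_. borel))))
                  (sets (vimage_algebra (space M) (\<lambda>\<omega> (t, z). U t z \<omega>) (PiM UNIV (\<lambda>_. borel))))"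
    and E7_mom: "\<exists>B. \<forall>\<nu>. (\<integral>\<^sup>+\<omega>. ennreal (\<bar>H (Xi \<omega>) $ \<nu>\<bar> powr (2 + \<delta>)) \<partial>M) \<le> ennreal B"
  (* bounded idiosyncratic variances *)
    and var0: "\<exists>B. \<forall>t \<nu>. (\<integral>\<^sup>+\<omega>. ennreal ((eps 0 t \<omega> $ \<nu>)\<^sup>2) \<partial>M) \<le> ennreal B"
  (* eigenvalue conditions on Gamma_T *)
    and Gam: "\<forall>\<nu>. 0 < Liminf sequentially (\<lambda>T. ereal (lambda_min (Gamma_mat M x (\<lambda>t. e t \<nu>) T)))
              \<and> Liminf sequentially (\<lambda>T. ereal (lambda_min (Gamma_mat M x (\<lambda>t. e t \<nu>) T)))
                  < Limsup sequentially (\<lambda>T. ereal (lambda_max (Gamma_mat M x (\<lambda>t. e t \<nu>) T)))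
              \<and> Limsup sequentially (\<lambda>T. ereal (lambda_max (Gamma_mat M x (\<lambda>t. e t \<nu>) T))) < \<infinity>"
  shows
    "(\<forall>lam :: nat \<Rightarrow> real. (\<forall>T. 0 \<le> lam T) \<and> lam \<longlonglongrightarrow> 0 \<longrightarrow>
        (\<forall>\<nu>. AN M (\<lambda>T \<omega>. sqrt (real T) *\<^sub>R (ridge x (\<lambda>t. Y t \<nu> \<omega>) T (lam T) - beta \<nu>))
                (\<lambda>_. 0)
                (\<lambda>T. matrix_inv Sigx ** Gamma_mat M x (\<lambda>t. e t \<nu>) T ** matrix_inv Sigx)))
     \<and>
     (\<forall>Lam :: nat \<Rightarrow> 'a \<Rightarrow> real.
        (\<forall>T. Lam T \<in> borel_measurable M \<and> (\<forall>\<omega>\<in>space M. 0 \<le> Lam T \<omega>)) \<and>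
        (\<lambda>T. \<integral>\<^sup>+\<omega>. ennreal ((Lam T \<omega>)\<^sup>2) \<partial>M) \<longlonglongrightarrow> 0 \<longrightarrow>
        (\<forall>\<nu>. AN M (\<lambda>T \<omega>. sqrt (real T) *\<^sub>R (ridge x (\<lambda>t. Y t \<nu> \<omega>) T (Lam T \<omega>) - beta \<nu>))
                (\<lambda>_. 0)
                (\<lambda>T. matrix_inv Sigx ** Gamma_mat M x (\<lambda>t. e t \<nu>) T ** matrix_inv Sigx)))"
proof -
  interpret prob_space M by (rule prob)
  obtain Bx where Bx: "\<And>t. norm (x t) \<le> Bx" using R_bdd by blast
  obtain \<eta> C where gram_conv: "\<And>T. 1 \<le> T \<Longrightarrow> onorm (\<lambda>v. ((1 / real T) *\<^sub>R gram x T - Sigx) *v v)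
      \<le> C * real CARD('p) powr \<eta> / sqrt (real T)"
    using R_conv by blast
  obtain \<mu>0 where \<mu>0: "\<And>l t \<nu>. l \<le> L \<Longrightarrow> (\<integral>\<^sup>+\<omega>. ennreal (\<bar>eps l t \<omega> $ \<nu>\<bar> powr (2 + \<delta>)) \<partial>M) \<le> ennreal \<mu>0"
    using E2 by blast
  obtain K0 \<theta> where "0 < \<theta>" and K0: "\<And>l j \<nu> i. l \<le> L \<Longrightarrow>
      \<bar>Cm l j $ \<nu> $ i\<bar> \<le> K0 * real (max j 1) powr (- 7 / 2 - \<theta>)"
    using E6 by blast
  obtain LH where LH: "\<And>\<nu> A B. \<bar>H A $ \<nu> - H B $ \<nu>\<bar> \<le> LH * sqrt (\<Sum>k\<le>m. (norm (A k - B k))\<^sup>2)"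
    using E7_lip by blast
  \<comment> \<open>Entry bounds give the operator bound with one factor for rows and one for
    columns; the 8 comes from \<open>decay\<close>.\<close>
  define K where "K = real CARD('d) * real CARD('d) * (8 * \<bar>K0\<bar>)"
  \<comment> \<open>The sum dominates every loading uniformly in \<open>\<nu>\<close> and
    \<open>l\<close>; the added 1 serves the idiosyncratic term.\<close>
  define P where "P = 1 + (\<Sum>\<nu>\<in>UNIV. \<Sum>l\<le>L. \<bar>phi \<nu> l\<bar>)"
  \<comment> \<open>\<open>max j 1\<close> is at least half of \<open>Suc j\<close>, also for
    \<open>j = 0\<close>, and halving the base costs the factor \<open>2 ^ 3 = 8\<close>.\<close>
  have decay: "real (max j 1) powr (- 7 / 2 - \<theta>) \<le> 8 * real (Suc j) powr (-3)" for j
  proof -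
    have "real (max j 1) powr (- 7 / 2 - \<theta>) \<le> real (max j 1) powr (-3)"
      using \<open>0 < \<theta>\<close> by (intro powr_mono) auto
    also have "\<dots> \<le> (real (Suc j) / 2) powr (-3)"
      by (intro powr_mono2') auto
    also have "\<dots> = 8 * real (Suc j) powr (-3)"
      by (simp add: powr_divide powr_minus) (simp add: inverse_eq_divide)
    finally show ?thesis .
  qed
  have coeff: "norm (Cm l j *v y) \<le> K * real (Suc j) powr (-3) * norm y" if "l \<le> L" for l j y
  proof -
    have "\<bar>Cm l j $ i $ i'\<bar> \<le> \<bar>K0\<bar> * (8 * real (Suc j) powr (-3))" for i i'
    proof -
      have "\<bar>Cm l j $ i $ i'\<bar> \<le> K0 * real (max j 1) powr (- 7 / 2 - \<theta>)" by (rule K0[OF that])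
      also have "\<dots> \<le> \<bar>K0\<bar> * (8 * real (Suc j) powr (-3))" by (intro mult_mono decay) auto
      finally show ?thesis .
    qed
    from norm_matrix_vector_mult_le[OF this, of y] show ?thesis by (simp add: K_def mult_ac)
  qed
  have weight: "\<bar>phi \<nu> l * dd (s t) (r l)\<bar> \<le> P" if "l \<le> L" for \<nu> l t
  proof -
    have "\<bar>phi \<nu> l\<bar> \<le> (\<Sum>l\<le>L. \<bar>phi \<nu> l\<bar>)"
      using that by (intro member_le_sum) auto
    also have "\<dots> \<le> (\<Sum>\<nu>\<in>UNIV. \<Sum>l\<le>L. \<bar>phi \<nu> l\<bar>)"
      by (intro member_le_sum[of \<nu> UNIV "\<lambda>\<nu>. \<Sum>l\<le>L. \<bar>phi \<nu> l\<bar>"]) (auto intro: sum_nonneg)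
    finally have "\<bar>phi \<nu> l\<bar> \<le> P" by (simp add: P_def)
    moreover have "\<bar>dd (s t) (r l)\<bar> \<le> 1"
      using dd_range[rule_format, of "s t" "r l"] s_cube r_cube by simp
    ultimately have "\<bar>phi \<nu> l\<bar> * \<bar>dd (s t) (r l)\<bar> \<le> P * 1"
      by (intro mult_mono) auto
    then show ?thesis by (simp add: abs_mult)
  qed
  \<comment> \<open>\<open>ennreal\<close> sends a negative bound to 0, so
    \<open>max \<mu>0 0\<close> is a valid nonnegative replacement for
    \<open>\<mu>0\<close>.\<close>
  interpret spatial_factor_errors M L m phi dd r s Cm eps H \<delta> "max \<mu>0 0" K LH P
  proof
    show "indep_vars (\<lambda>_. borel) (\<lambda>(l, t). eps l t) ({..L} \<times> UNIV)" by (rule E1_indep)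
    show "(\<integral>\<^sup>+\<omega>. ennreal (\<bar>eps l t \<omega> $ \<nu>\<bar> powr (2 + \<delta>)) \<partial>M) \<le> ennreal (max \<mu>0 0)" if "l \<le> L" for l t \<nu>
      using \<mu>0[OF that] by (rule order_trans) (simp add: ennreal_leI)
    show "1 \<le> P" by (simp add: P_def sum_nonneg)
    show "0 \<le> K" by (simp add: K_def)
    show "\<And>l j y. l \<le> L \<Longrightarrow> norm (Cm l j *v y) \<le> K * real (Suc j) powr (-3) * norm y" by (rule coeff)
    show "\<And>\<nu> l t. l \<le> L \<Longrightarrow> \<bar>phi \<nu> l * dd (s t) (r l)\<bar> \<le> P" by (rule weight)
    show "\<And>\<nu> A B. \<bar>H A $ \<nu> - H B $ \<nu>\<bar> \<le> LH * sqrt (\<Sum>k\<le>m. (norm (A k - B k))\<^sup>2)" by (rule LH)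
  qed (use \<delta>_pos in simp_all)
  have e_eq: "e t \<nu> = (\<lambda>\<omega>. hproc Cm eps t \<nu> \<omega> - expectation (hproc Cm eps t \<nu>))" for t \<nu>
    by (simp add: fun_eq_iff e_def err_proc_def U_def hproc_def[abs_def])
  have random_penalty: "AN M (\<lambda>T \<omega>. sqrt (real T) *\<^sub>R (ridge x (\<lambda>t. Y t \<nu> \<omega>) T (Lam T \<omega>) - beta \<nu>)) (\<lambda>_. 0)
      (\<lambda>T. matrix_inv Sigx ** Gamma_mat M x (\<lambda>t. e t \<nu>) T ** matrix_inv Sigx)"
    if "\<And>T. Lam T \<in> borel_measurable M" "\<And>T \<omega>. \<omega> \<in> space M \<Longrightarrow> 0 \<le> Lam T \<omega>"
      and "(\<lambda>T. \<integral>\<^sup>+\<omega>. ennreal ((Lam T \<omega>)\<^sup>2) \<partial>M) \<longlonglongrightarrow> 0" for Lam :: "nat \<Rightarrow> 'a \<Rightarrow> real" and \<nu>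
    unfolding Y_def e_eq
  proof (rule ridge_asymptotically_normal[OF Bx R_Sigx])
    show "onorm (\<lambda>v. ((1 / real T) *\<^sub>R gram x T - Sigx) *v v) \<le> (C * real CARD('p) powr \<eta>) / sqrt T" if "0 < T" for T
      using that by (intro gram_conv) simp
    show "0 < Liminf sequentially (\<lambda>T. ereal (lambda_min (Gamma_mat M x
        (\<lambda>t \<omega>. hproc Cm eps t \<nu> \<omega> - expectation (hproc Cm eps t \<nu>)) T)))"
      using Gam unfolding e_eq by blast
  qed (use that in auto)
  have fixed_penalty: "AN M (\<lambda>T \<omega>. sqrt (real T) *\<^sub>R (ridge x (\<lambda>t. Y t \<nu> \<omega>) T (lam T) - beta \<nu>)) (\<lambda>_. 0)
      (\<lambda>T. matrix_inv Sigx ** Gamma_mat M x (\<lambda>t. e t \<nu>) T ** matrix_inv Sigx)"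
    if "\<And>T. 0 \<le> lam T" "lam \<longlonglongrightarrow> 0" for lam :: "nat \<Rightarrow> real" and \<nu>
  proof (rule random_penalty)
    have "(\<lambda>T. ennreal ((lam T)\<^sup>2)) \<longlonglongrightarrow> ennreal (0\<^sup>2)"
      by (intro tendsto_ennrealI tendsto_power that)
    then show "(\<lambda>T. \<integral>\<^sup>+\<omega>. ennreal ((lam T)\<^sup>2) \<partial>M) \<longlonglongrightarrow> 0"
      by (simp add: emeasure_space_1)
  qed (use that in auto)
  show ?thesis
  proof (intro conjI allI impI; elim conjE)
  qed (rule fixed_penalty random_penalty; blast)+
qed

end
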